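(* For any two mm-spaces $X_0,X_1$ which are not mm-isomorphic, there exists an uncountable family of $\square$-geodesics from $X_0$ to $X_1$ which are pairwise disjoint, in the sense that any two distinct geodesics of the family do not intersect anywhere except at the endpoints. In particular, every $\square$-geodesic branches everywhere.
   Context: An mm-space is a triple $(X,d_X,\mu_X)$ where $(X,d_X)$ is a complete separable metric space and $\mu_X$ is a Borel probability measure on $X$. Two mm-spaces $X,Y$ are mm-isomorphic if there is an isometry $f\colon \operatorname{supp}\mu_X\to\operatorname{supp}\mu_Y$ with $f_*\mu_X=\mu_Y$; $\mathcal{X}$ is the set of mm-isomorphism classes. A parameter of $X$ is a Borel map $\varphi\colon [0,1)\to X$ with $\varphi_*\mathcal{L}^1=\mu_X$. The box distance $\square(X,Y)$ is the infimum of $\varepsilon\ge 0$ such that there exist parameters $\varphi$ of $X$, $\psi$ of $Y$ and a Borel set $I_0\subset[0,1)$ with $\mathcal{L}^1(I_0)\ge 1-\varepsilon$ and $|d_X(\varphi(s),\varphi(t))-d_Y(\psi(s),\psi(t))|\le\varepsilon$ for all $s,t\in I_0$; it is a metric on $\mathcal{X}$. A $\square$-geodesic from $X_0$ to $X_1$ is a map $[0,1]\ni t\mapsto X_t\in\mathcal{X}$ with $\square(X_s,X_t)=|s-t|\,\square(X_0,X_1)$ for all $s,t$. *)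

theory Defs
  imports "HOL-Analysis.Analysis" "HOL-Probability.Probability"
begin

type_synonym 'a mmspace = "('a \<Rightarrow> 'a \<Rightarrow> real) \<times> 'a measure"

definition mm_dist :: "'a mmspace \<Rightarrow> 'a \<Rightarrow> 'a \<Rightarrow> real" where
  "mm_dist X = fst X"

definition mm_meas :: "'a mmspace \<Rightarrow> 'a measure" where
  "mm_meas X = snd X"

definition mm_space :: "'a mmspace \<Rightarrow> bool" where
  "mm_space X \<longleftrightarrow>
     (let d = mm_dist X; \<mu> = mm_meas X; S = space \<mu> in
       Metric_space S d \<and>
       Metric_space.mcomplete S d \<and>
       separable_space (Metric_space.mtopology S d) \<and>
       sets \<mu> = sigma_sets S {U. openin (Metric_space.mtopology S d) U} \<and>
       prob_space \<mu>)"

definition mm_supp :: "'a mmspace \<Rightarrow> 'a set" where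
  "mm_supp X = {x \<in> space (mm_meas X). \<forall>e>0.
      emeasure (mm_meas X) {y \<in> space (mm_meas X). mm_dist X x y < e} > 0}"

definition mm_iso :: "'a mmspace \<Rightarrow> 'b mmspace \<Rightarrow> bool" where
  "mm_iso X Y \<longleftrightarrow> (\<exists>f. bij_betw f (mm_supp X) (mm_supp Y) \<and>
      (\<forall>x\<in>mm_supp X. \<forall>y\<in>mm_supp X. mm_dist Y (f x) (f y) = mm_dist X x y) \<and>
      (\<forall>B\<in>sets (mm_meas Y).
         emeasure (mm_meas X) {x \<in> mm_supp X. f x \<in> B} = emeasure (mm_meas Y) B))"

definition unit_interval_L :: "real measure" where
  "unit_interval_L = restrict_space lborel {0..<1}"

definition mm_parameter :: "'a mmspace \<Rightarrow> (real \<Rightarrow> 'a) \<Rightarrow> bool" where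
  "mm_parameter X \<phi> \<longleftrightarrow> \<phi> \<in> measurable unit_interval_L (mm_meas X) \<and>
      distr unit_interval_L (mm_meas X) \<phi> = mm_meas X"

definition box_dist :: "'a mmspace \<Rightarrow> 'b mmspace \<Rightarrow> real" where
  "box_dist X Y = Inf {\<epsilon>. \<epsilon> \<ge> 0 \<and> (\<exists>\<phi> \<psi> I0. mm_parameter X \<phi> \<and> mm_parameter Y \<psi> \<and>
      I0 \<in> sets borel \<and> I0 \<subseteq> {0..<1} \<and> measure lborel I0 \<ge> 1 - \<epsilon> \<and>
      (\<forall>s\<in>I0. \<forall>t\<in>I0. \<bar>mm_dist X (\<phi> s) (\<phi> t) - mm_dist Y (\<psi> s) (\<psi> t)\<bar> \<le> \<epsilon>))}"

text \<open>A box-geodesic from X0 to X1, with values mm-spaces carried by subsets of the reals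
  (every mm-space is mm-isomorphic to one of these, since complete separable metric
  spaces have cardinality at most that of the continuum).\<close>
definition box_geodesic :: "'a mmspace \<Rightarrow> 'b mmspace \<Rightarrow> (real \<Rightarrow> real mmspace) \<Rightarrow> bool" where
  "box_geodesic X0 X1 \<gamma> \<longleftrightarrow>
     (\<forall>t\<in>{0..1}. mm_space (\<gamma> t)) \<and> mm_iso (\<gamma> 0) X0 \<and> mm_iso (\<gamma> 1) X1 \<and>
     (\<forall>s\<in>{0..1}. \<forall>t\<in>{0..1}. box_dist (\<gamma> s) (\<gamma> t) = \<bar>s - t\<bar> * box_dist X0 X1)"

end

theory Submission
  imports Defs
begin

text \<open>
  The infimum \<open>e\<close> in the box distance is attained: code points of the two spaces by sequences of
  naturals, pass to a limit of the codes of almost optimal parameters (the marginals are fixed, so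
  no mass escapes), and decode. On the optimal set of measure \<open>1 - e\<close> both metrics differ by at most
  \<open>e\<close>, so the two spaces can be glued at distance \<open>e / 2\<close> along it. At time \<open>t\<close> the core carries the
  metric \<open>(1 - t) d0 + t d1\<close>, and of the remaining mass \<open>e\<close> a portion \<open>t e\<close> has been moved from the
  first space to the second one. This changes distances at speed at most \<open>e\<close> off a set of mass
  \<open>|s - t| e\<close>, so it is a geodesic by the triangle inequality.

  The remaining mass leaves room for a modification inside the open time interval: a portion \<open>a e\<close>
  of it is discretized (more and more finely as \<open>t\<close> tends to 0 or 1), so it becomes purely atomic,
  while the rest is spread out along an extra real coordinate, so it becomes atomless. The total
  mass of the atoms is then a constant plus \<open>a e\<close>, independent of \<open>t\<close>, and separates the geodesics
  for different \<open>a\<close>.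
\<close>

section \<open>Codes and a compactness principle\<close>

text \<open>Between two core points the passage from \<open>A\<close> to \<open>B\<close> may
  already use the full speed \<open>e\<close>, so a modification has to avoid the core. As soon as
  one of two points lies off the core, shifting weight between the two ends costs only
  \<open>e / 2\<close>, the distance of a core point to its twin in the other copy. The remaining
  \<open>e / 2\<close> of the speed is shared by the discretization and the extra coordinate,
  \<open>e / 4\<close> each. Both have to fade out at times 0 and 1, where the spaces are
  prescribed; therefore the discretization is not switched on but interpolated between dyadic levels
  with a Lipschitz bound. The atoms inside the core do not depend on the time, since
  \<open>(1 - t) * A + t * B\<close> with \<open>0 < t < 1\<close> vanishes exactly where both
  \<open>A\<close> and \<open>B\<close> vanish. The spaces at all times are described by
  pseudometrics on the same unit interval, so that distances and atoms at different times can be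
  compared at the same point \<open>u\<close>.\<close>

lemma space_unit_interval_L [simp]: "space unit_interval_L = {0..<1}"
  by (simp add: unit_interval_L_def space_restrict_space)

lemma sets_unit_interval_L: "A \<in> sets unit_interval_L \<longleftrightarrow> A \<in> sets borel \<and> A \<subseteq> {0..<1}"
  unfolding unit_interval_L_def by (subst sets_restrict_space_iff) auto

lemma emeasure_unit_interval_L: "A \<subseteq> {0..<1} \<Longrightarrow> emeasure unit_interval_L A = emeasure lborel A"
  unfolding unit_interval_L_def by (subst emeasure_restrict_space) auto

lemma measure_unit_interval_L: "A \<subseteq> {0..<1} \<Longrightarrow> measure unit_interval_L A = measure lborel A"
  by (simp add: measure_def emeasure_unit_interval_L)

lemma prob_space_unit_interval_L: "prob_space unit_interval_L"
  by (rule prob_spaceI) (simp add: emeasure_unit_interval_L)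

interpretation UL: prob_space unit_interval_L
  by (rule prob_space_unit_interval_L)

text \<open>Subdividing intervals according to the masses \<open>p\<close> of cylinders yields half-open intervals, so every
  prefix of the code of every point of \<open>[0,1)\<close> has positive mass; there is no exceptional null set.\<close>

locale mass_tree =
  fixes p :: "nat list \<Rightarrow> real"
  assumes p_nonneg: "p a \<ge> 0" and p_Nil: "p [] = 1" and p_sums: "(\<lambda>j. p (a @ [j])) sums p a"
begin

text \<open>Left endpoint of the interval belonging to the prefix \<open>a\<close>: at each level
  the masses of the siblings that precede the chosen child are skipped.\<close>

definition left_end :: "nat list \<Rightarrow> real" where
  "left_end a = (\<Sum>k<length a. \<Sum>i<a ! k. p (take k a @ [i]))"

primrec prefix_at :: "real \<Rightarrow> nat \<Rightarrow> nat list" where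
  "prefix_at u 0 = []"
| "prefix_at u (Suc m) = prefix_at u m @
     [LEAST j. u < left_end (prefix_at u m) + (\<Sum>i\<le>j. p (prefix_at u m @ [i]))]"

lemma left_end_Nil [simp]: "left_end [] = 0"
  by (simp add: left_end_def)

lemma left_end_snoc: "left_end (a @ [j]) = left_end a + (\<Sum>i<j. p (a @ [i]))"
  by (simp add: left_end_def nth_append)

lemma length_prefix_at [simp]: "length (prefix_at u m) = m"
  by (induction m) auto

lemma partial_sum_le: "(\<Sum>i<j. p (a @ [i])) \<le> p a"
  using sum_le_suminf[of "\<lambda>i. p (a @ [i])" "{..<j}"] p_sums[of a] p_nonneg
  by (auto simp: sums_iff)

lemma partial_sum_mono: "i \<le> j \<Longrightarrow> (\<Sum>k<i. p (a @ [k])) \<le> (\<Sum>k<j. p (a @ [k]))"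
  by (intro sum_mono2) (auto simp: p_nonneg)

lemma prefix_at_eq_iff:
  assumes "u \<in> {0..<1}"
  shows "prefix_at u (length a) = a \<longleftrightarrow> u \<in> {left_end a..<left_end a + p a}"
proof (induction a rule: rev_induct)
  case Nil
  then show ?case using assms by (auto simp: p_Nil)
next
  case (snoc j a)
  define Q where "Q = (\<lambda>j. u < left_end a + (\<Sum>i\<le>j. p (a @ [i])))"
  have Q_mono: "Q j" if "Q i" "i \<le> j" for i j
    using that partial_sum_mono[of "Suc i" "Suc j" a] unfolding Q_def lessThan_Suc_atMost by simp
  have "prefix_at u (length (a @ [j])) = a @ [j] \<longleftrightarrow> prefix_at u (length a) = a \<and> (LEAST j. Q j) = j"
    unfolding Q_def length_append list.size prefix_at.simps add_0_right add_Suc_right append1_eq_conv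
    by (rule conj_cong) simp_all
  also have "\<dots> \<longleftrightarrow> u \<in> {left_end a..<left_end a + p a} \<and> (LEAST j. Q j) = j"
    by (simp only: snoc)
  also have "\<dots> \<longleftrightarrow> u \<in> {left_end a..<left_end a + p a} \<and> Q j \<and> (\<forall>i<j. \<not> Q i)"
  proof (intro conj_cong refl)
    assume u: "u \<in> {left_end a..<left_end a + p a}"
    \<comment> \<open>For \<open>u\<close> in the interval of \<open>a\<close> the partial sums of
      the child masses eventually exceed \<open>u - left_end a\<close>; without such a witness the
      \<open>LEAST\<close> in \<open>prefix_at\<close> would carry no information.\<close>
    have "\<exists>j. Q j"
    proof -
      have "(\<lambda>j. \<Sum>i\<le>j. p (a @ [i])) \<longlonglongrightarrow> p a"
        using p_sums[of a] by (simp add: sums_def_le)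
      then have "eventually (\<lambda>j. (\<Sum>i\<le>j. p (a @ [i])) > u - left_end a) sequentially"
        by (rule order_tendstoD) (use u in auto)
      then obtain j where "(\<Sum>i\<le>j. p (a @ [i])) > u - left_end a"
        by (auto simp: eventually_sequentially)
      then show ?thesis unfolding Q_def by (intro exI[of _ j]) simp
    qed
    then have "Q (LEAST j. Q j)"
      by (rule LeastI_ex)
    moreover have "\<not> Q i" if "i < (LEAST j. Q j)" for i
      using that by (rule not_less_Least)
    moreover have "(LEAST j. Q j) = j" if "Q j" "\<forall>i<j. \<not> Q i"
      using that by (metis LeastI not_less_Least linorder_cases)
    ultimately show "(LEAST j. Q j) = j \<longleftrightarrow> Q j \<and> (\<forall>i<j. \<not> Q i)"
      by metis
  qed
  also have "\<dots> \<longleftrightarrow> u \<in> {left_end (a @ [j])..<left_end (a @ [j]) + p (a @ [j])}"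
  proof -
    have 1: "(\<Sum>i\<le>j. p (a @ [i])) = (\<Sum>i<j. p (a @ [i])) + p (a @ [j])"
      by (simp flip: lessThan_Suc_atMost)
    \<comment> \<open>\<open>Q\<close> is monotone, so all earlier children fail as soon as the last
      predecessor of \<open>j\<close> fails, and its failure places \<open>u\<close> to the right of
      all of them.\<close>
    have 2: "(\<forall>i<j. \<not> Q i) \<and> left_end a \<le> u \<longleftrightarrow> left_end (a @ [j]) \<le> u"
    proof (cases j)
      case 0
      then show ?thesis by (simp add: left_end_snoc)
    next
      case (Suc i)
      have "(\<forall>k<j. \<not> Q k) \<longleftrightarrow> \<not> Q i"
        using Suc Q_mono by auto
      moreover have "(\<Sum>k\<le>i. p (a @ [k])) = (\<Sum>k<j. p (a @ [k]))"
        by (simp add: Suc lessThan_Suc_atMost)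
      moreover have "0 \<le> (\<Sum>k<j. p (a @ [k]))"
        by (intro sum_nonneg p_nonneg)
      ultimately show ?thesis by (auto simp: Q_def left_end_snoc)
    qed
    have 3: "Q j \<Longrightarrow> u < left_end a + p a"
      using partial_sum_le[of a "Suc j"] unfolding Q_def lessThan_Suc_atMost by simp
    show ?thesis using 1 2 3 by (auto simp: Q_def left_end_snoc)
  qed
  finally show ?case .
qed

definition digit :: "real \<Rightarrow> nat \<Rightarrow> nat" where
  "digit u m = last (prefix_at u (Suc m))"

lemma prefix_at_eq_map: "prefix_at u m = map (digit u) [0..<m]"
  by (induction m) (auto simp: digit_def)

lemma digit_cylinder:
  "{u \<in> {0..<1}. map (digit u) [0..<length a] = a} = {left_end a..<left_end a + p a} \<inter> {0..<1}"
  using prefix_at_eq_iff[of _ a] by (auto simp flip: prefix_at_eq_map)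

lemma left_end_bounds: "0 \<le> left_end a \<and> left_end a + p a \<le> 1"
proof (induction a rule: rev_induct)
  case (snoc j a)
  have "0 \<le> (\<Sum>k<j. p (a @ [k]))"
    by (intro sum_nonneg p_nonneg)
  then show ?case
    using snoc partial_sum_le[of a "Suc j"] by (auto simp: left_end_snoc)
qed (simp add: p_Nil)

lemma digit_cylinder':
  "{u \<in> {0..<1}. map (digit u) [0..<length a] = a} = {left_end a..<left_end a + p a}"
  using left_end_bounds[of a] unfolding digit_cylinder by auto

end

lemma map_upt_eq_iff: "map g [0..<length a] = a \<longleftrightarrow> (\<forall>i<length a. g i = a ! i)"
proof
  assume "map g [0..<length a] = a"
  then have "map g [0..<length a] ! i = a ! i" for i
    by (rule arg_cong)
  then show "\<forall>i<length a. g i = a ! i"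
    by (metis add_0 nth_map_upt diff_zero)
qed (rule nth_equalityI, simp_all)

lemma sets_map_upt_eq:
  assumes "\<And>m. (\<lambda>w. f w m) \<in> M \<rightarrow>\<^sub>M count_space (UNIV :: nat set)"
  shows "{w \<in> space M. map (f w) [0..<length a] = a} \<in> sets M"
proof -
  have "{w \<in> space M. map (f w) [0..<length a] = a} = {w \<in> space M. \<forall>i\<in>{..<length a}. f w i = a ! i}"
    by (simp add: map_upt_eq_iff Ball_def)
  also have "\<dots> \<in> sets M"
  proof (rule sets.sets_Collect_finite_All)
    fix i
    have "(\<lambda>w. f w i) -` {a ! i} \<inter> space M \<in> sets M"
      by (rule measurable_sets[OF assms]) simp
    then show "{w \<in> space M. f w i = a ! i} \<in> sets M"
      by (simp add: vimage_def Int_def conj_commute)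
  qed simp
  finally show ?thesis .
qed

section \<open>Subsequential limits of cylinder masses\<close>

lemma compact_unit_cube: "compact {f :: nat list \<Rightarrow> real. \<forall>a. f a \<in> {0..1}}"
proof -
  have "compactin (product_topology (\<lambda>_::nat list. euclideanreal) UNIV) (PiE UNIV (\<lambda>_. {0..1::real}))"
    by (subst compactin_PiE) auto
  moreover have "PiE UNIV (\<lambda>_::nat list. {0..1::real}) = {f. \<forall>a. f a \<in> {0..1}}"
    by (auto simp: PiE_def Pi_def)
  ultimately show ?thesis
    by (simp add: euclidean_product_topology)
qed

text \<open>Words form a countable index type, so the product topology is first countable and
  Tychonoff compactness yields one subsequence that converges at all words.\<close>

lemma unit_cube_convergent_subsequence:
  fixes P :: "nat \<Rightarrow> nat list \<Rightarrow> real"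
  assumes "\<And>n a. 0 \<le> P n a" "\<And>n a. P n a \<le> 1"
  obtains r :: "nat \<Rightarrow> nat" and p where "strict_mono r" "\<And>a. (\<lambda>n. P (r n) a) \<longlonglongrightarrow> p a"
proof -
  have "seq_compact {f :: nat list \<Rightarrow> real. \<forall>a. f a \<in> {0..1}}"
    by (rule compact_imp_seq_compact[OF compact_unit_cube])
  then obtain p r where r: "strict_mono r" "(P \<circ> r) \<longlonglongrightarrow> p"
    using assms unfolding seq_compact_def by (smt (verit, best) atLeastAtMost_iff mem_Collect_eq)
  have "(\<lambda>n. P (r n) a) \<longlonglongrightarrow> p a" for a
  proof -
    have "continuous_on UNIV (\<lambda>f :: nat list \<Rightarrow> real. f a)"
      by (rule continuous_on_product_coordinates)
    then have "isCont (\<lambda>f :: nat list \<Rightarrow> real. f a) p"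
      unfolding continuous_on_eq_continuous_at[OF open_UNIV] by blast
    from isCont_tendsto_compose[OF this r(2)] show ?thesis
      by simp
  qed
  with r(1) show thesis by (rule that)
qed

text \<open>Splitting by the \<open>m\<close> earlier digits turns an event about a single digit
  into a countable disjoint union of cylinders.\<close>

lemma digit_eq_union:
  fixes f :: "'c \<Rightarrow> nat \<Rightarrow> nat"
  shows "{w \<in> \<Omega>. f w m = j} = (\<Union>a\<in>{a. length a = m}. {w \<in> \<Omega>. map (f w) [0..<length (a @ [j])] = a @ [j]})"
proof (rule set_eqI, rule iffI)
  fix w assume "w \<in> {w \<in> \<Omega>. f w m = j}"
  then show "w \<in> (\<Union>a\<in>{a. length a = m}. {w \<in> \<Omega>. map (f w) [0..<length (a @ [j])] = a @ [j]})"
    by (intro UN_I[of "map (f w) [0..<m]"]) auto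
next
  fix w assume "w \<in> (\<Union>a\<in>{a. length a = m}. {w \<in> \<Omega>. map (f w) [0..<length (a @ [j])] = a @ [j]})"
  then show "w \<in> {w \<in> \<Omega>. f w m = j}"
    by auto
qed

text \<open>Helly selection for laws of code sequences. The majorant \<open>q m\<close>, summable
  and independent of \<open>n\<close>, keeps mass from escaping to large digits. A prefix of the
  limit code has positive limit mass and is therefore eventually realized. The bound on single
  digits survives as an inequality, which suffices by \<open>countable_law_eq\<close>. The event
  that digit 0 equals 0 becomes an initial interval because it belongs to the first child of the
  root.\<close>

lemma code_compactness:
  fixes M :: "nat \<Rightarrow> 'c measure" and \<xi> :: "nat \<Rightarrow> 'c \<Rightarrow> nat \<Rightarrow> nat" and q :: "nat \<Rightarrow> nat \<Rightarrow> real"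
  assumes prob: "\<And>n. prob_space (M n)"
    and meas: "\<And>n m. (\<lambda>w. \<xi> n w m) \<in> M n \<rightarrow>\<^sub>M count_space UNIV"
    and bound: "\<And>n m j. measure (M n) {w \<in> space (M n). \<xi> n w m = j} \<le> q m j"
    and sq: "\<And>m. summable (q m)"
  obtains r :: "nat \<Rightarrow> nat" and \<zeta> :: "real \<Rightarrow> nat \<Rightarrow> nat" and c where
    "strict_mono r"
    "\<And>m. (\<lambda>u. \<zeta> u m) \<in> unit_interval_L \<rightarrow>\<^sub>M count_space UNIV"
    "\<And>u m. u \<in> {0..<1} \<Longrightarrow> eventually (\<lambda>n. \<exists>w\<in>space (M (r n)). \<forall>i<m. \<xi> (r n) w i = \<zeta> u i) sequentially"
    "\<And>m j. measure unit_interval_L {u \<in> {0..<1}. \<zeta> u m = j} \<le> q m j"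
    "(\<lambda>n. measure (M (r n)) {w \<in> space (M (r n)). \<xi> (r n) w 0 = 0}) \<longlonglongrightarrow> c"
    "{u \<in> {0..<1}. \<zeta> u 0 = 0} = {0..<c}" "c \<ge> 0"
proof -
  define cyl where "cyl = (\<lambda>n a. {w \<in> space (M n). map (\<xi> n w) [0..<length a] = a})"
  define P where "P = (\<lambda>n a. measure (M n) (cyl n a))"
  have cyl_sets: "cyl n a \<in> sets (M n)" for n a
    unfolding cyl_def by (rule sets_map_upt_eq[OF meas])
  have "0 \<le> P n a" "P n a \<le> 1" for n a
    using prob_space.prob_le_1[OF prob] by (auto simp: P_def)
  then obtain r p where r: "strict_mono r" and p: "\<And>a. (\<lambda>n. P (r n) a) \<longlonglongrightarrow> p a"
    using unit_cube_convergent_subsequence by blast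
  have cyl_UN: "cyl n a = (\<Union>j. cyl n (a @ [j]))" for n a
    by (auto simp: cyl_def)
  have cyl_sub: "cyl n (a @ [j]) \<subseteq> {w \<in> space (M n). \<xi> n w (length a) = j}" for n a j
    by (auto simp: cyl_def)
  have dig_sets: "{w \<in> space (M n). \<xi> n w m = j} \<in> sets (M n)" for n m j
    using measurable_sets[OF meas, of "{j}" n m] by (simp add: vimage_def Int_def conj_commute)
  have P_le: "P n (a @ [j]) \<le> q (length a) j" for n a j
  proof -
    interpret prob_space "M n" by (rule prob)
    have "P n (a @ [j]) \<le> measure (M n) {w \<in> space (M n). \<xi> n w (length a) = j}"
      unfolding P_def by (rule finite_measure_mono[OF cyl_sub dig_sets])
    then show ?thesis using bound[of n "length a" j] by linarith
  qed
  have P_sums: "(\<lambda>j. P n (a @ [j])) sums P n a" for n a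
  proof -
    interpret prob_space "M n" by (rule prob)
    have "disjoint_family (\<lambda>j. cyl n (a @ [j]))"
      by (auto simp: disjoint_family_on_def cyl_def)
    then show ?thesis unfolding P_def
      by (subst (2) cyl_UN) (intro finite_measure_UNION, auto simp: cyl_sets)
  qed
  interpret mass_tree p
  proof
    show nn: "0 \<le> p a" for a
      by (rule LIMSEQ_le_const[OF p]) (auto simp: P_def)
    have "P n [] = 1" for n
      using prob_space.prob_space[OF prob] by (simp add: P_def cyl_def)
    then show "p [] = 1"
      using p[of "[]"] by (simp add: LIMSEQ_const_iff)
    show "(\<lambda>j. p (a @ [j])) sums p a" for a
    proof -
      \<comment> \<open>Tannery's theorem exchanges the limit with the sum over the children, which
        makes the limit masses additive again.\<close>
      have T: "eventually (\<lambda>n. summable (\<lambda>j. norm (P (r n) (a @ [j])))) sequentially \<and>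
           summable (\<lambda>j. norm (p (a @ [j]))) \<and>
           ((\<lambda>n. suminf (\<lambda>j. P (r n) (a @ [j]))) \<longlongrightarrow> (\<Sum>j. p (a @ [j]))) sequentially"
      proof (rule tannerys_theorem[OF p _ sq[of "length a"]])
        have "norm (P (r n) (a @ [k])) \<le> q (length a) k" for n k
          using P_le[of "r n" a k] by (simp add: P_def)
        then show "eventually (\<lambda>(k, n). norm (P (r n) (a @ [k])) \<le> q (length a) k) (sequentially \<times>\<^sub>F sequentially)"
          by (intro always_eventually) auto
      qed simp
      have "(\<lambda>n. P (r n) a) \<longlonglongrightarrow> (\<Sum>j. p (a @ [j]))"
        using T P_sums by (simp add: sums_iff)
      with p[of a] have "(\<Sum>j. p (a @ [j])) = p a"
        using LIMSEQ_unique by blast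
      with T show ?thesis
        using nn by (simp add: sums_iff)
    qed
  qed
  have cylU: "emeasure unit_interval_L {u \<in> {0..<1}. map (digit u) [0..<length a] = a} = ennreal (p a)" for a
  proof -
    have "{left_end a..<left_end a + p a} \<subseteq> {0..<1}"
      using left_end_bounds[of a] by auto
    from emeasure_unit_interval_L[OF this] show ?thesis
      unfolding digit_cylinder' by (simp add: p_nonneg)
  qed
  have cylU_sets: "{u \<in> {0..<1}. map (digit u) [0..<length a] = a} \<in> sets unit_interval_L" for a
    unfolding digit_cylinder' sets_unit_interval_L using left_end_bounds[of a] by auto
  have digU_sets: "{u \<in> {0..<1}. digit u m = j} \<in> sets unit_interval_L" for m j
    unfolding digit_eq_union by (intro sets.countable_UN' image_subsetI cylU_sets countableI_type)
  have 2: "(\<lambda>u. digit u m) \<in> unit_interval_L \<rightarrow>\<^sub>M count_space UNIV" for m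
  proof (rule measurable_count_space_eq_countable[THEN iffD2])
    show "(\<lambda>u. digit u m) \<in> space unit_interval_L \<rightarrow> UNIV \<and>
      (\<forall>a\<in>UNIV. (\<lambda>u. digit u m) -` {a} \<inter> space unit_interval_L \<in> sets unit_interval_L)"
      using digU_sets[of m] by (simp add: vimage_def Int_def conj_commute)
  qed auto
  have 3: "eventually (\<lambda>n. \<exists>w\<in>space (M (r n)). \<forall>i<m. \<xi> (r n) w i = digit u i) sequentially"
    if u: "u \<in> {0..<1}" for u m
  proof -
    define a where "a = map (digit u) [0..<m]"
    have "u \<in> {u \<in> {0..<1}. map (digit u) [0..<length a] = a}"
      using u by (simp add: a_def)
    then have "p a > 0"
      unfolding digit_cylinder' by auto
    with p[of a] have "eventually (\<lambda>n. P (r n) a > 0) sequentially"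
      by (rule order_tendstoD)
    then show ?thesis
    proof eventually_elim
      case (elim n)
      then have "cyl (r n) a \<noteq> {}"
        by (auto simp: P_def)
      then show ?case
        by (fastforce simp: cyl_def a_def)
    qed
  qed
  \<comment> \<open>There are infinitely many prefixes of length \<open>m\<close> to sum over;
    Fatou's lemma yields the inequality.\<close>
  have 4: "measure unit_interval_L {u \<in> {0..<1}. digit u m = j} \<le> q m j" for m j
  proof -
    let ?L = "{a :: nat list. length a = m}"
    have "emeasure unit_interval_L {u \<in> {0..<1}. digit u m = j}
        = (\<integral>\<^sup>+a. ennreal (p (a @ [j])) \<partial>count_space ?L)"
      unfolding digit_eq_union cylU[symmetric]
      by (rule emeasure_UN_countable[OF cylU_sets]) (auto simp: disjoint_family_on_def)
    also have "\<dots> = (\<integral>\<^sup>+a. liminf (\<lambda>n. ennreal (P (r n) (a @ [j]))) \<partial>count_space ?L)"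
      by (intro nn_integral_cong) (metis lim_imp_Liminf p tendsto_ennrealI trivial_limit_sequentially)
    also have "\<dots> \<le> liminf (\<lambda>n. \<integral>\<^sup>+a. ennreal (P (r n) (a @ [j])) \<partial>count_space ?L)"
      by (intro nn_integral_liminf) auto
    also have "\<dots> \<le> liminf (\<lambda>n. ennreal (q m j))"
    proof (intro Liminf_mono always_eventually allI)
      fix n
      interpret prob_space "M (r n)" by (rule prob)
      have "(\<integral>\<^sup>+a. ennreal (P (r n) (a @ [j])) \<partial>count_space ?L)
          = emeasure (M (r n)) {w \<in> space (M (r n)). \<xi> (r n) w m = j}"
        unfolding digit_eq_union P_def cyl_def emeasure_eq_measure[symmetric]
        by (rule emeasure_UN_countable[OF cyl_sets[unfolded cyl_def], symmetric])
          (auto simp: disjoint_family_on_def)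
      also have "\<dots> \<le> ennreal (q m j)"
        unfolding emeasure_eq_measure by (intro ennreal_leI bound)
      finally show "(\<integral>\<^sup>+a. ennreal (P (r n) (a @ [j])) \<partial>count_space ?L) \<le> ennreal (q m j)" .
    qed
    finally have "emeasure unit_interval_L {u \<in> {0..<1}. digit u m = j} \<le> ennreal (q m j)"
      by (simp add: Liminf_const)
    moreover have "0 \<le> q m j"
      using bound[of 0 m j] measure_nonneg order_trans by blast
    ultimately show ?thesis
      by (simp add: UL.emeasure_eq_measure)
  qed
  have 5: "(\<lambda>n. measure (M (r n)) {w \<in> space (M (r n)). \<xi> (r n) w 0 = 0}) \<longlonglongrightarrow> p [0]"
    using p[of "[0]"] by (simp add: P_def cyl_def)
  have "left_end [0] = 0"
    using left_end_snoc[of "[]" 0] by simp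
  then have 6: "{u \<in> {0..<1}. digit u 0 = 0} = {0..<p [0]}"
    using digit_cylinder'[of "[0]"] by simp
  show thesis
    by (rule that[OF r 2 3 4 5 6 p_nonneg])
qed

text \<open>The inequality extends from points to every set and to its complement, and both totals
  are 1, so neither inequality can be strict.\<close>

lemma countable_law_eq:
  fixes c1 :: "'c \<Rightarrow> nat" and c2 :: "'d \<Rightarrow> nat"
  assumes "prob_space M1" "prob_space M2"
    and [measurable]: "c1 \<in> M1 \<rightarrow>\<^sub>M count_space UNIV" "c2 \<in> M2 \<rightarrow>\<^sub>M count_space UNIV"
    and le: "\<And>j. measure M1 {w \<in> space M1. c1 w = j} \<le> measure M2 {w \<in> space M2. c2 w = j}"
  shows "distr M1 (count_space UNIV) c1 = distr M2 (count_space UNIV) c2"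
proof -
  let ?N1 = "distr M1 (count_space UNIV) c1" and ?N2 = "distr M2 (count_space UNIV) c2"
  interpret N1: prob_space ?N1 by (rule prob_space.prob_space_distr[OF assms(1)]) measurable
  interpret N2: prob_space ?N2 by (rule prob_space.prob_space_distr[OF assms(2)]) measurable
  have single: "emeasure ?N1 {j} \<le> emeasure ?N2 {j}" for j
  proof -
    have "measure ?N1 {j} \<le> measure ?N2 {j}"
      using le[of j] by (simp add: measure_distr vimage_def Int_def conj_commute)
    then show ?thesis by (simp add: N1.emeasure_eq_measure N2.emeasure_eq_measure)
  qed
  have all: "emeasure ?N1 A \<le> emeasure ?N2 A" for A
  proof -
    have "emeasure ?N1 A = (\<integral>\<^sup>+j. emeasure ?N1 {j} \<partial>count_space A)"
      by (rule emeasure_countable_singleton) auto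
    also have "\<dots> \<le> (\<integral>\<^sup>+j. emeasure ?N2 {j} \<partial>count_space A)"
      by (intro nn_integral_mono single)
    also have "\<dots> = emeasure ?N2 A"
      by (rule emeasure_countable_singleton[symmetric]) auto
    finally show ?thesis .
  qed
  show ?thesis
  proof (rule measure_eqI)
    fix A :: "nat set"
    have "measure ?N1 (UNIV - A) \<le> measure ?N2 (UNIV - A)" "measure ?N1 A \<le> measure ?N2 A"
      using all[of "UNIV - A"] all[of A] by (simp_all add: N1.emeasure_eq_measure N2.emeasure_eq_measure)
    moreover have "measure ?N1 (UNIV - A) = 1 - measure ?N1 A" "measure ?N2 (UNIV - A) = 1 - measure ?N2 A"
      using N1.prob_compl[of A] N2.prob_compl[of A] by simp_all
    ultimately show "emeasure ?N1 A = emeasure ?N2 A"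
      by (simp add: N1.emeasure_eq_measure N2.emeasure_eq_measure)
  qed simp
qed

section \<open>Metric measure spaces and their parameters\<close>

locale mm =
  fixes X :: "'a mmspace"
  assumes mm_space: "mm_space X"
begin

abbreviation "S \<equiv> space (mm_meas X)"
abbreviation "d \<equiv> mm_dist X"
abbreviation "\<mu> \<equiv> mm_meas X"

sublocale Metric_space S d
  using mm_space by (simp add: mm_space_def Let_def)

sublocale prob_space \<mu>
  using mm_space by (simp add: mm_space_def Let_def)

lemma complete: mcomplete
  using mm_space by (simp add: mm_space_def Let_def)

lemma sets_eq: "sets \<mu> = sigma_sets S {U. openin mtopology U}"
  using mm_space by (simp add: mm_space_def Let_def)

lemma sets_openin: "openin mtopology U \<Longrightarrow> U \<in> sets \<mu>"
  unfolding sets_eq by (rule sigma_sets.Basic) simp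

lemma sets_closedin: "closedin mtopology F \<Longrightarrow> F \<in> sets \<mu>"
proof -
  assume F: "closedin mtopology F"
  then have "S - (S - F) \<in> sets \<mu>"
    by (intro sets.compl_sets sets_openin) (simp add: closedin_def)
  moreover have "S - (S - F) = F"
    using closedin_subset[OF F] by auto
  ultimately show ?thesis by simp
qed

lemma ex_dense_sequence: "\<exists>x :: nat \<Rightarrow> 'a. range x \<subseteq> S \<and> (\<forall>y\<in>S. \<forall>e>0. \<exists>i. d (x i) y < e)"
proof -
  obtain C where C: "countable C" "C \<subseteq> S" "mtopology closure_of C = S"
    using mm_space by (auto simp: mm_space_def Let_def separable_space_def)
  have "C \<noteq> {}"
    using C(3) not_empty by auto
  show ?thesis
  proof (intro exI[of _ "from_nat_into C"] conjI ballI allI impI)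
    show "range (from_nat_into C) \<subseteq> S"
      using C(2) \<open>C \<noteq> {}\<close> by (auto intro: from_nat_into)
    fix y and e :: real assume "y \<in> S" "e > 0"
    then obtain z where "z \<in> C" "d y z < e"
      using C(3) unfolding metric_closure_of by fastforce
    then show "\<exists>i. d (from_nat_into C i) y < e"
      by (metis C(1) commute from_nat_into_surj)
  qed
qed

definition xs :: "nat \<Rightarrow> 'a" where
  "xs = (SOME x. range x \<subseteq> S \<and> (\<forall>y\<in>S. \<forall>e>0. \<exists>i. d (x i) y < e))"

lemma xs_in [simp]: "xs i \<in> S" and xs_dense: "y \<in> S \<Longrightarrow> e > 0 \<Longrightarrow> \<exists>i. d (xs i) y < e"
  using someI_ex[OF ex_dense_sequence] unfolding xs_def by auto

text \<open>Balls of radius \<open>1 / Suc n\<close> around the dense sequence are a countable base.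
  The countable union over them is what later reduces measurability to balls around
  \<open>xs i\<close>.\<close>

lemma openin_iff_balls:
  assumes "openin mtopology V" and yS: "y \<in> S"
  shows "y \<in> V \<longleftrightarrow> (\<exists>i n. mball (xs i) (1 / Suc n) \<subseteq> V \<and> d (xs i) y < 1 / Suc n)"
proof
  assume y: "y \<in> V"
  then obtain r where r: "r > 0" "mball y r \<subseteq> V"
    using assms unfolding openin_mtopology by blast
  obtain n where n: "1 / Suc n < r / 2"
    using r(1) by (metis half_gt_zero nat_approx_posE)
  obtain i where i: "d (xs i) y < 1 / Suc n"
    using xs_dense[OF yS, of "1 / Suc n"] by auto
  have "mball (xs i) (1 / Suc n) \<subseteq> V"
  proof
    fix z assume "z \<in> mball (xs i) (1 / Suc n)"
    then have "z \<in> S" "d y z < r"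
      using triangle''[of y "xs i" z] i n yS by auto
    then show "z \<in> V" using r(2) yS by auto
  qed
  then show "\<exists>i n. mball (xs i) (1 / Suc n) \<subseteq> V \<and> d (xs i) y < 1 / Suc n"
    using i by blast
next
  assume "\<exists>i n. mball (xs i) (1 / Suc n) \<subseteq> V \<and> d (xs i) y < 1 / Suc n"
  then obtain i n where "mball (xs i) (1 / Suc n) \<subseteq> V" "y \<in> mball (xs i) (1 / Suc n)"
    using yS by auto
  then show "y \<in> V" by blast
qed

lemma measurableI_balls:
  assumes f: "\<And>w. w \<in> space M \<Longrightarrow> f w \<in> S"
    and d: "\<And>i r. {w \<in> space M. d (xs i) (f w) < r} \<in> sets M"
  shows "f \<in> M \<rightarrow>\<^sub>M \<mu>"
proof (rule measurable_sigma_sets[OF sets_eq])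
  show "f \<in> space M \<rightarrow> S" using f by auto
  fix V assume "V \<in> {U. openin mtopology U}"
  then have V: "openin mtopology V" by simp
  have "f -` V \<inter> space M = (\<Union>(i, n)\<in>{(i, n). mball (xs i) (1 / Suc n) \<subseteq> V}. {w \<in> space M. d (xs i) (f w) < 1 / Suc n})"
  proof (rule set_eqI)
    fix w
    show "w \<in> f -` V \<inter> space M \<longleftrightarrow> w \<in> (\<Union>(i, n)\<in>{(i, n). mball (xs i) (1 / Suc n) \<subseteq> V}. {w \<in> space M. d (xs i) (f w) < 1 / Suc n})"
      using openin_iff_balls[OF V f, of w] by blast
  qed
  also have "\<dots> \<in> sets M"
    by (intro sets.countable_UN' countableI_type image_subsetI) (auto intro: d)
  finally show "f -` V \<inter> space M \<in> sets M" .
qed (use openin_subset[of mtopology] in fastforce)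

lemma dist_measurable:
  assumes f: "f \<in> M \<rightarrow>\<^sub>M \<mu>" and x: "x \<in> S"
  shows "(\<lambda>w. d x (f w)) \<in> borel_measurable M"
proof (subst borel_measurable_iff_less, intro allI)
  fix a
  have "{w \<in> space M. d x (f w) < a} = f -` mball x a \<inter> space M"
    using measurable_space[OF f] x by auto
  also have "\<dots> \<in> sets M"
    by (rule measurable_sets[OF f sets_openin]) simp
  finally show "{w \<in> space M. d x (f w) < a} \<in> sets M" .
qed

section \<open>Codes of points, and laws determined by codes\<close>

definition code :: "nat \<Rightarrow> 'a \<Rightarrow> nat" where
  "code m y = (LEAST i. d (xs i) y < (1/2) ^ m)"

lemma code_dist: "y \<in> S \<Longrightarrow> d (xs (code m y)) y < (1/2) ^ m"
  unfolding code_def using xs_dense[of y "(1/2) ^ m"] by (auto intro: LeastI_ex)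

lemma measurable_code:
  assumes f: "f \<in> M \<rightarrow>\<^sub>M \<mu>"
  shows "(\<lambda>w. code m (f w)) \<in> M \<rightarrow>\<^sub>M count_space UNIV"
proof -
  have [measurable]: "(\<lambda>w. d (xs i) (f w)) \<in> borel_measurable M" for i
    by (rule dist_measurable[OF f]) simp
  show ?thesis unfolding code_def by measurable
qed

text \<open>Thickening: a first point in \<open>F\<close> has its code in the set \<open>J\<close>
  of codes near \<open>F\<close>, the code laws agree, and a code in \<open>J\<close> forces the
  second point into a neighbourhood of \<open>F\<close>. As \<open>m\<close> grows these
  neighbourhoods shrink to the closed set \<open>F\<close>. The digits \<open>c1\<close>,
  \<open>c2\<close> are only required to approximate at rate \<open>(1/2) ^ m\<close>; they may
  differ from the values of \<open>code\<close>.\<close>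

lemma law_le_closed:
  fixes f1 :: "'c \<Rightarrow> 'a" and f2 :: "'d \<Rightarrow> 'a"
  assumes "prob_space M1" "prob_space M2"
    and f1: "f1 \<in> M1 \<rightarrow>\<^sub>M \<mu>" and f2: "f2 \<in> M2 \<rightarrow>\<^sub>M \<mu>"
    and c1: "\<And>m. (\<lambda>w. c1 w m) \<in> M1 \<rightarrow>\<^sub>M count_space UNIV"
    and c2: "\<And>m. (\<lambda>w. c2 w m) \<in> M2 \<rightarrow>\<^sub>M count_space UNIV"
    and law: "\<And>m. distr M1 (count_space UNIV) (\<lambda>w. c1 w m) = distr M2 (count_space UNIV) (\<lambda>w. c2 w m)"
    and d1: "\<And>w m. w \<in> space M1 \<Longrightarrow> d (xs (c1 w m)) (f1 w) \<le> (1/2) ^ m"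
    and d2: "\<And>w m. w \<in> space M2 \<Longrightarrow> d (xs (c2 w m)) (f2 w) \<le> (1/2) ^ m"
    and F: "closedin mtopology F"
  shows "measure M1 (f1 -` F \<inter> space M1) \<le> measure M2 (f2 -` F \<inter> space M2)"
proof -
  interpret M1: prob_space M1 by fact
  interpret M2: prob_space M2 by fact
  have FS: "F \<subseteq> S" using closedin_subset[OF F] by simp
  have f1S: "f1 w \<in> S" if "w \<in> space M1" for w using measurable_space[OF f1 that] .
  have f2S: "f2 w \<in> S" if "w \<in> space M2" for w using measurable_space[OF f2 that] .
  \<comment> \<open>Two code errors of \<open>(1/2) ^ m\<close> add up below; the factor 3 leaves
    room for the strict inequality of an open ball.\<close>
  define N where "N = (\<lambda>m. \<Union>y\<in>F. mball y (3 * (1/2) ^ m))"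
  have N_sets: "N m \<in> sets \<mu>" for m
    unfolding N_def by (intro sets_openin openin_Union) auto
  have le: "measure M1 (f1 -` F \<inter> space M1) \<le> measure M2 (f2 -` N m \<inter> space M2)" for m
  proof -
    define J where "J = {j. \<exists>y\<in>F. d (xs j) y \<le> (1/2) ^ m}"
    have "measure M1 (f1 -` F \<inter> space M1) \<le> measure M1 ((\<lambda>w. c1 w m) -` J \<inter> space M1)"
      by (intro M1.finite_measure_mono measurable_sets[OF c1]) (use d1 in \<open>auto simp: J_def\<close>)
    also have "\<dots> = measure (distr M1 (count_space UNIV) (\<lambda>w. c1 w m)) J"
      by (simp add: measure_distr[OF c1])
    also have "\<dots> = measure M2 ((\<lambda>w. c2 w m) -` J \<inter> space M2)"
      unfolding law by (simp add: measure_distr[OF c2])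
    also have "\<dots> \<le> measure M2 (f2 -` N m \<inter> space M2)"
    proof (intro M2.finite_measure_mono measurable_sets[OF f2 N_sets] subsetI)
      fix w assume "w \<in> (\<lambda>w. c2 w m) -` J \<inter> space M2"
      then obtain y where w: "w \<in> space M2" and y: "y \<in> F" "d (xs (c2 w m)) y \<le> (1/2) ^ m"
        by (auto simp: J_def)
      have yS: "y \<in> S" using y FS by auto
      have "d y (f2 w) \<le> d (xs (c2 w m)) y + d (xs (c2 w m)) (f2 w)"
        using triangle''[of y "xs (c2 w m)" "f2 w"] yS f2S[OF w] by (simp add: commute)
      also have "\<dots> < 3 * (1/2) ^ m"
        using y(2) d2[OF w, of m] zero_less_power[of "1/2 :: real" m] by linarith
      finally show "w \<in> f2 -` N m \<inter> space M2"
        using w y(1) yS f2S[OF w] by (auto simp: N_def)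
    qed
    finally show ?thesis .
  qed
  have dec: "decseq N"
  proof (intro decseq_SucI subsetI)
    fix n x assume "x \<in> N (Suc n)"
    then obtain y where y: "y \<in> F" "x \<in> mball y (3 * (1/2) ^ Suc n)"
      unfolding N_def by blast
    have "3 * (1/2) ^ Suc n \<le> 3 * (1/2 :: real) ^ n" by simp
    from mball_subset_concentric[OF this] y show "x \<in> N n" unfolding N_def by blast
  qed
  have INT: "(\<Inter>m. N m) = F"
  proof (intro equalityI subsetI)
    fix x assume x: "x \<in> (\<Inter>m. N m)"
    then have "x \<in> N 0" by blast
    then have xS: "x \<in> S" by (auto simp: N_def)
    have "\<exists>y\<in>F. y \<in> mball x r" if r: "r > 0" for r
    proof -
      obtain m where m: "(1/2 :: real) ^ m < r / 3"
        using real_arch_pow_inv[of "r / 3" "1 / 2"] r by auto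
      have "x \<in> N m" using x by blast
      then obtain y where "y \<in> F" "d y x < 3 * (1/2) ^ m"
        by (auto simp: N_def)
      then show ?thesis
        using m xS FS by (intro bexI[of _ y]) (auto simp: commute)
    qed
    then have "x \<in> mtopology closure_of F"
      using xS unfolding metric_closure_of by auto
    then show "x \<in> F" using closure_of_closedin[OF F] by simp
  next
    fix x assume "x \<in> F"
    then have "x \<in> N m" for m
      unfolding N_def using FS by (intro UN_I[of x]) auto
    then show "x \<in> (\<Inter>m. N m)" by blast
  qed
  have "(\<lambda>m. measure M2 (f2 -` N m \<inter> space M2)) \<longlonglongrightarrow> measure M2 (\<Inter>m. f2 -` N m \<inter> space M2)"
    using dec measurable_sets[OF f2 N_sets]
    by (intro M2.finite_Lim_measure_decseq) (auto simp: decseq_def)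
  moreover have "(\<Inter>m. f2 -` N m \<inter> space M2) = f2 -` F \<inter> space M2"
    using INT by auto
  ultimately show ?thesis
    using LIMSEQ_le_const[of _ _ "measure M1 (f1 -` F \<inter> space M1)"] le by metis
qed

lemma sets_eq_closed: "sets \<mu> = sigma_sets S {F. closedin mtopology F}"
  unfolding sets_eq
proof (rule sigma_sets_eqI)
  fix a assume "a \<in> {U. openin mtopology U}"
  then have "S - (S - a) = a" "S - a \<in> {F. closedin mtopology F}"
    using openin_subset[of mtopology a] by (auto simp: closedin_def)
  then show "a \<in> sigma_sets S {F. closedin mtopology F}"
    by (metis sigma_sets.Basic sigma_sets.Compl)
next
  fix a assume "a \<in> {F. closedin mtopology F}"
  then have "S - (S - a) = a" "S - a \<in> {F. openin mtopology F}"
    using closedin_subset[of mtopology a] by (auto simp: closedin_def)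
  then show "a \<in> sigma_sets S {F. openin mtopology F}"
    by (metis sigma_sets.Basic sigma_sets.Compl)
qed

lemma law_eqI_codes:
  fixes f1 :: "'c \<Rightarrow> 'a" and f2 :: "'d \<Rightarrow> 'a"
  assumes "prob_space M1" "prob_space M2"
    and f1: "f1 \<in> M1 \<rightarrow>\<^sub>M \<mu>" and f2: "f2 \<in> M2 \<rightarrow>\<^sub>M \<mu>"
    and c1: "\<And>m. (\<lambda>w. c1 w m) \<in> M1 \<rightarrow>\<^sub>M count_space UNIV"
    and c2: "\<And>m. (\<lambda>w. c2 w m) \<in> M2 \<rightarrow>\<^sub>M count_space UNIV"
    and law: "\<And>m. distr M1 (count_space UNIV) (\<lambda>w. c1 w m) = distr M2 (count_space UNIV) (\<lambda>w. c2 w m)"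
    and d1: "\<And>w m. w \<in> space M1 \<Longrightarrow> d (xs (c1 w m)) (f1 w) \<le> (1/2) ^ m"
    and d2: "\<And>w m. w \<in> space M2 \<Longrightarrow> d (xs (c2 w m)) (f2 w) \<le> (1/2) ^ m"
  shows "distr M1 \<mu> f1 = distr M2 \<mu> f2"
proof (rule measure_eqI_generator_eq)
  interpret M1: prob_space M1 by fact
  interpret M2: prob_space M2 by fact
  show "Int_stable {F. closedin mtopology F}"
    by (auto simp: Int_stable_def)
  show "{F. closedin mtopology F} \<subseteq> Pow S"
    using closedin_subset by fastforce
  show "sets (distr M1 \<mu> f1) = sigma_sets S {F. closedin mtopology F}"
    "sets (distr M2 \<mu> f2) = sigma_sets S {F. closedin mtopology F}"
    by (simp_all add: sets_eq_closed)
  show "range (\<lambda>_::nat. S) \<subseteq> {F. closedin mtopology F}" "(\<Union>_::nat. S) = S" by auto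
  show "emeasure (distr M1 \<mu> f1) S \<noteq> \<infinity>" for i :: nat
    using f1 by (simp add: emeasure_distr M1.emeasure_eq_measure)
  fix F assume "F \<in> {F. closedin mtopology F}"
  then have F: "closedin mtopology F" by simp
  have "measure M1 (f1 -` F \<inter> space M1) = measure M2 (f2 -` F \<inter> space M2)"
    using law_le_closed[OF assms(1,2) f1 f2 c1 c2 law d1 d2 F]
      law_le_closed[OF assms(2,1) f2 f1 c2 c1 law[symmetric] d2 d1 F] by linarith
  then show "emeasure (distr M1 \<mu> f1) F = emeasure (distr M2 \<mu> f2) F"
    using sets_closedin[OF F]
    by (simp add: emeasure_distr[OF f1] emeasure_distr[OF f2] M1.emeasure_eq_measure M2.emeasure_eq_measure)
qed

text \<open>Decoding. Each finite piece of \<open>\<zeta> u\<close> is the code of some point, but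
  the whole sequence need not be the code of the limit point. Hence the weak inequality in the
  conclusion, and the detour over approximating digits to identify the law.\<close>

lemma limit_parameter:
  fixes \<zeta> :: "real \<Rightarrow> nat \<Rightarrow> nat"
  assumes meas: "\<And>m. (\<lambda>u. \<zeta> u m) \<in> unit_interval_L \<rightarrow>\<^sub>M count_space UNIV"
    and real: "\<And>u m. u \<in> {0..<1} \<Longrightarrow> \<exists>y\<in>S. \<forall>k<m. code k y = \<zeta> u k"
    and law: "\<And>m j. measure unit_interval_L {u \<in> {0..<1}. \<zeta> u m = j} \<le> prob {y \<in> S. code m y = j}"
  obtains \<phi> where "mm_parameter X \<phi>" "\<And>u m. u \<in> {0..<1} \<Longrightarrow> d (xs (\<zeta> u m)) (\<phi> u) \<le> (1/2) ^ m"
proof -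
  \<comment> \<open>A point whose code realizes a long enough prefix is close to both dense
    points.\<close>
  have near: "d (xs (\<zeta> u m)) (xs (\<zeta> u n)) \<le> (1/2) ^ m + (1/2) ^ n" if u: "u \<in> {0..<1}" for u m n
  proof -
    obtain y where y: "y \<in> S" "\<forall>k<Suc (max m n). code k y = \<zeta> u k"
      using real[OF u] by blast
    have "\<zeta> u m = code m y" "\<zeta> u n = code n y"
      using y(2) by auto
    then have "d (xs (\<zeta> u m)) y < (1/2) ^ m" "d (xs (\<zeta> u n)) y < (1/2) ^ n"
      using code_dist[OF y(1)] by auto
    then show ?thesis
      using triangle'[of "xs (\<zeta> u m)" y "xs (\<zeta> u n)"] y(1) commute
      by (smt (verit) triangle xs_in)
  qed
  have "\<exists>z. limitin mtopology (\<lambda>m. xs (\<zeta> u m)) z sequentially" if u: "u \<in> {0..<1}" for u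
  proof -
    have "MCauchy (\<lambda>m. xs (\<zeta> u m))"
      unfolding MCauchy_def
    proof (intro conjI allI impI)
      fix e :: real assume "e > 0"
      then obtain N where N: "(1/2 :: real) ^ N < e / 2"
        using real_arch_pow_inv[of "e / 2" "1 / 2"] by auto
      have "d (xs (\<zeta> u n)) (xs (\<zeta> u n')) < e" if "N \<le> n" "N \<le> n'" for n n'
      proof -
        have "(1/2 :: real) ^ n \<le> (1/2) ^ N" "(1/2 :: real) ^ n' \<le> (1/2) ^ N"
          using that by (auto intro: power_decreasing)
        then show ?thesis using near[OF u, of n n'] N by linarith
      qed
      then show "\<exists>N. \<forall>n n'. N \<le> n \<longrightarrow> N \<le> n' \<longrightarrow> d (xs (\<zeta> u n)) (xs (\<zeta> u n')) < e"
        by blast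
    qed auto
    then show ?thesis using complete unfolding mcomplete_def by blast
  qed
  then obtain \<phi> where lim: "\<And>u. u \<in> {0..<1} \<Longrightarrow> limitin mtopology (\<lambda>m. xs (\<zeta> u m)) (\<phi> u) sequentially"
    by metis
  have \<phi>S: "\<phi> u \<in> S" if "u \<in> {0..<1}" for u
    using lim[OF that] limitin_mspace by blast
  have dlim: "(\<lambda>m. d x (xs (\<zeta> u m))) \<longlonglongrightarrow> d x (\<phi> u)" if u: "u \<in> {0..<1}" and x: "x \<in> S" for u x
  proof (rule LIMSEQ_I)
    fix r :: real assume "r > 0"
    then obtain N where N: "\<forall>m\<ge>N. d (xs (\<zeta> u m)) (\<phi> u) < r"
      using lim[OF u] unfolding limitin_metric eventually_sequentially by blast
    have "norm (d x (xs (\<zeta> u m)) - d x (\<phi> u)) < r" if "m \<ge> N" for m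
      using N that mdist_reverse_triangle[of "xs (\<zeta> u m)" x "\<phi> u"] x \<phi>S[OF u]
        commute[of x "xs (\<zeta> u m)"] by fastforce
    then show "\<exists>N. \<forall>m\<ge>N. norm (d x (xs (\<zeta> u m)) - d x (\<phi> u)) < r" by blast
  qed
  have dle: "d (xs (\<zeta> u m)) (\<phi> u) \<le> (1/2) ^ m" if u: "u \<in> {0..<1}" for u m
  proof -
    have "(\<lambda>n. (1/2) ^ m + (1/2 :: real) ^ n) \<longlonglongrightarrow> (1/2) ^ m + 0"
      by (intro tendsto_intros LIMSEQ_realpow_zero) auto
    from LIMSEQ_le[OF dlim[OF u] this, of "xs (\<zeta> u m)"] show ?thesis
      using near[OF u] by auto
  qed
  have \<phi>m: "\<phi> \<in> unit_interval_L \<rightarrow>\<^sub>M \<mu>"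
  proof (rule measurableI_balls)
    fix i r
    have "(\<lambda>u. d (xs i) (\<phi> u)) \<in> borel_measurable unit_interval_L"
    proof (rule borel_measurable_LIMSEQ_real)
      show "(\<lambda>m. d (xs i) (xs (\<zeta> u m))) \<longlonglongrightarrow> d (xs i) (\<phi> u)" if "u \<in> space unit_interval_L" for u
        using dlim that by simp
      show "(\<lambda>u. d (xs i) (xs (\<zeta> u m))) \<in> borel_measurable unit_interval_L" for m
        by (rule measurable_compose[OF meas, of "\<lambda>k. d (xs i) (xs k)"]) simp
    qed
    then show "{w \<in> space unit_interval_L. d (xs i) (\<phi> w) < r} \<in> sets unit_interval_L"
      by measurable
  qed (use \<phi>S in simp)
  have cdm: "(\<lambda>y. code m y) \<in> \<mu> \<rightarrow>\<^sub>M count_space UNIV" for m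
    by (rule measurable_code) simp
  \<comment> \<open>The limit map is compared with the identity on the space itself, whose
    approximating digits are given by \<open>code\<close>.\<close>
  have "distr unit_interval_L \<mu> \<phi> = distr \<mu> \<mu> (\<lambda>y. y)"
  proof (rule law_eqI_codes[OF prob_space_unit_interval_L prob_space_axioms \<phi>m _ meas cdm])
    show "distr unit_interval_L (count_space UNIV) (\<lambda>u. \<zeta> u m) = distr \<mu> (count_space UNIV) (code m)" for m
      by (rule countable_law_eq[OF prob_space_unit_interval_L prob_space_axioms meas cdm])
         (use law in simp)
  qed (use dle code_dist in \<open>auto intro: less_imp_le\<close>)
  then have "mm_parameter X \<phi>"
    using \<phi>m by (simp add: mm_parameter_def)
  then show thesis using dle that by blast
qed

text \<open>\<open>code_compactness\<close> for a constant sequence: the unit interval is divided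
  according to the code masses of \<open>\<mu>\<close>, and the digits are decoded.\<close>

lemma ex_parameter: "\<exists>\<phi>. mm_parameter X \<phi>"
proof -
  have cdm: "(\<lambda>y. code m y) \<in> \<mu> \<rightarrow>\<^sub>M count_space UNIV" for m
    by (rule measurable_code) simp
  have cds: "{y \<in> S. code m y = j} \<in> sets \<mu>" for m j
    using measurable_sets[OF cdm, of "{j}" m] by (simp add: vimage_def Int_def conj_commute)
  have sm: "summable (\<lambda>j. prob {y \<in> S. code m y = j})" for m
    by (rule sums_summable[OF finite_measure_UNION]) (auto simp: cds disjoint_family_on_def)
  show ?thesis
  proof (rule code_compactness[of "\<lambda>_. \<mu>" "\<lambda>_ y m. code m y" "\<lambda>m j. prob {y \<in> S. code m y = j}",
        OF prob_space_axioms cdm order_refl sm])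
    fix r \<zeta> and c :: real
    assume \<zeta>: "\<And>m. (\<lambda>u. \<zeta> u m) \<in> unit_interval_L \<rightarrow>\<^sub>M count_space UNIV"
    and re: "\<And>u m. u \<in> {0..<1} \<Longrightarrow> eventually (\<lambda>n. \<exists>w\<in>S. \<forall>i<m. code i w = \<zeta> u i) sequentially"
    and law: "\<And>m j. measure unit_interval_L {u \<in> {0..<1}. \<zeta> u m = j} \<le> prob {y \<in> S. code m y = j}"
    show "\<exists>\<phi>. mm_parameter X \<phi>"
      by (rule limit_parameter[OF \<zeta> _ law]) (use re in auto)
  qed
qed

end

lemma (in Metric_space) mdist_diff_le:
  assumes "x \<in> M" "x' \<in> M" "y \<in> M" "y' \<in> M"
  shows "\<bar>d x y - d x' y'\<bar> \<le> d x x' + d y y'"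
  using triangle[of x x' y] triangle[of x' y' y] triangle[of x' x y'] triangle[of x y y'] assms
    commute[of x x'] commute[of y y'] by simp

context mm
begin

lemma parameter_in: "mm_parameter X \<phi> \<Longrightarrow> u \<in> {0..<1} \<Longrightarrow> \<phi> u \<in> S"
  using measurable_space[of \<phi> unit_interval_L \<mu> u] by (simp add: mm_parameter_def)

lemma parameter_emeasure:
  assumes \<phi>: "mm_parameter X \<phi>" and B: "{y \<in> S. P y} \<in> sets \<mu>"
  shows "emeasure unit_interval_L {u \<in> {0..<1}. P (\<phi> u)} = emeasure \<mu> {y \<in> S. P y}"
proof -
  have m: "\<phi> \<in> unit_interval_L \<rightarrow>\<^sub>M \<mu>" and law: "distr unit_interval_L \<mu> \<phi> = \<mu>"
    using \<phi> by (auto simp: mm_parameter_def)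
  have "emeasure \<mu> {y \<in> S. P y} = emeasure (distr unit_interval_L \<mu> \<phi>) {y \<in> S. P y}"
    by (simp add: law)
  also have "\<dots> = emeasure unit_interval_L (\<phi> -` {y \<in> S. P y} \<inter> space unit_interval_L)"
    by (rule emeasure_distr[OF m B])
  also have "\<phi> -` {y \<in> S. P y} \<inter> space unit_interval_L = {u \<in> {0..<1}. P (\<phi> u)}"
    using parameter_in[OF \<phi>] by auto
  finally show ?thesis by simp
qed

lemma parameter_measure:
  assumes "mm_parameter X \<phi>" and "{y \<in> S. P y} \<in> sets \<mu>"
  shows "measure unit_interval_L {u \<in> {0..<1}. P (\<phi> u)} = prob {y \<in> S. P y}"
  using parameter_emeasure[OF assms] by (simp add: measure_def)

lemma sets_code: "{y \<in> S. code m y = j} \<in> sets \<mu>"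
proof -
  have "(\<lambda>y. code m y) \<in> \<mu> \<rightarrow>\<^sub>M count_space UNIV"
    by (rule measurable_code) simp
  from measurable_sets[OF this, of "{j}"] show ?thesis
    by (simp add: vimage_def Int_def conj_commute)
qed

lemma summable_code: "summable (\<lambda>j. prob {y \<in> S. code m y = j})"
  by (rule sums_summable[OF finite_measure_UNION]) (auto simp: sets_code disjoint_family_on_def)

end

section \<open>Optimal parameters for the box distance\<close>

definition box_set :: "'a mmspace \<Rightarrow> 'b mmspace \<Rightarrow> real set" where
  "box_set X Y = {\<epsilon>. \<epsilon> \<ge> 0 \<and> (\<exists>\<phi> \<psi> I0. mm_parameter X \<phi> \<and> mm_parameter Y \<psi> \<and>
      I0 \<in> sets borel \<and> I0 \<subseteq> {0..<1} \<and> measure lborel I0 \<ge> 1 - \<epsilon> \<and>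
      (\<forall>s\<in>I0. \<forall>t\<in>I0. \<bar>mm_dist X (\<phi> s) (\<phi> t) - mm_dist Y (\<psi> s) (\<psi> t)\<bar> \<le> \<epsilon>))}"

lemma box_dist_eq_Inf: "box_dist X Y = Inf (box_set X Y)"
  by (simp add: box_dist_def box_set_def)

lemma box_set_bdd: "bdd_below (box_set X Y)"
  by (rule bdd_belowI[of _ 0]) (simp add: box_set_def)

lemma box_dist_le:
  assumes "mm_parameter X \<phi>" "mm_parameter Y \<psi>" "I \<in> sets borel" "I \<subseteq> {0..<1}" "0 \<le> e"
    "measure lborel I \<ge> 1 - e"
    "\<And>s t. s \<in> I \<Longrightarrow> t \<in> I \<Longrightarrow> \<bar>mm_dist X (\<phi> s) (\<phi> t) - mm_dist Y (\<psi> s) (\<psi> t)\<bar> \<le> e"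
  shows "box_dist X Y \<le> e"
  unfolding box_dist_eq_Inf
  by (rule cInf_lower[OF _ box_set_bdd]) (use assms in \<open>auto simp: box_set_def intro!: exI[of _ I] exI[of _ \<phi>] exI[of _ \<psi>]\<close>)

text \<open>With error 1 the empty set is an admissible good set, so any pair of parameters is a
  witness. This makes the infimum run over a nonempty set and bounds it by 1.\<close>

lemma one_in_box_set:
  assumes "mm_space X" "mm_space Y"
  shows "1 \<in> box_set X Y"
proof -
  obtain \<phi> \<psi> where "mm_parameter X \<phi>" "mm_parameter Y \<psi>"
    using mm.ex_parameter[OF mm.intro] assms by metis
  then show ?thesis
    unfolding box_set_def by (auto intro!: exI[of _ \<phi>] exI[of _ \<psi>] exI[of _ "{}"])
qed

lemma box_dist_less_obtains:
  assumes "mm_space X" "mm_space Y" "box_dist X Y < r"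
  obtains e where "e \<in> box_set X Y" "e < r"
  using cInf_lessD[of "box_set X Y" r] one_in_box_set[OF assms(1,2)] assms(3)
  unfolding box_dist_eq_Inf by auto

lemma box_dist_nonneg:
  assumes "mm_space X" "mm_space Y"
  shows "0 \<le> box_dist X Y"
  unfolding box_dist_eq_Inf
proof (rule cInf_greatest)
  show "box_set X Y \<noteq> {}"
    using one_in_box_set[OF assms] by blast
qed (simp add: box_set_def)

lemma box_dist_le_one:
  assumes "mm_space X" "mm_space Y"
  shows "box_dist X Y \<le> 1"
  unfolding box_dist_eq_Inf by (rule cInf_lower[OF one_in_box_set[OF assms] box_set_bdd])

lemma box_dist_attained:
  assumes "mm_space X" "mm_space Y"
  obtains \<phi> \<psi> where "mm_parameter X \<phi>" "mm_parameter Y \<psi>"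
    "\<And>s t. s \<in> {0..<1 - box_dist X Y} \<Longrightarrow> t \<in> {0..<1 - box_dist X Y} \<Longrightarrow>
      \<bar>mm_dist X (\<phi> s) (\<phi> t) - mm_dist Y (\<psi> s) (\<psi> t)\<bar> \<le> box_dist X Y"
proof -
  interpret X: mm X by (rule mm.intro) fact
  interpret Y: mm Y by (rule mm.intro) fact
  define e where "e = box_dist X Y"
  have "\<exists>en. en \<in> box_set X Y \<and> en < e + 1 / (real n + 1)" for n
    by (rule box_dist_less_obtains[OF assms, of "e + 1 / (real n + 1)"]) (auto simp: e_def)
  then obtain en where en: "\<And>n. en n \<in> box_set X Y" "\<And>n. en n < e + 1 / (real n + 1)"
    by metis
  have "\<forall>n. \<exists>\<phi> \<psi> I. mm_parameter X \<phi> \<and> mm_parameter Y \<psi> \<and> I \<in> sets borel \<and> I \<subseteq> {0..<1} \<and>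
    measure lborel I \<ge> 1 - en n \<and>
    (\<forall>s\<in>I. \<forall>t\<in>I. \<bar>mm_dist X (\<phi> s) (\<phi> t) - mm_dist Y (\<psi> s) (\<psi> t)\<bar> \<le> en n)"
    using en(1) unfolding box_set_def by blast
  then obtain f g I where f: "\<And>n. mm_parameter X (f n)" and g: "\<And>n. mm_parameter Y (g n)"
    and I: "\<And>n. I n \<in> sets borel" "\<And>n. I n \<subseteq> {0..<1}" "\<And>n. measure lborel (I n) \<ge> 1 - en n"
    and dis: "\<And>n s t. s \<in> I n \<Longrightarrow> t \<in> I n \<Longrightarrow> \<bar>mm_dist X (f n s) (f n t) - mm_dist Y (g n s) (g n t)\<bar> \<le> en n"
    by metis
  \<comment> \<open>Digit 0 says whether \<open>u\<close> lies in the good set; the codes in both spaces are interleaved after it.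
    Since \<open>code_compactness\<close> orders intervals by the first digit, the limit good set is an initial interval.\<close>
  define \<xi> :: "nat \<Rightarrow> real \<Rightarrow> nat \<Rightarrow> nat" where
    "\<xi> = (\<lambda>n u m. if m = 0 then (if u \<in> I n then 0 else 1)
       else if odd m then X.code (m div 2) (f n u) else Y.code (m div 2 - 1) (g n u))"
  \<comment> \<open>The digits carrying codes have the marginals of the two fixed spaces as
    majorants, independent of \<open>n\<close>; the flag digit takes only two values.\<close>
  define q :: "nat \<Rightarrow> nat \<Rightarrow> real" where
    "q = (\<lambda>m j. if m = 0 then (if j \<le> 1 then 1 else 0)
       else if odd m then X.prob {y \<in> X.S. X.code (m div 2) y = j} else Y.prob {y \<in> Y.S. Y.code (m div 2 - 1) y = j})"
  have IU: "I n \<in> sets unit_interval_L" for n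
    using I by (simp add: sets_unit_interval_L)
  have fm: "f n \<in> unit_interval_L \<rightarrow>\<^sub>M mm_meas X" and gm: "g n \<in> unit_interval_L \<rightarrow>\<^sub>M mm_meas Y" for n
    using f g by (auto simp: mm_parameter_def)
  have "(\<lambda>u. if u \<in> I n then 0 else 1 :: nat) \<in> unit_interval_L \<rightarrow>\<^sub>M count_space UNIV" for n
    using IU[of n] by (intro measurable_If_set) (auto simp: Int_absorb2 I(2))
  then have meas: "(\<lambda>u. \<xi> n u m) \<in> unit_interval_L \<rightarrow>\<^sub>M count_space UNIV" for n m
    using X.measurable_code[OF fm] Y.measurable_code[OF gm] by (auto simp: \<xi>_def)
  have bound: "measure unit_interval_L {u \<in> space unit_interval_L. \<xi> n u m = j} \<le> q m j" for n m j
  proof (cases "m = 0")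
    case True
    then show ?thesis
      by (cases "j \<le> 1") (auto simp: \<xi>_def q_def)
  next
    case False
    then show ?thesis
      using X.parameter_measure[OF f[of n] X.sets_code[of "m div 2" j]]
        Y.parameter_measure[OF g[of n] Y.sets_code[of "m div 2 - 1" j]]
      by (auto simp: \<xi>_def q_def)
  qed
  have "summable (\<lambda>j. if j \<le> 1 then 1 else 0 :: real)"
    by (rule summable_finite[of "{..1}"]) auto
  then have sq: "summable (q m)" for m
    using X.summable_code[of "m div 2"] Y.summable_code[of "m div 2 - 1"]
    by (cases "m = 0"; cases "odd m") (simp_all add: q_def)
  show thesis
  proof (rule code_compactness[of "\<lambda>_. unit_interval_L" \<xi> q, OF prob_space_unit_interval_L meas bound sq])
    fix r :: "nat \<Rightarrow> nat" and \<zeta> :: "real \<Rightarrow> nat \<Rightarrow> nat" and c :: real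
    assume r: "strict_mono r"
      and \<zeta>: "\<And>m. (\<lambda>u. \<zeta> u m) \<in> unit_interval_L \<rightarrow>\<^sub>M count_space UNIV"
      and re: "\<And>u m. u \<in> {0..<1} \<Longrightarrow>
        eventually (\<lambda>n. \<exists>w\<in>space unit_interval_L. \<forall>i<m. \<xi> (r n) w i = \<zeta> u i) sequentially"
      and law: "\<And>m j. measure unit_interval_L {u \<in> {0..<1}. \<zeta> u m = j} \<le> q m j"
      and c: "(\<lambda>n. measure unit_interval_L {w \<in> space unit_interval_L. \<xi> (r n) w 0 = 0}) \<longlonglongrightarrow> c"
        "{u \<in> {0..<1}. \<zeta> u 0 = 0} = {0..<c}"
    have ex: "\<exists>n w. n \<ge> k \<and> w \<in> {0..<1} \<and> (\<forall>i<m. \<xi> (r n) w i = \<zeta> u i)" if "u \<in> {0..<1}" for u m k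
    proof -
      have "eventually (\<lambda>n. k \<le> n \<and> (\<exists>w\<in>{0..<1}. \<forall>i<m. \<xi> (r n) w i = \<zeta> u i)) sequentially"
        using re[OF that, of m] eventually_ge_at_top[of k] by eventually_elim simp
      then show ?thesis
        using eventually_happens'[OF sequentially_bot] by blast
    qed
    have realX: "\<exists>y\<in>X.S. \<forall>k<m. X.code k y = \<zeta> u (2 * k + 1)" if u: "u \<in> {0..<1}" for u m
    proof -
      obtain n w where w: "w \<in> {0..<1}" "\<forall>i<2 * m + 2. \<xi> (r n) w i = \<zeta> u i"
        using ex[OF u] by blast
      have "X.code k (f (r n) w) = \<zeta> u (2 * k + 1)" if "k < m" for k
        using w(2)[rule_format, of "2 * k + 1"] that by (simp add: \<xi>_def)
      then show ?thesis using X.parameter_in[OF f w(1)] by blast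
    qed
    have lawX: "measure unit_interval_L {u \<in> {0..<1}. \<zeta> u (2 * m + 1) = j} \<le> X.prob {y \<in> X.S. X.code m y = j}" for m j
      using law[of "2 * m + 1" j] by (simp add: q_def)
    obtain \<phi> where \<phi>: "mm_parameter X \<phi>"
      "\<And>u m. u \<in> {0..<1} \<Longrightarrow> mm_dist X (X.xs (\<zeta> u (2 * m + 1))) (\<phi> u) \<le> (1/2) ^ m"
      using X.limit_parameter[of "\<lambda>u m. \<zeta> u (2 * m + 1)", OF \<zeta> realX lawX] by blast
    have realY: "\<exists>y\<in>Y.S. \<forall>k<m. Y.code k y = \<zeta> u (2 * k + 2)" if u: "u \<in> {0..<1}" for u m
    proof -
      obtain n w where w: "w \<in> {0..<1}" "\<forall>i<2 * m + 3. \<xi> (r n) w i = \<zeta> u i"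
        using ex[OF u] by blast
      have "Y.code k (g (r n) w) = \<zeta> u (2 * k + 2)" if "k < m" for k
        using w(2)[rule_format, of "2 * k + 2"] that by (simp add: \<xi>_def)
      then show ?thesis using Y.parameter_in[OF g w(1)] by blast
    qed
    have lawY: "measure unit_interval_L {u \<in> {0..<1}. \<zeta> u (2 * m + 2) = j} \<le> Y.prob {y \<in> Y.S. Y.code m y = j}" for m j
      using law[of "2 * m + 2" j] by (simp add: q_def)
    obtain \<psi> where \<psi>: "mm_parameter Y \<psi>"
      "\<And>u m. u \<in> {0..<1} \<Longrightarrow> mm_dist Y (Y.xs (\<zeta> u (2 * m + 2))) (\<psi> u) \<le> (1/2) ^ m"
      using Y.limit_parameter[of "\<lambda>u m. \<zeta> u (2 * m + 2)", OF \<zeta> realY lawY] by blast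
    have r_ge: "n \<le> r n" for n
      using r by (rule strict_mono_imp_increasing)
    \<comment> \<open>\<open>c\<close> is the limit of the masses of the approximating good sets,
      and along the subsequence these masses are at least \<open>1 - e - 1 / Suc n\<close>.\<close>
    have "1 - e \<le> c"
    proof (rule LIMSEQ_le)
      show "(\<lambda>n. measure unit_interval_L {w \<in> space unit_interval_L. \<xi> (r n) w 0 = 0}) \<longlonglongrightarrow> c"
        by (rule c(1))
      have "(\<lambda>n. 1 - e - 1 / real (Suc n)) \<longlonglongrightarrow> 1 - e - 0"
        by (intro tendsto_intros LIMSEQ_Suc lim_1_over_n)
      then show "(\<lambda>n. 1 - e - 1 / real (Suc n)) \<longlonglongrightarrow> 1 - e" by simp
      have "1 - e - 1 / real (Suc n) \<le> measure unit_interval_L {w \<in> space unit_interval_L. \<xi> (r n) w 0 = 0}" for n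
      proof -
        have "{w \<in> space unit_interval_L. \<xi> (r n) w 0 = 0} = I (r n)"
          using I(2)[of "r n"] by (auto simp: \<xi>_def)
        moreover have "1 / (real (r n) + 1) \<le> 1 / real (Suc n)"
          using r_ge[of n] by (intro divide_left_mono) auto
        ultimately show ?thesis
          using I(3)[of "r n"] en(2)[of "r n"] by (simp add: measure_unit_interval_L[OF I(2)])
      qed
      then show "\<exists>N. \<forall>n\<ge>N. 1 - e - 1 / real (Suc n) \<le> measure unit_interval_L {w \<in> space unit_interval_L. \<xi> (r n) w 0 = 0}"
        by blast
    qed
    have "\<bar>mm_dist X (\<phi> u) (\<phi> v) - mm_dist Y (\<psi> u) (\<psi> v)\<bar> \<le> e"
      if u': "u \<in> {0..<1 - e}" and v': "v \<in> {0..<1 - e}" for u v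
    proof -
      have "u \<in> {u \<in> {0..<1}. \<zeta> u 0 = 0}" "v \<in> {u \<in> {0..<1}. \<zeta> u 0 = 0}"
        unfolding c(2) using u' v' \<open>1 - e \<le> c\<close> by auto
      then have u: "u \<in> {0..<1}" "\<zeta> u 0 = 0" and v: "v \<in> {0..<1}" "\<zeta> v 0 = 0"
        by auto
      \<comment> \<open>Each of the two points is recovered up to \<open>2 * (1/2) ^ m\<close> in
        each of the two spaces: four errors, hence the factor 8.\<close>
      have step: "\<bar>mm_dist X (\<phi> u) (\<phi> v) - mm_dist Y (\<psi> u) (\<psi> v)\<bar> \<le> e + 1 / real (Suc m) + 8 * (1/2) ^ m" for m
      proof -
        \<comment> \<open>A prefix of length \<open>2 * m + 3\<close> just covers the flag and the
          digits \<open>2 * m + 1\<close> and \<open>2 * m + 2\<close>, which hold the level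
          \<open>m\<close> codes in the two spaces. The same \<open>n\<close> has to serve
          \<open>u\<close> and \<open>v\<close>.\<close>
        have "eventually (\<lambda>n. m \<le> n \<and> (\<exists>w\<in>{0..<1}. \<forall>i<2 * m + 3. \<xi> (r n) w i = \<zeta> u i) \<and>
            (\<exists>w\<in>{0..<1}. \<forall>i<2 * m + 3. \<xi> (r n) w i = \<zeta> v i)) sequentially"
          using re[OF u(1), of "2 * m + 3"] re[OF v(1), of "2 * m + 3"] eventually_ge_at_top[of m]
          by eventually_elim auto
        then obtain n w z where n: "m \<le> n"
          and w: "w \<in> {0..<1}" "\<And>i. i < 2 * m + 3 \<Longrightarrow> \<xi> (r n) w i = \<zeta> u i"
          and z: "z \<in> {0..<1}" "\<And>i. i < 2 * m + 3 \<Longrightarrow> \<xi> (r n) z i = \<zeta> v i"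
          using eventually_happens'[OF sequentially_bot] by blast
        let ?k = "r n"
        have fS: "f ?k w \<in> X.S" "f ?k z \<in> X.S" "\<phi> u \<in> X.S" "\<phi> v \<in> X.S"
          using X.parameter_in f \<phi>(1) u(1) v(1) w(1) z(1) by auto
        have gS: "g ?k w \<in> Y.S" "g ?k z \<in> Y.S" "\<psi> u \<in> Y.S" "\<psi> v \<in> Y.S"
          using Y.parameter_in g \<psi>(1) u(1) v(1) w(1) z(1) by auto
        have "w \<in> I ?k" "z \<in> I ?k"
          using w(2)[of 0] z(2)[of 0] u(2) v(2) by (auto simp: \<xi>_def split: if_splits)
        then have 1: "\<bar>mm_dist X (f ?k w) (f ?k z) - mm_dist Y (g ?k w) (g ?k z)\<bar> \<le> en ?k"
          by (rule dis)
        have "X.code m (f ?k w) = \<zeta> u (2 * m + 1)" "X.code m (f ?k z) = \<zeta> v (2 * m + 1)"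
          "Y.code m (g ?k w) = \<zeta> u (2 * m + 2)" "Y.code m (g ?k z) = \<zeta> v (2 * m + 2)"
          using w(2)[of "2 * m + 1"] z(2)[of "2 * m + 1"] w(2)[of "2 * m + 2"] z(2)[of "2 * m + 2"]
          by (auto simp: \<xi>_def)
        then have "mm_dist X (X.xs (\<zeta> u (2 * m + 1))) (f ?k w) \<le> (1/2) ^ m"
          "mm_dist X (X.xs (\<zeta> v (2 * m + 1))) (f ?k z) \<le> (1/2) ^ m"
          "mm_dist Y (Y.xs (\<zeta> u (2 * m + 2))) (g ?k w) \<le> (1/2) ^ m"
          "mm_dist Y (Y.xs (\<zeta> v (2 * m + 2))) (g ?k z) \<le> (1/2) ^ m"
          using X.code_dist[of "f ?k w" m] X.code_dist[of "f ?k z" m] Y.code_dist[of "g ?k w" m]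
            Y.code_dist[of "g ?k z" m] fS gS by auto
        then have "mm_dist X (\<phi> u) (f ?k w) \<le> 2 * (1/2) ^ m" "mm_dist X (\<phi> v) (f ?k z) \<le> 2 * (1/2) ^ m"
          "mm_dist Y (\<psi> u) (g ?k w) \<le> 2 * (1/2) ^ m" "mm_dist Y (\<psi> v) (g ?k z) \<le> 2 * (1/2) ^ m"
          using \<phi>(2)[OF u(1), of m] \<phi>(2)[OF v(1), of m] \<psi>(2)[OF u(1), of m] \<psi>(2)[OF v(1), of m]
            X.triangle''[of "\<phi> u" "X.xs (\<zeta> u (2 * m + 1))" "f ?k w"]
            X.triangle''[of "\<phi> v" "X.xs (\<zeta> v (2 * m + 1))" "f ?k z"]
            Y.triangle''[of "\<psi> u" "Y.xs (\<zeta> u (2 * m + 2))" "g ?k w"]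
            Y.triangle''[of "\<psi> v" "Y.xs (\<zeta> v (2 * m + 2))" "g ?k z"] fS gS
          by auto
        then have "\<bar>mm_dist X (\<phi> u) (\<phi> v) - mm_dist Y (\<psi> u) (\<psi> v)\<bar> \<le> en ?k + 8 * (1/2) ^ m"
          using 1 X.mdist_diff_le[OF fS(3,1,4,2)] Y.mdist_diff_le[OF gS(3,1,4,2)] by linarith
        also have "en ?k \<le> e + 1 / real (Suc m)"
        proof -
          have "1 / (real ?k + 1) \<le> 1 / real (Suc m)"
            using r_ge[of n] n by (intro divide_left_mono) auto
          then show ?thesis using en(2)[of ?k] by linarith
        qed
        finally show ?thesis by simp
      qed
      have "(\<lambda>m. e + 1 / real (Suc m) + 8 * (1/2) ^ m) \<longlonglongrightarrow> e + 0 + 8 * 0"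
        by (intro tendsto_intros LIMSEQ_Suc lim_1_over_n LIMSEQ_realpow_zero) auto
      then show ?thesis
        using step by (intro LIMSEQ_le_const[where X = "\<lambda>m. e + 1 / real (Suc m) + 8 * (1/2) ^ m"]) auto
    qed
    then show thesis
      using that \<phi>(1) \<psi>(1) unfolding e_def by blast
  qed
qed

section \<open>Parameters with equal distances give isomorphic spaces\<close>

context mm
begin

abbreviation "supp \<equiv> mm_supp X"

lemma supp_subset: "supp \<subseteq> S"
  by (auto simp: mm_supp_def)

text \<open>Lindelof argument: a point outside the support has a null ball around it, hence lies in
  a null ball of the countable base. This makes the complement null and measurable.\<close>

lemma supp_compl_eq:
  "S - supp = (\<Union>(i, n)\<in>{(i, n). emeasure \<mu> (mball (xs i) (1 / Suc n)) = 0}. mball (xs i) (1 / Suc n))"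
proof (intro equalityI subsetI)
  fix z assume z: "z \<in> S - supp"
  then obtain e where e: "e > 0" "emeasure \<mu> {y \<in> S. d z y < e} = 0"
    by (auto simp: mm_supp_def not_gr_zero)
  have "{y \<in> S. d z y < e} = mball z e" using z by auto
  then have null: "emeasure \<mu> (mball z e) = 0" using e by simp
  have zS: "z \<in> S" using z by simp
  have "z \<in> mball z e" using z e by simp
  then obtain i n where i: "mball (xs i) (1 / Suc n) \<subseteq> mball z e" "d (xs i) z < 1 / Suc n"
    using openin_iff_balls[OF openin_mball[of z e] zS] by blast
  have "emeasure \<mu> (mball (xs i) (1 / Suc n)) \<le> emeasure \<mu> (mball z e)"
    by (intro emeasure_mono i(1) sets_openin openin_mball)
  then show "z \<in> (\<Union>(i, n)\<in>{(i, n). emeasure \<mu> (mball (xs i) (1 / Suc n)) = 0}. mball (xs i) (1 / Suc n))"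
    using null i(2) zS by (intro UN_I[of "(i, n)"]) auto
next
  fix z assume "z \<in> (\<Union>(i, n)\<in>{(i, n). emeasure \<mu> (mball (xs i) (1 / Suc n)) = 0}. mball (xs i) (1 / Suc n))"
  then obtain i n where i: "emeasure \<mu> (mball (xs i) (1 / Suc n)) = 0" "z \<in> mball (xs i) (1 / Suc n)"
    by auto
  then obtain e where e: "e > 0" "mball z e \<subseteq> mball (xs i) (1 / Suc n)"
    using openin_mball[of "xs i" "1 / Suc n"] unfolding openin_mtopology by blast
  have zS: "z \<in> S" using i by auto
  have "{y \<in> S. d z y < e} = mball z e" using zS by auto
  moreover have "emeasure \<mu> (mball z e) \<le> emeasure \<mu> (mball (xs i) (1 / Suc n))"
    by (intro emeasure_mono e(2) sets_openin openin_mball)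
  ultimately have "emeasure \<mu> {y \<in> S. d z y < e} = 0" using i(1) by simp
  then have "z \<notin> supp" using e(1) by (auto simp: mm_supp_def)
  then show "z \<in> S - supp" using zS by simp
qed

lemma supp_compl_null: "S - supp \<in> null_sets \<mu>"
  unfolding supp_compl_eq
  by (intro null_sets_UN' countableI_type) (auto intro!: null_setsI sets_openin)

lemma sets_supp: "supp \<in> sets \<mu>"
proof -
  have "S - (S - supp) \<in> sets \<mu>"
    by (intro sets.compl_sets null_setsD2 supp_compl_null)
  moreover have "S - (S - supp) = supp" using supp_subset by auto
  ultimately show ?thesis by simp
qed

lemma suppD: "x \<in> supp \<Longrightarrow> e > 0 \<Longrightarrow> emeasure \<mu> {y \<in> S. d x y < e} > 0"
  by (auto simp: mm_supp_def)

lemma sets_ball: "x \<in> S \<Longrightarrow> {y \<in> S. d x y < e} \<in> sets \<mu>"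
  using sets_openin[OF openin_mball[of x e]] by (simp add: mball_def)

end

text \<open>Two spaces whose pulled-back distances agree on a set of full measure. The situation is
  symmetric, and \<open>swap\<close> is what provides the inverse of the isometry.\<close>

locale mm_match = X: mm X + Y: mm Y for X :: "'a mmspace" and Y :: "'b mmspace" +
  fixes \<phi> :: "real \<Rightarrow> 'a" and \<psi> :: "real \<Rightarrow> 'b" and T :: "real set"
  assumes \<phi>: "mm_parameter X \<phi>" and \<psi>: "mm_parameter Y \<psi>"
    and T: "T \<in> sets unit_interval_L" "measure unit_interval_L T = 1"
    and iso: "\<And>s t. s \<in> T \<Longrightarrow> t \<in> T \<Longrightarrow> mm_dist X (\<phi> s) (\<phi> t) = mm_dist Y (\<psi> s) (\<psi> t)"
begin

lemma swap: "mm_match Y X \<psi> \<phi> T"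
  by unfold_locales (use \<phi> \<psi> T iso in auto)

lemma T_sub: "T \<subseteq> {0..<1}"
  using T(1) by (simp add: sets_unit_interval_L)

lemma \<phi>_in: "v \<in> T \<Longrightarrow> \<phi> v \<in> X.S" and \<psi>_in: "v \<in> T \<Longrightarrow> \<psi> v \<in> Y.S"
  using X.parameter_in[OF \<phi>] Y.parameter_in[OF \<psi>] T_sub by auto

lemma AE_T: "AE v in unit_interval_L. v \<in> T"
  using T by (intro UL.AE_prob_1) simp

lemma emeasure_T_ball:
  assumes "x \<in> X.S"
  shows "emeasure unit_interval_L {v \<in> T. mm_dist X x (\<phi> v) < e} = emeasure (mm_meas X) {y \<in> X.S. mm_dist X x y < e}"
proof -
  have \<phi>m: "\<phi> \<in> unit_interval_L \<rightarrow>\<^sub>M mm_meas X" using \<phi> by (simp add: mm_parameter_def)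
  have s: "{u \<in> {0..<1}. mm_dist X x (\<phi> u) < e} \<in> sets unit_interval_L"
    using X.dist_measurable[OF \<phi>m assms] by (simp add: borel_measurable_iff_less)
  have "emeasure unit_interval_L {v \<in> T. mm_dist X x (\<phi> v) < e}
      = emeasure unit_interval_L {u \<in> {0..<1}. mm_dist X x (\<phi> u) < e}"
  proof (rule emeasure_eq_AE)
    have "{v \<in> T. mm_dist X x (\<phi> v) < e} = T \<inter> {u \<in> {0..<1}. mm_dist X x (\<phi> u) < e}"
      using T_sub by auto
    then show "{v \<in> T. mm_dist X x (\<phi> v) < e} \<in> sets unit_interval_L"
      using s T(1) by auto
  qed (use AE_T s T_sub in auto)
  also have "\<dots> = emeasure (mm_meas X) {y \<in> X.S. mm_dist X x y < e}"
    by (rule X.parameter_emeasure[OF \<phi> X.sets_ball[OF assms]])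
  finally show ?thesis .
qed

text \<open>The parameter values over \<open>T\<close> are dense in the support, because balls
  around its points have positive mass and \<open>T\<close> has full measure.\<close>

lemma near:
  assumes x: "x \<in> X.supp" and e: "e > 0"
  obtains v where "v \<in> T" "mm_dist X x (\<phi> v) < e"
proof -
  have "x \<in> X.S" using x X.supp_subset by auto
  then have "emeasure unit_interval_L {v \<in> T. mm_dist X x (\<phi> v) < e} > 0"
    using X.suppD[OF x e] emeasure_T_ball by simp
  then have "{v \<in> T. mm_dist X x (\<phi> v) < e} \<noteq> {}"
    by (metis emeasure_empty less_irrefl)
  then show thesis using that by auto
qed

text \<open>Points are matched by their distances to all parameter values over \<open>T\<close>.
  This extends the pairing of \<open>\<phi> v\<close> with \<open>\<psi> v\<close> to limit points
  without reference to a chosen sequence.\<close>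

definition corr :: "'a \<Rightarrow> 'b \<Rightarrow> bool" where
  "corr x y \<longleftrightarrow> (\<forall>v\<in>T. mm_dist Y y (\<psi> v) = mm_dist X x (\<phi> v))"

lemma corr_unique:
  assumes "x \<in> X.supp" "y \<in> Y.S" "y' \<in> Y.S" "corr x y" "corr x y'"
  shows "y = y'"
proof -
  have "mm_dist Y y y' \<le> e" if "e > 0" for e
  proof -
    obtain v where v: "v \<in> T" "mm_dist X x (\<phi> v) < e / 2"
      using near[OF assms(1), of "e / 2"] \<open>e > 0\<close> by auto
    then have "mm_dist Y y (\<psi> v) < e / 2" "mm_dist Y y' (\<psi> v) < e / 2"
      using assms by (auto simp: corr_def)
    then show ?thesis
      using Y.triangle'[of y "\<psi> v" y'] Y.triangle[of y "\<psi> v" y'] Y.commute[of y' "\<psi> v"] assms \<psi>_in[OF v(1)] by linarith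
  qed
  then have "mm_dist Y y y' \<le> 0"
    by (rule field_le_epsilon[of _ 0, simplified])
  then show ?thesis
    using Y.mdist_pos_eq[OF assms(2,3)] by (meson not_le)
qed

text \<open>Parameter values converging to \<open>x\<close> have partners that form a Cauchy
  sequence in the complete space \<open>Y\<close>, and the limit inherits all distances. It lies in
  the support since corresponding balls have the same mass.\<close>

lemma corr_ex:
  assumes x: "x \<in> X.supp"
  shows "\<exists>y\<in>Y.supp. corr x y"
proof -
  have xS: "x \<in> X.S" using x X.supp_subset by auto
  have "\<exists>v. v \<in> T \<and> mm_dist X x (\<phi> v) < 1 / Suc n" for n
    using near[OF x, of "1 / Suc n"] by auto
  then obtain v where v: "\<And>n. v n \<in> T" "\<And>n. mm_dist X x (\<phi> (v n)) < 1 / Suc n"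
    by metis
  have dd: "mm_dist Y (\<psi> (v n)) (\<psi> (v m)) < 1 / Suc n + 1 / Suc m" for n m
    using v(2)[of n] v(2)[of m] X.triangle''[of "\<phi> (v n)" x "\<phi> (v m)"] xS \<phi>_in[OF v(1)]
      iso[OF v(1) v(1), of n m] by (smt (verit))
  have "Y.MCauchy (\<lambda>n. \<psi> (v n))"
    unfolding Y.MCauchy_def
  proof (intro conjI allI impI)
    fix e :: real assume "e > 0"
    then obtain N where N: "1 / Suc N < e / 2"
      by (metis half_gt_zero nat_approx_posE)
    have "mm_dist Y (\<psi> (v n)) (\<psi> (v n')) < e" if "N \<le> n" "N \<le> n'" for n n'
    proof -
      have "1 / real (Suc n) \<le> 1 / Suc N" "1 / real (Suc n') \<le> 1 / Suc N"
        using that by (auto intro!: divide_left_mono)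
      then show ?thesis using dd[of n n'] N by linarith
    qed
    then show "\<exists>N. \<forall>n n'. N \<le> n \<longrightarrow> N \<le> n' \<longrightarrow> mm_dist Y (\<psi> (v n)) (\<psi> (v n')) < e"
      by blast
  qed (use \<psi>_in v in auto)
  then obtain y where y: "limitin Y.mtopology (\<lambda>n. \<psi> (v n)) y sequentially"
    using Y.complete unfolding Y.mcomplete_def by blast
  then have yS: "y \<in> Y.S" using Y.limitin_mspace by blast
  have yl: "(\<lambda>n. mm_dist Y (\<psi> (v n)) y) \<longlonglongrightarrow> 0"
    using y unfolding Y.limitin_metric_dist_null by simp
  have xl: "(\<lambda>n. mm_dist X x (\<phi> (v n))) \<longlonglongrightarrow> 0"
  proof (rule tendsto_sandwich[OF _ _ tendsto_const])
    show "(\<lambda>n. 1 / real (Suc n)) \<longlonglongrightarrow> 0" by (intro LIMSEQ_Suc lim_1_over_n)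
  qed (use v(2) in \<open>auto intro: less_imp_le always_eventually\<close>)
  have corr: "corr x y"
    unfolding corr_def
  proof
    fix w assume w: "w \<in> T"
    have le: "\<bar>mm_dist Y y (\<psi> w) - mm_dist X x (\<phi> w)\<bar> \<le> mm_dist Y (\<psi> (v n)) y + mm_dist X x (\<phi> (v n))" for n
      using Y.mdist_diff_le[of y "\<psi> (v n)" "\<psi> w" "\<psi> w"] X.mdist_diff_le[of x "\<phi> (v n)" "\<phi> w" "\<phi> w"]
        iso[OF v(1)[of n] w] yS xS \<psi>_in[OF w] \<phi>_in[OF w] \<psi>_in[OF v(1)[of n]] \<phi>_in[OF v(1)[of n]]
        Y.commute[of y "\<psi> (v n)"] by simp
    have "(\<lambda>n. mm_dist Y (\<psi> (v n)) y + mm_dist X x (\<phi> (v n))) \<longlonglongrightarrow> 0 + 0"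
      by (intro tendsto_add yl xl)
    then have "\<bar>mm_dist Y y (\<psi> w) - mm_dist X x (\<phi> w)\<bar> \<le> 0 + 0"
      by (rule LIMSEQ_le_const) (use le in auto)
    then show "mm_dist Y y (\<psi> w) = mm_dist X x (\<phi> w)" by simp
  qed
  interpret sw: mm_match Y X \<psi> \<phi> T by (rule swap)
  have "y \<in> Y.supp"
    unfolding mm_supp_def
  proof (intro CollectI conjI allI impI yS)
    fix e :: real assume e: "e > 0"
    have "{v \<in> T. mm_dist Y y (\<psi> v) < e} = {v \<in> T. mm_dist X x (\<phi> v) < e}"
      using corr by (auto simp: corr_def)
    then show "emeasure (mm_meas Y) {z \<in> Y.S. mm_dist Y y z < e} > 0"
      using X.suppD[OF x e] emeasure_T_ball[OF xS, of e] sw.emeasure_T_ball[OF yS, of e] by simp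
  qed
  with corr show ?thesis by blast
qed

definition F :: "'a \<Rightarrow> 'b" where
  "F x = (SOME y. y \<in> Y.supp \<and> corr x y)"

lemma F: "x \<in> X.supp \<Longrightarrow> F x \<in> Y.supp" "x \<in> X.supp \<Longrightarrow> corr x (F x)"
  using someI_ex[of "\<lambda>y. y \<in> Y.supp \<and> corr x y"] corr_ex[of x] unfolding F_def by blast+

lemma F_eqI: "x \<in> X.supp \<Longrightarrow> y \<in> Y.S \<Longrightarrow> corr x y \<Longrightarrow> F x = y"
  using corr_unique[of x "F x" y] F[of x] Y.supp_subset by auto

lemma F_isometry:
  assumes x: "x \<in> X.supp" "x' \<in> X.supp"
  shows "mm_dist Y (F x) (F x') = mm_dist X x x'"
proof -
  have S: "x \<in> X.S" "x' \<in> X.S" "F x \<in> Y.S" "F x' \<in> Y.S"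
    using x F X.supp_subset Y.supp_subset by auto
  have "\<bar>mm_dist Y (F x) (F x') - mm_dist X x x'\<bar> \<le> e" if "e > 0" for e
  proof -
    obtain v where v: "v \<in> T" "mm_dist X x' (\<phi> v) < e / 2"
      using near[OF x(2), of "e / 2"] \<open>e > 0\<close> by auto
    have "mm_dist Y (F x) (\<psi> v) = mm_dist X x (\<phi> v)" "mm_dist Y (F x') (\<psi> v) = mm_dist X x' (\<phi> v)"
      using F(2)[OF x(1)] F(2)[OF x(2)] v(1) by (auto simp: corr_def)
    then show ?thesis
      using Y.mdist_diff_le[of "F x" "F x" "F x'" "\<psi> v"] X.mdist_diff_le[of x x x' "\<phi> v"]
        v(2) S \<phi>_in[OF v(1)] \<psi>_in[OF v(1)] by simp
  qed
  then have "\<bar>mm_dist Y (F x) (F x') - mm_dist X x x'\<bar> \<le> 0"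
    by (rule field_le_epsilon[of _ 0, simplified])
  then show ?thesis by simp
qed

text \<open>\<open>F\<close> is an isometry, so the preimage of a ball is the trace on the support
  of a union of open balls.\<close>

lemma F_measurable: "F \<in> restrict_space (mm_meas X) X.supp \<rightarrow>\<^sub>M mm_meas Y"
proof (rule Y.measurableI_balls)
  have sp: "space (restrict_space (mm_meas X) X.supp) = X.supp"
    using X.supp_subset by (auto simp: space_restrict_space)
  show "F w \<in> Y.S" if "w \<in> space (restrict_space (mm_meas X) X.supp)" for w
    using that F Y.supp_subset unfolding sp by auto
  fix i r
  let ?A = "{w \<in> X.supp. mm_dist Y (Y.xs i) (F w) < r}"
  define U where "U = (\<Union>w\<in>?A. X.mball w (r - mm_dist Y (Y.xs i) (F w)))"
  have "?A = X.supp \<inter> U"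
  proof (intro equalityI subsetI)
    fix w assume w: "w \<in> ?A"
    then have "w \<in> X.mball w (r - mm_dist Y (Y.xs i) (F w))"
      using X.supp_subset by auto
    then show "w \<in> X.supp \<inter> U" using w unfolding U_def by blast
  next
    fix z assume "z \<in> X.supp \<inter> U"
    then obtain w where w: "w \<in> ?A" "mm_dist X w z < r - mm_dist Y (Y.xs i) (F w)" and z: "z \<in> X.supp"
      by (auto simp: U_def)
    have "F w \<in> Y.S" "F z \<in> Y.S"
      using F(1) w(1) z Y.supp_subset by auto
    then show "z \<in> ?A"
      using F_isometry[of w z] Y.triangle[of "Y.xs i" "F w" "F z"] w z by simp
  qed
  moreover have "U \<in> sets (mm_meas X)"
    unfolding U_def by (intro X.sets_openin openin_Union) auto
  ultimately have "?A \<in> sets (mm_meas X)" using X.sets_supp by auto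
  then show "{w \<in> space (restrict_space (mm_meas X) X.supp). mm_dist Y (Y.xs i) (F w) < r}
      \<in> sets (restrict_space (mm_meas X) X.supp)"
    unfolding sp by (subst sets_restrict_space_iff) (auto simp: X.sets_supp)
qed

lemma mm_iso: "mm_iso X Y"
  unfolding mm_iso_def
proof (intro exI[of _ F] conjI ballI)
  interpret sw: mm_match Y X \<psi> \<phi> T by (rule swap)
  have cs: "sw.corr y x \<longleftrightarrow> corr x y" for x y
    by (auto simp: corr_def sw.corr_def)
  show "bij_betw F X.supp Y.supp"
  proof (rule bij_betw_byWitness[of _ sw.F])
    show "\<forall>a\<in>X.supp. sw.F (F a) = a"
      using sw.F_eqI cs F X.supp_subset by blast
    show "\<forall>a\<in>Y.supp. F (sw.F a) = a"
      using F_eqI cs sw.F Y.supp_subset by blast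
  qed (use F sw.F in auto)
  show "mm_dist Y (F x) (F y) = mm_dist X x y" if "x \<in> X.supp" "y \<in> X.supp" for x y
    using that by (rule F_isometry)
  fix B assume B: "B \<in> sets (mm_meas Y)"
  have m: "\<phi> \<in> unit_interval_L \<rightarrow>\<^sub>M mm_meas X" "\<psi> \<in> unit_interval_L \<rightarrow>\<^sub>M mm_meas Y"
    and law: "distr unit_interval_L (mm_meas X) \<phi> = mm_meas X" "distr unit_interval_L (mm_meas Y) \<psi> = mm_meas Y"
    using \<phi> \<psi> by (auto simp: mm_parameter_def)
  let ?A = "{x \<in> X.supp. F x \<in> B}"
  have A: "?A \<in> sets (mm_meas X)"
  proof -
    have "F -` B \<inter> space (restrict_space (mm_meas X) X.supp) \<in> sets (restrict_space (mm_meas X) X.supp)"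
      by (rule measurable_sets[OF F_measurable B])
    moreover have "F -` B \<inter> space (restrict_space (mm_meas X) X.supp) = ?A"
      using X.supp_subset by (auto simp: space_restrict_space)
    ultimately show ?thesis
      by (subst (asm) sets_restrict_space_iff) (auto simp: X.sets_supp)
  qed
  have AEs: "AE v in unit_interval_L. \<phi> v \<in> X.supp"
  proof -
    have "AE x in distr unit_interval_L (mm_meas X) \<phi>. x \<in> X.supp"
      unfolding law by (rule AE_I'[OF X.supp_compl_null]) auto
    then show ?thesis
      by (subst (asm) AE_distr_iff[OF m(1)]) (use X.sets_supp X.supp_subset in \<open>auto simp: Int_absorb1 Collect_conj_eq\<close>)
  qed
  have "emeasure (mm_meas X) ?A = emeasure unit_interval_L (\<phi> -` ?A \<inter> space unit_interval_L)"
    using emeasure_distr[OF m(1) A] by (simp add: law)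
  also have "\<dots> = emeasure unit_interval_L (\<psi> -` B \<inter> space unit_interval_L)"
  proof (rule emeasure_eq_AE)
    show "AE v in unit_interval_L. v \<in> \<phi> -` ?A \<inter> space unit_interval_L \<longleftrightarrow> v \<in> \<psi> -` B \<inter> space unit_interval_L"
      using AEs AE_T
    proof eventually_elim
      case (elim v)
      \<comment> \<open>\<open>F\<close> sends almost every parameter value to its partner, so the
        two preimages agree up to a null set; this carries one law to the other.\<close>
      have "corr (\<phi> v) (\<psi> v)"
        unfolding corr_def using iso elim(2) by auto
      then have "F (\<phi> v) = \<psi> v"
        using F_eqI elim \<psi>_in by blast
      then show ?case using elim T_sub by auto
    qed
  qed (use measurable_sets[OF m(1) A] measurable_sets[OF m(2) B] in auto)
  also have "\<dots> = emeasure (mm_meas Y) B"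
    using emeasure_distr[OF m(2) B] by (simp add: law)
  finally show "emeasure (mm_meas X) ?A = emeasure (mm_meas Y) B" .
qed

end

text \<open>If the attained infimum were 0, the good interval would be all of \<open>{0..<1}\<close>
  and the pulled-back distances would coincide there.\<close>

lemma box_dist_pos:
  assumes "mm_space X" "mm_space Y" "\<not> mm_iso X Y"
  shows "box_dist X Y > 0"
proof (rule ccontr)
  assume "\<not> box_dist X Y > 0"
  then have b: "box_dist X Y = 0" using box_dist_nonneg[OF assms(1,2)] by simp
  obtain \<phi> \<psi> where p: "mm_parameter X \<phi>" "mm_parameter Y \<psi>"
    "\<And>s t. s \<in> {0..<1} \<Longrightarrow> t \<in> {0..<1} \<Longrightarrow> \<bar>mm_dist X (\<phi> s) (\<phi> t) - mm_dist Y (\<psi> s) (\<psi> t)\<bar> \<le> 0"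
    using box_dist_attained[OF assms(1,2)] unfolding b by auto
  have "mm_match X Y \<phi> \<psi> {0..<1}"
    using assms p by unfold_locales (auto simp: sets_unit_interval_L measure_unit_interval_L)
  then show False
    using mm_match.mm_iso assms(3) by blast
qed

section \<open>The triangle inequality for the box distance\<close>

text \<open>The plane with its usual metric is itself an instance of \<open>mm_space\<close>, so
  \<open>mm.ex_parameter\<close> turns a coupling on the unit square into a map defined on the unit
  interval.\<close>

lemma ex_parameter_plane:
  fixes P :: "(real \<times> real) measure"
  assumes "prob_space P" and sets: "sets P = sets borel"
  obtains \<omega> where "\<omega> \<in> unit_interval_L \<rightarrow>\<^sub>M borel" "distr unit_interval_L borel \<omega> = P"
proof -
  have sp: "space P = UNIV"
    using sets_eq_imp_space_eq[OF sets] by simp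
  have sep: "separable_space (euclidean :: (real \<times> real) topology)"
  proof -
    obtain D :: "(real \<times> real) set" where D: "countable D" "\<And>X. open X \<Longrightarrow> X \<noteq> {} \<Longrightarrow> \<exists>d\<in>D. d \<in> X"
      using countable_dense_exists by blast
    have "closure D = UNIV"
    proof (rule ccontr)
      assume "closure D \<noteq> UNIV"
      then have "- closure D \<noteq> {}" by blast
      with D(2)[of "- closure D"] obtain d where "d \<in> D" "d \<in> - closure D"
        by (metis closed_closure open_Compl)
      then show False using closure_subset by blast
    qed
    then show ?thesis
      unfolding separable_space_def using D(1) by auto
  qed
  have "mm_space (dist, P)"
    unfolding mm_space_def mm_dist_def mm_meas_def Let_def fst_conv snd_conv sp
  proof (intro conjI)
    show "Metric_space UNIV (dist :: real \<times> real \<Rightarrow> _)" by (rule Met_TC.Metric_space_axioms)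
    show "Met_TC.mcomplete TYPE(real \<times> real)"
      by (simp add: complete_UNIV)
    show "separable_space (Met_TC.mtopology :: (real \<times> real) topology)"
      using sep by simp
    show "sets P = sigma_sets UNIV {U. openin Met_TC.mtopology U}"
      by (simp add: sets borel_def)
  qed fact
  then obtain \<omega> where "mm_parameter (dist, P) \<omega>"
    using mm.ex_parameter[OF mm.intro] by blast
  then have "\<omega> \<in> unit_interval_L \<rightarrow>\<^sub>M P" "distr unit_interval_L P \<omega> = P"
    by (auto simp: mm_parameter_def mm_meas_def)
  then show thesis
    using that[of \<omega>] measurable_cong_sets[OF refl sets] distr_cong[OF refl sets] by metis
qed

lemma sets_Collect_eq_nat:
  fixes f g :: "'a \<Rightarrow> nat"
  assumes "f \<in> M \<rightarrow>\<^sub>M count_space UNIV" "g \<in> M \<rightarrow>\<^sub>M count_space UNIV"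
  shows "{x \<in> space M. f x = g x} \<in> sets M"
proof -
  have "{x \<in> space M. f x = g x} = (\<Union>i. (f -` {i} \<inter> space M) \<inter> (g -` {i} \<inter> space M))"
    by auto
  also have "\<dots> \<in> sets M"
    using measurable_sets[OF assms(1)] measurable_sets[OF assms(2)]
    by (intro sets.countable_UN image_subsetI) (rule sets.Int, simp_all)
  finally show ?thesis .
qed

lemma measurable_fst_snd_if:
  assumes k: "k1 \<in> M \<rightarrow>\<^sub>M count_space (UNIV :: nat set)" "k2 \<in> N \<rightarrow>\<^sub>M count_space UNIV"
  shows "(\<lambda>x. if k1 (fst x) = k2 (snd x) then g (k1 (fst x)) else (0::ennreal)) \<in> borel_measurable (M \<Otimes>\<^sub>M N)"
proof -
  have k1: "(\<lambda>x. k1 (fst x)) \<in> M \<Otimes>\<^sub>M N \<rightarrow>\<^sub>M count_space UNIV"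
    by (rule measurable_compose[OF measurable_fst k(1)])
  have k2: "(\<lambda>x. k2 (snd x)) \<in> M \<Otimes>\<^sub>M N \<rightarrow>\<^sub>M count_space UNIV"
    by (rule measurable_compose[OF measurable_snd k(2)])
  show ?thesis
    by (rule measurable_If[OF measurable_compose[OF k1] _ sets_Collect_eq_nat[OF k1 k2]]) simp_all
qed

text \<open>Gluing step for the triangle inequality. The two parameters of the middle space are made
  to agree in their codes of one fixed level, not as points. This is a countable condition, so the
  coupling has an explicit density and no disintegration is involved.\<close>

lemma ex_coupling_over_code:
  fixes k1 k2 :: "real \<Rightarrow> nat"
  assumes k[measurable]: "k1 \<in> unit_interval_L \<rightarrow>\<^sub>M count_space UNIV" "k2 \<in> unit_interval_L \<rightarrow>\<^sub>M count_space UNIV"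
    and law: "\<And>i. emeasure unit_interval_L {u \<in> {0..<1}. k1 u = i} = emeasure unit_interval_L {u \<in> {0..<1}. k2 u = i}"
  obtains \<alpha> \<beta> where "\<alpha> \<in> unit_interval_L \<rightarrow>\<^sub>M unit_interval_L" "\<beta> \<in> unit_interval_L \<rightarrow>\<^sub>M unit_interval_L"
    "distr unit_interval_L unit_interval_L \<alpha> = unit_interval_L"
    "distr unit_interval_L unit_interval_L \<beta> = unit_interval_L"
    "AE u in unit_interval_L. k1 (\<alpha> u) = k2 (\<beta> u)"
proof -
  let ?U = unit_interval_L
  define p where "p i = emeasure ?U {u \<in> {0..<1}. k1 u = i}" for i
  \<comment> \<open>The density of the coupling that is conditionally independent given the common code.\<close>
  define h where "h x = (if k1 (fst x) = k2 (snd x) then inverse (p (k1 (fst x))) else 0)" for x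
  define Q where "Q = density (?U \<Otimes>\<^sub>M ?U) h"
  interpret UU: pair_prob_space ?U ?U ..
  have h_meas[measurable]: "h \<in> borel_measurable (?U \<Otimes>\<^sub>M ?U)"
    unfolding h_def by (rule measurable_fst_snd_if) measurable
  have kset: "{u \<in> {0..<1}. k1 u = i} \<in> sets ?U" "{u \<in> {0..<1}. k2 u = i} \<in> sets ?U" for i
    using measurable_sets[OF k(1), of "{i}"] measurable_sets[OF k(2), of "{i}"]
    by (simp_all add: vimage_def Int_def conj_commute)
  have p2: "p i = emeasure ?U {u \<in> {0..<1}. k2 u = i}" for i
    unfolding p_def by (rule law)
  have p_fin: "p i \<noteq> \<infinity>" for i
    unfolding p_def by (simp add: UL.emeasure_eq_measure)
  \<comment> \<open>The density is infinite at codes of mass zero; such codes are met only on a null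
    set.\<close>
  have AEp: "AE u in ?U. p (f u) \<noteq> 0"
    if f: "f \<in> ?U \<rightarrow>\<^sub>M count_space UNIV" "\<And>i. p i = emeasure ?U {u \<in> {0..<1}. f u = i}"
      "\<And>i. {u \<in> {0..<1}. f u = i} \<in> sets ?U" for f
  proof (rule AE_I')
    show "(\<Union>i\<in>{i. p i = 0}. {u \<in> {0..<1}. f u = i}) \<in> null_sets ?U"
      by (intro null_sets_UN' countableI_type) (use f in \<open>auto intro!: null_setsI\<close>)
  qed auto
  have int1: "(\<integral>\<^sup>+v. h (u, v) \<partial>?U) = 1" if "p (k1 u) \<noteq> 0" for u
  proof -
    have "(\<integral>\<^sup>+v. h (u, v) \<partial>?U) = (\<integral>\<^sup>+v. inverse (p (k1 u)) * indicator {v \<in> {0..<1}. k2 v = k1 u} v \<partial>?U)"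
      by (intro nn_integral_cong) (auto simp: h_def indicator_def)
    also have "\<dots> = inverse (p (k1 u)) * p (k1 u)"
      by (subst nn_integral_cmult_indicator[OF kset(2)]) (simp add: p2)
    finally show ?thesis
      using ennreal_divide_self[OF that] p_fin by (simp add: divide_ennreal_def mult.commute less_top)
  qed
  have int2: "(\<integral>\<^sup>+u. h (u, v) \<partial>?U) = 1" if "p (k2 v) \<noteq> 0" for v
  proof -
    have "(\<integral>\<^sup>+u. h (u, v) \<partial>?U) = (\<integral>\<^sup>+u. inverse (p (k2 v)) * indicator {u \<in> {0..<1}. k1 u = k2 v} u \<partial>?U)"
      by (intro nn_integral_cong) (auto simp: h_def indicator_def)
    also have "\<dots> = inverse (p (k2 v)) * p (k2 v)"
      by (subst nn_integral_cmult_indicator[OF kset(1)]) (simp add: p_def)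
    finally show ?thesis
      using ennreal_divide_self[OF that] p_fin by (simp add: divide_ennreal_def mult.commute less_top)
  qed
  have fst_Q: "emeasure Q (fst -` A \<inter> space Q) = emeasure ?U A" if A: "A \<in> sets ?U" for A
  proof -
    have [measurable]: "A \<in> sets ?U" by fact
    have "emeasure Q (fst -` A \<inter> space Q) = (\<integral>\<^sup>+x. h x * indicator A (fst x) \<partial>(?U \<Otimes>\<^sub>M ?U))"
      unfolding Q_def
      by (subst emeasure_density) (auto intro!: nn_integral_cong simp: indicator_def)
    also have "\<dots> = (\<integral>\<^sup>+u. (\<integral>\<^sup>+v. h (u, v) * indicator A u \<partial>?U) \<partial>?U)"
      by (subst UL.nn_integral_fst[symmetric]) auto
    also have "\<dots> = (\<integral>\<^sup>+u. indicator A u \<partial>?U)"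
    proof (intro nn_integral_cong_AE)
      show "AE u in ?U. (\<integral>\<^sup>+v. h (u, v) * indicator A u \<partial>?U) = indicator A u"
        using AEp[OF k(1) p_def kset(1)]
      proof eventually_elim
        case (elim u)
        then show ?case using int1[of u] by (cases "u \<in> A") simp_all
      qed
    qed
    also have "\<dots> = emeasure ?U A" by simp
    finally show ?thesis .
  qed
  have snd_Q: "emeasure Q (snd -` A \<inter> space Q) = emeasure ?U A" if A: "A \<in> sets ?U" for A
  proof -
    have [measurable]: "A \<in> sets ?U" by fact
    have "emeasure Q (snd -` A \<inter> space Q) = (\<integral>\<^sup>+x. h x * indicator A (snd x) \<partial>(?U \<Otimes>\<^sub>M ?U))"
      unfolding Q_def
      by (subst emeasure_density) (auto intro!: nn_integral_cong simp: indicator_def)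
    also have "\<dots> = (\<integral>\<^sup>+v. (\<integral>\<^sup>+u. h (u, v) * indicator A v \<partial>?U) \<partial>?U)"
      by (subst UU.nn_integral_snd[symmetric]) (auto simp: case_prod_beta)
    also have "\<dots> = (\<integral>\<^sup>+v. indicator A v \<partial>?U)"
    proof (intro nn_integral_cong_AE)
      show "AE v in ?U. (\<integral>\<^sup>+u. h (u, v) * indicator A v \<partial>?U) = indicator A v"
        using AEp[OF k(2) p2 kset(2)]
      proof eventually_elim
        case (elim v)
        then show ?case using int2[of v] by (cases "v \<in> A") simp_all
      qed
    qed
    also have "\<dots> = emeasure ?U A" by simp
    finally show ?thesis .
  qed
  have spQ: "space Q = {0..<1} \<times> {0..<1}"
    by (simp add: Q_def space_pair_measure)
  have setsQ: "sets Q = sets (?U \<Otimes>\<^sub>M ?U)" by (simp add: Q_def)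
  have "prob_space Q"
  proof
    have "fst -` {0..<1} \<inter> space Q = space Q" by (auto simp: spQ)
    then show "emeasure Q (space Q) = 1"
      using fst_Q[of "{0..<1}"] UL.emeasure_space_1 sets.top[of ?U] by simp
  qed
  have U_borel: "(\<lambda>x. x) \<in> ?U \<rightarrow>\<^sub>M borel"
    unfolding unit_interval_L_def by (rule measurable_restrict_space1) simp
  have fs: "fst \<in> Q \<rightarrow>\<^sub>M ?U" "snd \<in> Q \<rightarrow>\<^sub>M ?U"
    unfolding measurable_cong_sets[OF setsQ refl] by measurable
  have idm: "(\<lambda>x. x) \<in> Q \<rightarrow>\<^sub>M (borel :: (real \<times> real) measure)"
  proof -
    have "(\<lambda>x. (fst x, snd x)) \<in> Q \<rightarrow>\<^sub>M (borel :: (real \<times> real) measure)"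
      by (intro borel_measurable_Pair measurable_compose[OF fs(1) U_borel] measurable_compose[OF fs(2) U_borel])
    then show ?thesis by simp
  qed
  let ?P = "distr Q borel (\<lambda>x. x)"
  have "prob_space ?P" by (rule prob_space.prob_space_distr[OF \<open>prob_space Q\<close> idm])
  then obtain \<omega> where \<omega>: "\<omega> \<in> ?U \<rightarrow>\<^sub>M borel" "distr ?U borel \<omega> = ?P"
    using ex_parameter_plane[of ?P] by auto
  \<comment> \<open>\<open>Q\<close> lives on the unit square, but the parameter
    \<open>\<omega>\<close> takes values in the plane; \<open>cl\<close> retracts its coordinates
    into the unit interval.\<close>
  define cl where "cl x = (if x \<in> {0..<1} then x else 0)" for x :: real
  have cl: "cl \<in> borel \<rightarrow>\<^sub>M ?U"
    unfolding unit_interval_L_def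
  proof (rule measurable_restrict_space2)
    show "cl \<in> borel \<rightarrow>\<^sub>M lborel" unfolding cl_def by measurable
  qed (auto simp: cl_def)
  have pr: "fst \<in> (borel :: (real \<times> real) measure) \<rightarrow>\<^sub>M borel" "snd \<in> (borel :: (real \<times> real) measure) \<rightarrow>\<^sub>M borel"
    by (intro borel_measurable_continuous_onI continuous_intros)+
  have cf: "(\<lambda>x :: real \<times> real. cl (fst x)) \<in> borel \<rightarrow>\<^sub>M ?U" "(\<lambda>x :: real \<times> real. cl (snd x)) \<in> borel \<rightarrow>\<^sub>M ?U"
    by (rule measurable_compose[OF pr(1) cl], rule measurable_compose[OF pr(2) cl])
  have law_g: "distr ?U N (\<lambda>u. g (\<omega> u)) = distr Q N g"
    if g: "g \<in> borel \<rightarrow>\<^sub>M N" for g and N :: "real measure"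
  proof -
    have "distr ?U N (\<lambda>u. g (\<omega> u)) = distr (distr ?U borel \<omega>) N g"
      using distr_distr[OF g \<omega>(1)] by (simp add: comp_def)
    also have "\<dots> = distr Q N g"
      unfolding \<omega>(2) using distr_distr[OF g idm] by (simp add: comp_def)
    finally show ?thesis .
  qed
  have distr_fst: "distr Q ?U (\<lambda>x. cl (fst x)) = ?U"
  proof -
    have "distr Q ?U (\<lambda>x. cl (fst x)) = distr Q ?U fst"
      by (intro distr_cong refl) (auto simp: spQ cl_def)
    also have "\<dots> = ?U"
      by (intro measure_eqI) (simp_all add: emeasure_distr[OF fs(1)] fst_Q)
    finally show ?thesis .
  qed
  have distr_snd: "distr Q ?U (\<lambda>x. cl (snd x)) = ?U"
  proof -
    have "distr Q ?U (\<lambda>x. cl (snd x)) = distr Q ?U snd"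
      by (intro distr_cong refl) (auto simp: spQ cl_def)
    also have "\<dots> = ?U"
      by (intro measure_eqI) (simp_all add: emeasure_distr[OF fs(2)] snd_Q)
    finally show ?thesis .
  qed
  have AEQ: "AE x in Q. k1 (cl (fst x)) = k2 (cl (snd x))"
  proof -
    have "AE x in (?U \<Otimes>\<^sub>M ?U). 0 < h x \<longrightarrow> k1 (cl (fst x)) = k2 (cl (snd x))"
      by (rule AE_I2) (auto simp: space_pair_measure cl_def h_def split: if_splits)
    then show ?thesis unfolding Q_def by (subst AE_density[OF h_meas])
  qed
  have kpred: "{x \<in> space (borel :: (real \<times> real) measure). k1 (cl (fst x)) = k2 (cl (snd x))} \<in> sets borel"
  proof -
    have "(\<lambda>x. k1 (cl (fst x))) \<in> (borel :: (real \<times> real) measure) \<rightarrow>\<^sub>M count_space UNIV"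
      "(\<lambda>x. k2 (cl (snd x))) \<in> (borel :: (real \<times> real) measure) \<rightarrow>\<^sub>M count_space UNIV"
      by (rule measurable_compose[OF cf(1) k(1)], rule measurable_compose[OF cf(2) k(2)])
    then show ?thesis by (rule sets_Collect_eq_nat)
  qed
  show thesis
  proof (rule that)
    show "(\<lambda>u. cl (fst (\<omega> u))) \<in> ?U \<rightarrow>\<^sub>M ?U" "(\<lambda>u. cl (snd (\<omega> u))) \<in> ?U \<rightarrow>\<^sub>M ?U"
      by (rule measurable_compose[OF \<omega>(1) cf(1)], rule measurable_compose[OF \<omega>(1) cf(2)])
    show "distr ?U ?U (\<lambda>u. cl (fst (\<omega> u))) = ?U" "distr ?U ?U (\<lambda>u. cl (snd (\<omega> u))) = ?U"
      using law_g[OF cf(1)] law_g[OF cf(2)] distr_fst distr_snd by simp_all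
    have "AE x in ?P. k1 (cl (fst x)) = k2 (cl (snd x))"
      by (subst AE_distr_iff[OF idm kpred]) (rule AEQ)
    then have "AE x in distr ?U borel \<omega>. k1 (cl (fst x)) = k2 (cl (snd x))"
      unfolding \<omega>(2) .
    then show "AE u in ?U. k1 (cl (fst (\<omega> u))) = k2 (cl (snd (\<omega> u)))"
      by (subst (asm) AE_distr_iff[OF \<omega>(1) kpred])
  qed
qed

lemma mm_parameter_compose:
  assumes \<phi>: "mm_parameter X \<phi>" and \<alpha>: "\<alpha> \<in> unit_interval_L \<rightarrow>\<^sub>M unit_interval_L"
    "distr unit_interval_L unit_interval_L \<alpha> = unit_interval_L"
  shows "mm_parameter X (\<phi> \<circ> \<alpha>)"
proof -
  have m: "\<phi> \<in> unit_interval_L \<rightarrow>\<^sub>M mm_meas X" and d: "distr unit_interval_L (mm_meas X) \<phi> = mm_meas X"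
    using \<phi> by (auto simp: mm_parameter_def)
  have "distr unit_interval_L (mm_meas X) (\<phi> \<circ> \<alpha>) = distr (distr unit_interval_L unit_interval_L \<alpha>) (mm_meas X) \<phi>"
    by (rule distr_distr[OF m \<alpha>(1), symmetric])
  then show ?thesis
    using measurable_comp[OF \<alpha>(1) m] by (simp add: mm_parameter_def \<alpha>(2) d)
qed

lemma box_dist_triangle:
  assumes X: "mm_space X" and Y: "mm_space Y" and Z: "mm_space Z"
  shows "box_dist X Z \<le> box_dist X Y + box_dist Y Z"
proof (rule field_le_epsilon)
  fix \<eta> :: real assume \<eta>: "\<eta> > 0"
  interpret Y: mm Y by (rule mm.intro) fact
  let ?U = unit_interval_L
  obtain e1 where e1: "e1 \<in> box_set X Y" "e1 < box_dist X Y + \<eta> / 4"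
    by (rule box_dist_less_obtains[OF X Y, of "box_dist X Y + \<eta> / 4"]) (use \<eta> in auto)
  obtain e2 where e2: "e2 \<in> box_set Y Z" "e2 < box_dist Y Z + \<eta> / 4"
    by (rule box_dist_less_obtains[OF Y Z, of "box_dist Y Z + \<eta> / 4"]) (use \<eta> in auto)
  obtain \<phi> \<psi> I where 1: "0 \<le> e1" "mm_parameter X \<phi>" "mm_parameter Y \<psi>" "I \<in> sets borel" "I \<subseteq> {0..<1}"
    "measure lborel I \<ge> 1 - e1"
    "\<And>s t. s \<in> I \<Longrightarrow> t \<in> I \<Longrightarrow> \<bar>mm_dist X (\<phi> s) (\<phi> t) - mm_dist Y (\<psi> s) (\<psi> t)\<bar> \<le> e1"
    using e1(1) unfolding box_set_def by blast
  obtain \<psi>' \<theta> J where 2: "0 \<le> e2" "mm_parameter Y \<psi>'" "mm_parameter Z \<theta>" "J \<in> sets borel" "J \<subseteq> {0..<1}"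
    "measure lborel J \<ge> 1 - e2"
    "\<And>s t. s \<in> J \<Longrightarrow> t \<in> J \<Longrightarrow> \<bar>mm_dist Y (\<psi>' s) (\<psi>' t) - mm_dist Z (\<theta> s) (\<theta> t)\<bar> \<le> e2"
    using e2(1) unfolding box_set_def by blast
  \<comment> \<open>The code error will enter as \<open>4 * (1/2) ^ m\<close>, which is below
    \<open>\<eta> / 2\<close>; approximating the two infima uses up the other half of
    \<open>\<eta>\<close>.\<close>
  obtain m where m: "(1/2 :: real) ^ m < \<eta> / 8"
    using real_arch_pow_inv[of "\<eta> / 8" "1 / 2"] \<eta> by auto
  have km: "(\<lambda>u. Y.code m (\<psi> u)) \<in> ?U \<rightarrow>\<^sub>M count_space UNIV" "(\<lambda>u. Y.code m (\<psi>' u)) \<in> ?U \<rightarrow>\<^sub>M count_space UNIV"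
    using 1(3) 2(2) by (auto simp: mm_parameter_def intro: Y.measurable_code)
  obtain \<alpha> \<beta> where \<alpha>: "\<alpha> \<in> ?U \<rightarrow>\<^sub>M ?U" "distr ?U ?U \<alpha> = ?U" and \<beta>: "\<beta> \<in> ?U \<rightarrow>\<^sub>M ?U" "distr ?U ?U \<beta> = ?U"
    and ae: "AE u in ?U. Y.code m (\<psi> (\<alpha> u)) = Y.code m (\<psi>' (\<beta> u))"
    by (rule ex_coupling_over_code[OF km])
      (use Y.parameter_emeasure[OF 1(3) Y.sets_code] Y.parameter_emeasure[OF 2(2) Y.sets_code] in auto)
  have \<alpha>s: "\<alpha> u \<in> {0..<1}" "\<beta> u \<in> {0..<1}" if "u \<in> {0..<1}" for u
    using measurable_space[OF \<alpha>(1), of u] measurable_space[OF \<beta>(1), of u] that by auto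
  let ?A = "\<alpha> -` I \<inter> {0..<1}" and ?B = "\<beta> -` J \<inter> {0..<1}"
  define K where "K = {u \<in> {0..<1}. Y.code m (\<psi> (\<alpha> u)) = Y.code m (\<psi>' (\<beta> u))}"
  have IU: "I \<in> sets ?U" "J \<in> sets ?U" using 1 2 by (auto simp: sets_unit_interval_L)
  have As: "?A \<in> sets ?U" "?B \<in> sets ?U"
    using measurable_sets[OF \<alpha>(1) IU(1)] measurable_sets[OF \<beta>(1) IU(2)] by auto
  have Ks: "K \<in> sets ?U"
  proof -
    have "(\<lambda>u. Y.code m (\<psi> (\<alpha> u))) \<in> ?U \<rightarrow>\<^sub>M count_space UNIV"
      "(\<lambda>u. Y.code m (\<psi>' (\<beta> u))) \<in> ?U \<rightarrow>\<^sub>M count_space UNIV"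
      by (rule measurable_compose[OF \<alpha>(1) km(1)], rule measurable_compose[OF \<beta>(1) km(2)])
    from sets_Collect_eq_nat[OF this]
    have "{u \<in> space ?U. Y.code m (\<psi> (\<alpha> u)) = Y.code m (\<psi>' (\<beta> u))} \<in> sets ?U" .
    then show ?thesis by (simp add: K_def)
  qed
  have mA: "measure ?U ?A \<ge> 1 - e1"
  proof -
    have "measure ?U ?A = measure (distr ?U ?U \<alpha>) I"
      by (simp add: measure_distr[OF \<alpha>(1) IU(1)])
    then show ?thesis using 1(6) by (simp add: \<alpha>(2) measure_unit_interval_L[OF 1(5)])
  qed
  have mB: "measure ?U ?B \<ge> 1 - e2"
  proof -
    have "measure ?U ?B = measure (distr ?U ?U \<beta>) J"
      by (simp add: measure_distr[OF \<beta>(1) IU(2)])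
    then show ?thesis using 2(6) by (simp add: \<beta>(2) measure_unit_interval_L[OF 2(5)])
  qed
  \<comment> \<open>The two good sets are pulled back by measure preserving maps and keep their
    masses; agreement of the codes holds almost everywhere and costs no mass.\<close>
  define T where "T = ?A \<inter> ?B \<inter> K"
  have Ts: "T \<in> sets ?U" unfolding T_def using As Ks by auto
  have "measure ?U T = measure ?U (?A \<inter> ?B)"
    by (rule UL.finite_measure_eq_AE) (use ae As Ts in \<open>auto simp: T_def K_def\<close>)
  moreover have "measure ?U (?A \<inter> ?B) = measure ?U ?A + measure ?U ?B - measure ?U (?A \<union> ?B)"
    using UL.finite_measure_Union'[OF As] UL.finite_measure_Diff'[OF As(2,1)] by (simp add: Int_commute)
  moreover have "measure ?U (?A \<union> ?B) \<le> 1" by (rule UL.prob_le_1)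
  ultimately have mT: "measure ?U T \<ge> 1 - (e1 + e2)" using mA mB by linarith
  have "box_dist X Z \<le> e1 + e2 + 4 * (1/2) ^ m"
  proof (rule box_dist_le)
    show "mm_parameter X (\<phi> \<circ> \<alpha>)" "mm_parameter Z (\<theta> \<circ> \<beta>)"
      by (rule mm_parameter_compose[OF 1(2) \<alpha>], rule mm_parameter_compose[OF 2(3) \<beta>])
    show "T \<in> sets borel" "T \<subseteq> {0..<1}" using Ts by (auto simp: sets_unit_interval_L)
    have "0 \<le> (1/2 :: real) ^ m" by simp
    then show "1 - (e1 + e2 + 4 * (1/2) ^ m) \<le> measure lborel T"
      using mT unfolding measure_unit_interval_L[OF \<open>T \<subseteq> {0..<1}\<close>] by linarith
    show "0 \<le> e1 + e2 + 4 * (1/2) ^ m" using 1(1) 2(1) by simp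
    have close: "mm_dist Y (\<psi> (\<alpha> s)) (\<psi>' (\<beta> s)) \<le> 2 * (1/2) ^ m" "\<psi> (\<alpha> s) \<in> Y.S" "\<psi>' (\<beta> s) \<in> Y.S" if "s \<in> T" for s
    proof -
      have s: "s \<in> {0..<1}" "Y.code m (\<psi> (\<alpha> s)) = Y.code m (\<psi>' (\<beta> s))"
        using that by (auto simp: T_def K_def)
      show S: "\<psi> (\<alpha> s) \<in> Y.S" "\<psi>' (\<beta> s) \<in> Y.S"
        using Y.parameter_in 1(3) 2(2) \<alpha>s[OF s(1)] by auto
      show "mm_dist Y (\<psi> (\<alpha> s)) (\<psi>' (\<beta> s)) \<le> 2 * (1/2) ^ m"
        using Y.code_dist[OF S(1), of m] Y.code_dist[OF S(2), of m] s(2) S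
          Y.triangle''[of "\<psi> (\<alpha> s)" "Y.xs (Y.code m (\<psi> (\<alpha> s)))" "\<psi>' (\<beta> s)"] by simp
    qed
    fix s t assume s: "s \<in> T" and t: "t \<in> T"
    then have "\<alpha> s \<in> I" "\<alpha> t \<in> I" "\<beta> s \<in> J" "\<beta> t \<in> J" by (auto simp: T_def)
    then show "\<bar>mm_dist X ((\<phi> \<circ> \<alpha>) s) ((\<phi> \<circ> \<alpha>) t) - mm_dist Z ((\<theta> \<circ> \<beta>) s) ((\<theta> \<circ> \<beta>) t)\<bar> \<le> e1 + e2 + 4 * (1/2) ^ m"
      using 1(7)[of "\<alpha> s" "\<alpha> t"] 2(7)[of "\<beta> s" "\<beta> t"] close[OF s] close[OF t]
        Y.mdist_diff_le[of "\<psi> (\<alpha> s)" "\<psi>' (\<beta> s)" "\<psi> (\<alpha> t)" "\<psi>' (\<beta> t)"] by simp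
  qed
  then show "box_dist X Z \<le> box_dist X Y + box_dist Y Z + \<eta>"
    using e1(2) e2(2) m by linarith
qed

section \<open>Realizing pseudometrics on the unit interval by mm-spaces\<close>

definition pseudometric :: "('c \<Rightarrow> 'c \<Rightarrow> real) \<Rightarrow> bool" where
  "pseudometric \<rho> \<longleftrightarrow> (\<forall>x. \<rho> x x = 0) \<and> (\<forall>x y. 0 \<le> \<rho> x y) \<and> (\<forall>x y. \<rho> x y = \<rho> y x) \<and>
     (\<forall>x y z. \<rho> x z \<le> \<rho> x y + \<rho> y z)"

text \<open>Separability through countable partitions into pieces of small diameter instead of a
  dense set: this form passes to pullbacks along arbitrary maps and, by common refinement, to
  sums.\<close>

definition separable_pm :: "('c \<Rightarrow> 'c \<Rightarrow> real) \<Rightarrow> bool" where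
  "separable_pm \<rho> \<longleftrightarrow> (\<forall>e>0. \<exists>k :: 'c \<Rightarrow> nat. \<forall>x y. k x = k y \<longrightarrow> \<rho> x y < e)"

lemma pseudometricD:
  assumes "pseudometric \<rho>"
  shows "\<rho> x x = 0" "0 \<le> \<rho> x y" "\<rho> x y = \<rho> y x" "\<rho> x z \<le> \<rho> x y + \<rho> y z"
  using assms by (auto simp: pseudometric_def)

lemma separable_pm_dense:
  assumes "separable_pm (\<rho> :: 'c \<Rightarrow> 'c \<Rightarrow> real)"
  obtains q :: "nat \<Rightarrow> 'c" where "\<And>u e. e > 0 \<Longrightarrow> \<exists>i. \<rho> u (q i) < e"
proof -
  have "\<exists>k :: 'c \<Rightarrow> nat. \<forall>x y. k x = k y \<longrightarrow> \<rho> x y < 1 / Suc n" for n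
    using assms by (simp add: separable_pm_def)
  then obtain k :: "nat \<Rightarrow> 'c \<Rightarrow> nat" where k: "\<And>n x y. k n x = k n y \<Longrightarrow> \<rho> x y < 1 / Suc n"
    by metis
  define q where "q m = (SOME v. k (fst (prod_decode m)) v = snd (prod_decode m))" for m
  have "\<exists>i. \<rho> u (q i) < e" if e: "e > 0" for u e
  proof -
    obtain n where n: "1 / Suc n < e"
      using e nat_approx_posE by blast
    have "q (prod_encode (n, k n u)) = (SOME v. k n v = k n u)"
      by (simp add: q_def)
    then have "k n (q (prod_encode (n, k n u))) = k n u"
      using someI[of "\<lambda>v. k n v = k n u" u] by metis
    then have "\<rho> u (q (prod_encode (n, k n u))) < e"
      using k[of n u "q (prod_encode (n, k n u))"] n by simp
    then show ?thesis by blast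
  qed
  then show thesis by (rule that)
qed

text \<open>A point is determined by the set of basic balls that contain it, so there are at most as
  many points as sets of naturals, hence as reals.\<close>

lemma metric_inj_real:
  fixes m :: "'c metric" and D :: "nat \<Rightarrow> 'c"
  assumes D: "\<And>i. D i \<in> mspace m" "\<And>x e. x \<in> mspace m \<Longrightarrow> e > 0 \<Longrightarrow> \<exists>i. mdist m (D i) x < e"
  obtains J :: "'c \<Rightarrow> real" where "inj_on J (mspace m)"
proof -
  obtain h :: "nat set \<Rightarrow> real" where h: "bij h"
    using nat_sets_eqpoll_reals unfolding eqpoll_def by auto
  define B where "B x = {i. mdist m (D (fst (prod_decode i))) x < 1 / Suc (snd (prod_decode i))}" for x
  have "inj_on B (mspace m)"
  proof
    fix x y assume x: "x \<in> mspace m" and y: "y \<in> mspace m" and eq: "B x = B y"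
    have "mdist m x y \<le> e" if e: "e > 0" for e
    proof -
      obtain n where n: "1 / Suc n < e / 2"
        using e by (metis half_gt_zero nat_approx_posE)
      obtain i where i: "mdist m (D i) x < 1 / Suc n"
        using D(2)[OF x, of "1 / Suc n"] by auto
      then have "prod_encode (i, n) \<in> B x" by (simp add: B_def)
      then have "mdist m (D i) y < 1 / Suc n" unfolding eq by (simp add: B_def)
      then show ?thesis
        using mdist_triangle[OF x D(1) y, of i] mdist_commute[of m x "D i"] i n by linarith
    qed
    then have "mdist m x y \<le> 0"
      by (rule field_le_epsilon[of _ 0, simplified])
    then show "x = y"
      using mdist_zero[OF x y] mdist_nonneg[of m x y] by linarith
  qed
  then have "inj_on (h \<circ> B) (mspace m)"
    using h by (intro comp_inj_on) (auto simp: bij_def intro: inj_on_subset)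
  then show thesis by (rule that)
qed

text \<open>Points at distance zero are identified, the quotient is completed, and the result is
  transported to a subset of the reals, as the type of the values of a geodesic demands. The
  parameter comes from the quotient map, so distances of its values are exactly
  \<open>\<rho>\<close>.\<close>

lemma pseudometric_realization:
  fixes \<rho> :: "real \<Rightarrow> real \<Rightarrow> real"
  assumes pm: "pseudometric \<rho>" and sep: "separable_pm \<rho>" and meas: "\<And>u. \<rho> u \<in> borel_measurable borel"
  shows "\<exists>(W :: real mmspace) \<phi>. mm_space W \<and> mm_parameter W \<phi> \<and> (\<forall>u v. mm_dist W (\<phi> u) (\<phi> v) = \<rho> u v)"
proof -
  note pmD = pseudometricD[OF pm]
  define rep where "rep u = (SOME v. \<rho> u v = 0)" for u
  have rep0: "\<rho> u (rep u) = 0" for u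
    unfolding rep_def by (rule someI[of _ u]) (rule pmD(1))
  have zero_trans: "\<rho> v w = 0" if "\<rho> u v = 0" "\<rho> u w = 0" for u v w
    using pmD(4)[of v w u] pmD(3)[of u v] pmD(2)[of v w] that by linarith
  \<comment> \<open>Points at distance zero give the same predicate to \<open>SOME\<close>, hence
    the same representative.\<close>
  have rep_eq: "rep u = rep v" if "\<rho> u v = 0" for u v
  proof -
    have "(\<rho> u w = 0) = (\<rho> v w = 0)" for w
      using zero_trans[of u v w] zero_trans[of v u w] that pmD(3)[of u v] by auto
    then show ?thesis unfolding rep_def by simp
  qed
  have rep_dist: "\<rho> (rep u) (rep v) = \<rho> u v" for u v
    using pmD(4)[of u v "rep u"] pmD(4)[of "rep u" v "rep v"] pmD(4)[of "rep u" "rep v" u] pmD(4)[of u "rep v" v]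
      rep0[of u] rep0[of v] pmD(3)[of u "rep u"] pmD(3)[of v "rep v"] by linarith
  have "Metric_space (range rep) \<rho>"
  proof
    show "\<rho> x y = 0 \<longleftrightarrow> x = y" if xy: "x \<in> range rep" "y \<in> range rep" for x y
    proof -
      obtain u v where uv: "x = rep u" "y = rep v" using xy by auto
      then show ?thesis
        using rep_dist[of u v] rep_eq[of u v] pmD(1) by auto
    qed
  qed (rule pmD)+
  then interpret R: Metric_space "range rep" \<rho> .
  obtain f :: "real \<Rightarrow> real \<Rightarrow> real" and m' where m': "mcomplete_of m'" "f \<in> range rep \<rightarrow> mspace m'"
    "mtopology_of m' closure_of f ` range rep = mspace m'"
    "\<And>x y. x \<in> range rep \<Longrightarrow> y \<in> range rep \<Longrightarrow> mdist m' (f x) (f y) = \<rho> x y"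
    by (rule R.metric_completion) blast
  interpret C: Metric_space "mspace m'" "mdist m'" by simp
  define g where "g u = f (rep u)" for u
  have gS: "g u \<in> mspace m'" for u using m'(2) by (auto simp: g_def)
  have gd: "mdist m' (g u) (g v) = \<rho> u v" for u v
    using m'(4)[of "rep u" "rep v"] by (simp add: g_def rep_dist)
  obtain q :: "nat \<Rightarrow> real" where q: "\<And>u e. e > 0 \<Longrightarrow> \<exists>i. \<rho> u (q i) < e"
    using separable_pm_dense[OF sep] by blast
  have dense_g: "\<exists>u. mdist m' x (g u) < e" if x: "x \<in> mspace m'" and e: "e > 0" for x e
  proof -
    have "x \<in> C.mtopology closure_of f ` range rep"
      using m'(3) x by (simp add: mtopology_of_def)
    then show ?thesis
      using e unfolding C.metric_closure_of by (auto simp: g_def)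
  qed
  have dense_q: "\<exists>i. mdist m' (g (q i)) x < e" if x: "x \<in> mspace m'" and e: "e > 0" for x e
  proof -
    obtain u where u: "mdist m' x (g u) < e / 2"
      using dense_g[OF x, of "e / 2"] e by auto
    obtain i where "\<rho> u (q i) < e / 2"
      using q[of "e / 2" u] e by auto
    then have "mdist m' x (g (q i)) < e"
      using C.triangle[OF x gS[of u] gS[of "q i"]] u gd[of u "q i"] by linarith
    then show ?thesis by (auto simp: mdist_commute)
  qed
  obtain J :: "(real \<Rightarrow> real) \<Rightarrow> real" where J: "inj_on J (mspace m')"
    using metric_inj_real[of "\<lambda>i. g (q i)" m'] gS dense_q by blast
  define S' where "S' = J ` mspace m'"
  define K where "K = inv_into (mspace m') J"
  have K: "K a \<in> mspace m'" "J (K a) = a" if "a \<in> S'" for a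
    using that by (auto simp: S'_def K_def f_inv_into_f inv_into_into)
  have KJ: "K (J x) = x" if "x \<in> mspace m'" for x
    using that J by (simp add: K_def)
  have JS: "J x \<in> S'" if "x \<in> mspace m'" for x using that by (simp add: S'_def)
  define d' where "d' a b = mdist m' (K a) (K b)" for a b
  have "Metric_space S' d'"
  proof
    show "d' x y = 0 \<longleftrightarrow> x = y" if "x \<in> S'" "y \<in> S'" for x y
      using that K by (metis d'_def mdist_zero)
    show "d' x z \<le> d' x y + d' y z" if "x \<in> S'" "y \<in> S'" "z \<in> S'" for x y z
      using that K unfolding d'_def by (intro mdist_triangle) auto
  qed (auto simp: d'_def mdist_commute)
  then interpret W: Metric_space S' d' .
  have comp: "W.mcomplete"
    unfolding W.mcomplete_def
  proof (intro allI impI)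
    fix \<sigma> assume \<sigma>: "W.MCauchy \<sigma>"
    then have \<sigma>S: "\<sigma> n \<in> S'" for n by (auto simp: W.MCauchy_def)
    have "C.MCauchy (\<lambda>n. K (\<sigma> n))"
      using \<sigma> K(1)[OF \<sigma>S] unfolding W.MCauchy_def C.MCauchy_def by (auto simp: d'_def)
    then obtain x where x: "limitin C.mtopology (\<lambda>n. K (\<sigma> n)) x sequentially"
      using m'(1) unfolding mcomplete_of_def C.mcomplete_def by blast
    then have "x \<in> mspace m'" using C.limitin_mspace by blast
    then have "limitin W.mtopology \<sigma> (J x) sequentially"
      using x \<sigma>S unfolding W.limitin_metric_dist_null C.limitin_metric_dist_null
      by (auto simp: d'_def KJ JS)
    then show "\<exists>x. limitin W.mtopology \<sigma> x sequentially" by blast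
  qed
  have sepW: "separable_space W.mtopology"
    unfolding separable_space_def
  proof (intro exI[of _ "range (\<lambda>i. J (g (q i)))"] conjI)
    show "W.mtopology closure_of range (\<lambda>i. J (g (q i))) = topspace W.mtopology"
    proof -
      have "\<exists>i. d' x (J (g (q i))) < r" if "x \<in> S'" "r > 0" for x r
        using dense_q[OF K(1)[OF that(1)] that(2)] by (auto simp: d'_def KJ gS mdist_commute)
      then show ?thesis
        unfolding W.metric_closure_of by (auto simp: JS gS)
    qed
  qed (auto simp: JS gS)
  define \<Sigma> where "\<Sigma> = sigma S' {U. openin W.mtopology U}"
  have sub: "{U. openin W.mtopology U} \<subseteq> Pow S'"
    using openin_subset[of W.mtopology] by fastforce
  have sp\<Sigma>: "space \<Sigma> = S'" and sets\<Sigma>: "sets \<Sigma> = sigma_sets S' {U. openin W.mtopology U}"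
    using sub by (simp_all add: \<Sigma>_def)
  have mmI: "mm_space (d', N)" if N: "sets N = sets \<Sigma>" "prob_space N" for N
  proof -
    have "space N = S'" using sets_eq_imp_space_eq[OF N(1)] sp\<Sigma> by simp
    then show ?thesis
      using W.Metric_space_axioms comp sepW N sets\<Sigma>
      by (simp add: mm_space_def mm_dist_def mm_meas_def)
  qed
  define \<phi> where "\<phi> u = J (g u)" for u
  have \<phi>S: "\<phi> u \<in> S'" for u by (simp add: \<phi>_def JS gS)
  \<comment> \<open>A dummy measure, needed only to apply the measurability criterion of the locale.\<close>
  let ?N0 = "return \<Sigma> (\<phi> 0)"
  have "prob_space ?N0"
    by (rule prob_space_return) (simp add: sp\<Sigma> \<phi>S)
  then have mm0: "mm_space (d', ?N0)" by (intro mmI) simp_all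
  interpret W0: mm "(d', ?N0)" by (rule mm.intro[OF mm0])
  \<comment> \<open>A point added by the completion is a limit of points \<open>g (v n)\<close>, so
    the distance to it is a pointwise limit of the measurable functions
    \<open>\<rho> (v n)\<close>.\<close>
  have dm: "(\<lambda>u. d' a (\<phi> u)) \<in> borel_measurable borel" if a: "a \<in> S'" for a
  proof -
    have "\<exists>v. mdist m' (K a) (g v) < 1 / Suc n" for n
      using dense_g[OF K(1)[OF a], of "1 / Suc n"] by auto
    then obtain v where v: "\<And>n. mdist m' (K a) (g (v n)) < 1 / Suc n" by metis
    show ?thesis
    proof (rule borel_measurable_LIMSEQ_real)
      show "(\<lambda>n. \<rho> (v n) u) \<longlonglongrightarrow> d' a (\<phi> u)" for u
      proof -
        have "\<bar>\<rho> (v n) u - d' a (\<phi> u)\<bar> \<le> 1 / Suc n" for n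
          using C.mdist_reverse_triangle[of "g (v n)" "g u" "K a"] v[of n] gS K(1)[OF a] gd[of "v n" u]
            C.commute[of "K a" "g u"] C.commute[of "K a" "g (v n)"]
          by (simp add: d'_def \<phi>_def KJ)
        then have "(\<lambda>n. \<rho> (v n) u - d' a (\<phi> u)) \<longlonglongrightarrow> 0"
          by (intro tendsto_rabs_zero_cancel[OF tendsto_sandwich[OF _ _ tendsto_const LIMSEQ_Suc[OF lim_1_over_n]]])
            (auto intro!: always_eventually)
        then show ?thesis by (simp add: LIM_zero_iff)
      qed
    qed (rule meas)
  qed
  have "\<phi> \<in> unit_interval_L \<rightarrow>\<^sub>M mm_meas (d', ?N0)"
  proof (rule W0.measurableI_balls)
    show "\<phi> w \<in> W0.S" for w by (simp add: mm_meas_def sp\<Sigma> \<phi>S)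
    fix i r
    have a: "W0.xs i \<in> S'" using W0.xs_in[of i] by (simp add: mm_meas_def sp\<Sigma>)
    have "{w. d' (W0.xs i) (\<phi> w) < r} \<in> sets borel"
      using dm[OF a] by (simp add: borel_measurable_iff_less)
    then have "{w. d' (W0.xs i) (\<phi> w) < r} \<inter> {0..<1} \<in> sets borel" by auto
    moreover have "{w. d' (W0.xs i) (\<phi> w) < r} \<inter> {0..<1} = {w \<in> space unit_interval_L. mm_dist (d', ?N0) (W0.xs i) (\<phi> w) < r}"
      by (auto simp: mm_dist_def)
    ultimately show "{w \<in> space unit_interval_L. mm_dist (d', ?N0) (W0.xs i) (\<phi> w) < r} \<in> sets unit_interval_L"
      by (auto simp: sets_unit_interval_L)
  qed
  then have \<phi>m: "\<phi> \<in> unit_interval_L \<rightarrow>\<^sub>M \<Sigma>"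
    by (simp add: mm_meas_def cong: measurable_cong_sets)
  define W where "W = (d', distr unit_interval_L \<Sigma> \<phi>)"
  have "mm_space W"
    unfolding W_def by (rule mmI) (use \<phi>m in \<open>auto intro: UL.prob_space_distr\<close>)
  moreover have "mm_parameter W \<phi>"
    using \<phi>m by (simp add: mm_parameter_def W_def mm_meas_def cong: distr_cong measurable_cong_sets)
  moreover have "mm_dist W (\<phi> u) (\<phi> v) = \<rho> u v" for u v
    by (simp add: W_def mm_dist_def d'_def \<phi>_def KJ gS gd)
  ultimately show ?thesis by blast
qed

section \<open>Atoms\<close>

definition atoms :: "'a mmspace \<Rightarrow> 'a set" where
  "atoms X = {x \<in> space (mm_meas X). measure (mm_meas X) {x} \<noteq> 0}"

definition atomic_mass :: "'a mmspace \<Rightarrow> real" where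
  "atomic_mass X = measure (mm_meas X) (atoms X)"

context mm
begin

lemma sets_singleton: "x \<in> S \<Longrightarrow> {x} \<in> sets \<mu>"
proof -
  assume x: "x \<in> S"
  have "y = x" if "y \<in> S" "d x y \<le> 0" for y
    using mdist_pos_eq[OF x that(1)] that(2) by (meson not_less)
  then have "mcball x 0 = {x}"
    using x by auto
  then show ?thesis using sets_closedin[OF closedin_mcball[of x 0]] by simp
qed

lemma sets_atoms: "atoms X \<in> sets \<mu>"
proof -
  have "countable {x. prob {x} \<noteq> 0}" by (rule countable_support)
  then have "countable (atoms X)"
    by (rule countable_subset[rotated]) (auto simp: atoms_def)
  then show ?thesis
    by (rule sets.countable[rotated]) (auto simp: atoms_def sets_singleton)
qed

lemma atoms_subset_supp: "atoms X \<subseteq> supp"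
proof
  fix x assume "x \<in> atoms X"
  then have x: "x \<in> S" "emeasure \<mu> {x} > 0"
    by (auto simp: atoms_def emeasure_eq_measure zero_less_measure_iff)
  have "emeasure \<mu> {x} \<le> emeasure \<mu> {y \<in> S. d x y < e}" if "e > 0" for e
    by (rule emeasure_mono[OF _ sets_ball[OF x(1)]]) (use x that in auto)
  then show "x \<in> supp"
    using x by (auto simp: mm_supp_def intro: less_le_trans)
qed

text \<open>The fibre of \<open>\<phi>\<close> through \<open>u\<close> is a zero set of the
  pulled-back distance, so whether \<open>u\<close> lies over an atom can be read off from this
  distance alone.\<close>

lemma heavy_parameter:
  assumes \<phi>: "mm_parameter X \<phi>"
  shows "{u \<in> {0..<1}. measure unit_interval_L {v \<in> {0..<1}. d (\<phi> u) (\<phi> v) = 0} \<noteq> 0}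
    = {u \<in> {0..<1}. \<phi> u \<in> atoms X}"
proof (intro Collect_cong conj_cong refl)
  fix u :: real assume u: "u \<in> {0..<1}"
  have uS: "\<phi> u \<in> S" by (rule parameter_in[OF \<phi> u])
  have eq: "{y \<in> S. d (\<phi> u) y = 0} = {\<phi> u}" using uS by auto
  have "measure unit_interval_L {v \<in> {0..<1}. d (\<phi> u) (\<phi> v) = 0} = prob {y \<in> S. d (\<phi> u) y = 0}"
    by (rule parameter_measure[OF \<phi>]) (simp add: eq sets_singleton[OF uS])
  then show "measure unit_interval_L {v \<in> {0..<1}. d (\<phi> u) (\<phi> v) = 0} \<noteq> 0 \<longleftrightarrow> \<phi> u \<in> atoms X"
    using uS by (simp add: eq atoms_def)
qed

lemma sets_atoms_parameter:
  assumes "mm_parameter X \<phi>"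
  shows "{u \<in> {0..<1}. \<phi> u \<in> atoms X} \<in> sets unit_interval_L"
proof -
  have "\<phi> -` atoms X \<inter> space unit_interval_L \<in> sets unit_interval_L"
    using assms by (intro measurable_sets[OF _ sets_atoms]) (simp add: mm_parameter_def)
  then show ?thesis by (simp add: vimage_def Int_def conj_commute)
qed

lemma atomic_mass_parameter:
  assumes \<phi>: "mm_parameter X \<phi>"
  shows "atomic_mass X = measure unit_interval_L
    {u \<in> {0..<1}. measure unit_interval_L {v \<in> {0..<1}. d (\<phi> u) (\<phi> v) = 0} \<noteq> 0}"
proof -
  have eq: "{y \<in> S. y \<in> atoms X} = atoms X" by (auto simp: atoms_def)
  show ?thesis
    unfolding heavy_parameter[OF \<phi>] atomic_mass_def
    using parameter_measure[OF \<phi>, of "\<lambda>y. y \<in> atoms X"] sets_atoms by (simp add: eq)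
qed

end

text \<open>An isomorphism is an honest map between the supports only. All atoms lie there, and
  injectivity makes the preimage of a singleton a singleton of the same mass.\<close>

lemma mm_iso_atomic_mass:
  assumes "mm_space X" "mm_space Y" "mm_iso X Y"
  shows "atomic_mass X = atomic_mass Y"
proof -
  interpret X: mm X by (rule mm.intro) fact
  interpret Y: mm Y by (rule mm.intro) fact
  obtain f where bij: "bij_betw f X.supp Y.supp"
    and m: "\<And>B. B \<in> sets (mm_meas Y) \<Longrightarrow>
      emeasure (mm_meas X) {x \<in> X.supp. f x \<in> B} = emeasure (mm_meas Y) B"
    using assms(3) unfolding mm_iso_def by blast
  have single: "emeasure (mm_meas Y) {f x} = emeasure (mm_meas X) {x}" if x: "x \<in> X.supp" for x
  proof -
    have "f x \<in> Y.S" using bij x Y.supp_subset by (auto dest: bij_betwE)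
    then have "emeasure (mm_meas Y) {f x} = emeasure (mm_meas X) {z \<in> X.supp. f z \<in> {f x}}"
      using m[OF Y.sets_singleton] by simp
    also have "{z \<in> X.supp. f z \<in> {f x}} = {x}"
      using bij x by (auto simp: bij_betw_def inj_on_def)
    finally show ?thesis .
  qed
  have "{x \<in> X.supp. f x \<in> atoms Y} = atoms X"
  proof -
    have "f x \<in> atoms Y \<longleftrightarrow> x \<in> atoms X" if x: "x \<in> X.supp" for x
      using single[OF x] x bij X.supp_subset Y.supp_subset
      by (auto simp: atoms_def measure_def dest: bij_betwE)
    then show ?thesis using X.atoms_subset_supp by auto
  qed
  then have "emeasure (mm_meas X) (atoms X) = emeasure (mm_meas Y) (atoms Y)"
    using m[OF Y.sets_atoms] by simp
  then show ?thesis by (simp add: atomic_mass_def measure_def)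
qed

section \<open>Interpolation of pseudometrics\<close>

lemma pseudometric_comb:
  assumes "pseudometric \<rho>" "pseudometric \<sigma>" "0 \<le> a" "0 \<le> b"
  shows "pseudometric (\<lambda>x y. a * \<rho> x y + b * \<sigma> x y)"
  unfolding pseudometric_def
proof (intro conjI allI)
  fix x y z
  have "a * \<rho> x z \<le> a * (\<rho> x y + \<rho> y z)" "b * \<sigma> x z \<le> b * (\<sigma> x y + \<sigma> y z)"
    using assms by (auto intro!: mult_left_mono pseudometricD(4))
  then show "a * \<rho> x z + b * \<sigma> x z \<le> a * \<rho> x y + b * \<sigma> x y + (a * \<rho> y z + b * \<sigma> y z)"
    by (simp add: algebra_simps)
  show "a * \<rho> x y + b * \<sigma> x y = a * \<rho> y x + b * \<sigma> y x"
    using pseudometricD(3)[OF assms(1), of x y] pseudometricD(3)[OF assms(2), of x y] by simp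
  show "0 \<le> a * \<rho> x y + b * \<sigma> x y"
    using pseudometricD(2)[OF assms(1)] pseudometricD(2)[OF assms(2)] assms(3,4) by simp
qed (simp add: pseudometricD(1)[OF assms(1)] pseudometricD(1)[OF assms(2)])

lemma pseudometric_pullback: "pseudometric \<rho> \<Longrightarrow> pseudometric (\<lambda>x y. \<rho> (f x) (f y))"
  by (auto simp: pseudometric_def)

lemma separable_pm_comb:
  fixes \<rho> \<sigma> :: "'c \<Rightarrow> 'c \<Rightarrow> real"
  assumes "separable_pm \<rho>" "separable_pm \<sigma>" "0 \<le> a" "0 \<le> b"
  shows "separable_pm (\<lambda>x y. a * \<rho> x y + b * \<sigma> x y)"
  unfolding separable_pm_def
proof (intro allI impI)
  fix e :: real assume e: "e > 0"
  \<comment> \<open>The denominators contain \<open>a + 1\<close> and \<open>b + 1\<close> so that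
    they stay positive for a zero coefficient.\<close>
  obtain k :: "'c \<Rightarrow> nat" where k: "\<And>x y. k x = k y \<Longrightarrow> \<rho> x y < e / (2 * (a + 1))"
    using assms(1)[unfolded separable_pm_def, rule_format, of "e / (2 * (a + 1))"] e assms(3) by auto
  obtain l :: "'c \<Rightarrow> nat" where l: "\<And>x y. l x = l y \<Longrightarrow> \<sigma> x y < e / (2 * (b + 1))"
    using assms(2)[unfolded separable_pm_def, rule_format, of "e / (2 * (b + 1))"] e assms(4) by auto
  have *: "c * r < e / 2" if "r < e / (2 * (c + 1))" "0 \<le> c" for c r
  proof -
    have "(c + 1) * r < e / 2" if "0 \<le> r"
      using \<open>r < e / (2 * (c + 1))\<close> \<open>0 \<le> c\<close> by (simp add: field_simps)
    then show ?thesis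
      using that e by (cases "0 \<le> r") (auto simp: algebra_simps intro: le_less_trans[OF mult_nonneg_nonpos])
  qed
  show "\<exists>k :: 'c \<Rightarrow> nat. \<forall>x y. k x = k y \<longrightarrow> a * \<rho> x y + b * \<sigma> x y < e"
  proof (intro exI[of _ "\<lambda>x. prod_encode (k x, l x)"] allI impI)
    fix x y assume "prod_encode (k x, l x) = prod_encode (k y, l y)"
    then have "\<rho> x y < e / (2 * (a + 1))" "\<sigma> x y < e / (2 * (b + 1))"
      using k l by auto
    then have "a * \<rho> x y < e / 2" "b * \<sigma> x y < e / 2"
      using * assms(3,4) by blast+
    then show "a * \<rho> x y + b * \<sigma> x y < e" by linarith
  qed
qed

lemma separable_pm_pullback: "separable_pm \<rho> \<Longrightarrow> separable_pm (\<lambda>x y. \<rho> (f x) (f y))"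
  unfolding separable_pm_def by (metis comp_apply)

lemma separable_pm_real_dist: "separable_pm (\<lambda>x y :: real. \<bar>x - y\<bar>)"
  unfolding separable_pm_def
proof (intro allI impI)
  fix e :: real assume e: "e > 0"
  show "\<exists>k :: real \<Rightarrow> nat. \<forall>x y. k x = k y \<longrightarrow> \<bar>x - y\<bar> < e"
  proof (intro exI[of _ "\<lambda>x. to_nat \<lfloor>x / e\<rfloor>"] allI impI)
    fix x y :: real assume "to_nat \<lfloor>x / e\<rfloor> = to_nat \<lfloor>y / e\<rfloor>"
    then have "\<lfloor>x / e\<rfloor> = \<lfloor>y / e\<rfloor>" by simp
    then have "\<bar>x / e - y / e\<bar> < 1" by linarith
    then show "\<bar>x - y\<bar> < e"
      using e by (simp add: diff_divide_distrib[symmetric] abs_divide)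
  qed
qed

text \<open>Sublevel sets of \<open>g\<close> are countable unions of \<open>A\<close>-balls around
  the dense points. This gives measurability of the bridge function, an infimum over an index set
  that is uncountable in general.\<close>

lemma lipschitz_measurable:
  fixes A :: "real \<Rightarrow> real \<Rightarrow> real"
  assumes pm: "pseudometric A" and sep: "separable_pm A" and meas: "\<And>u. A u \<in> borel_measurable borel"
    and g: "\<And>u v. g u - g v \<le> A u v"
  shows "g \<in> borel_measurable borel"
proof -
  obtain q :: "nat \<Rightarrow> real" where q: "\<And>u e. e > 0 \<Longrightarrow> \<exists>i. A u (q i) < e"
    using separable_pm_dense[OF sep] by blast
  have "{w. g w < a} \<in> sets borel" for a
  proof -
    have "{w. g w < a} = (\<Union>i. {w. A (q i) w < a - g (q i)})"
    proof (intro equalityI subsetI)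
      fix w assume "w \<in> {w. g w < a}"
      \<comment> \<open>Half of the gap pays for the possible increase from \<open>g w\<close> to
        \<open>g (q i)\<close>, the other half for the radius of the ball.\<close>
      then obtain i where "A w (q i) < (a - g w) / 2"
        using q[of "(a - g w) / 2" w] by auto
      then have "A (q i) w < a - g (q i)"
        using g[of "q i" w] pseudometricD(3)[OF pm, of w "q i"] by (simp add: field_simps)
      then show "w \<in> (\<Union>i. {w. A (q i) w < a - g (q i)})" by blast
    next
      fix w assume "w \<in> (\<Union>i. {w. A (q i) w < a - g (q i)})"
      then obtain i where "A (q i) w < a - g (q i)" by blast
      then show "w \<in> {w. g w < a}"
        using g[of w "q i"] pseudometricD(3)[OF pm, of w "q i"] by simp
    qed
    also have "\<dots> \<in> sets borel"
      using meas by (intro sets.countable_UN image_subsetI) (simp add: borel_measurable_iff_less)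
    finally show ?thesis .
  qed
  then show ?thesis by (simp add: borel_measurable_iff_less)
qed

text \<open>Every point is sent to a dense point within the prescribed accuracy. Only countably many
  values occur, and this is what will create atoms.\<close>

lemma ex_discretization:
  fixes A :: "real \<Rightarrow> real \<Rightarrow> real"
  assumes pm: "pseudometric A" and sep: "separable_pm A" and meas: "\<And>u. A u \<in> borel_measurable borel" and r: "0 < r"
  shows "\<exists>(q :: nat \<Rightarrow> real) idx. \<forall>n. idx n \<in> borel \<rightarrow>\<^sub>M count_space (UNIV :: nat set) \<and>
    (\<forall>u. A u (q (idx n u)) \<le> r * (1/2) ^ n)"
proof -
  obtain q :: "nat \<Rightarrow> real" where q: "\<And>u e. e > 0 \<Longrightarrow> \<exists>i. A u (q i) < e"
    using separable_pm_dense[OF sep] by blast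
  define idx where "idx n u = (LEAST i. A (q i) u < r * (1/2) ^ n)" for n u
  have "A u (q (idx n u)) \<le> r * (1/2) ^ n" for n u
  proof -
    have "\<exists>i. A (q i) u < r * (1/2) ^ n"
      using q[of "r * (1/2) ^ n" u] r by (simp add: pseudometricD(3)[OF pm, of u])
    then have "A (q (idx n u)) u < r * (1/2) ^ n"
      unfolding idx_def by (rule LeastI_ex)
    then show ?thesis by (simp add: pseudometricD(3)[OF pm, of u])
  qed
  moreover have "idx n \<in> borel \<rightarrow>\<^sub>M count_space UNIV" for n
  proof -
    have [measurable]: "A (q i) \<in> borel_measurable borel" for i by (rule meas)
    show ?thesis unfolding idx_def by measurable
  qed
  ultimately show ?thesis by blast
qed

text \<open>Piecewise linear interpolation in \<open>s\<close> with value \<open>E n\<close> at \<open>s = 2^-n\<close> and limit value \<open>E'\<close> at \<open>s = 0\<close>.\<close>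

definition dyadic_level :: "real \<Rightarrow> nat" where
  "dyadic_level s = (LEAST n. (1/2) ^ Suc n < s)"

text \<open>Relative position of \<open>s\<close> in its dyadic interval: 0 at the excluded lower
  end, 1 at the upper end.\<close>

definition dyadic_weight :: "real \<Rightarrow> real" where
  "dyadic_weight s = s * 2 ^ Suc (dyadic_level s) - 1"

definition dyadic_interp :: "real \<Rightarrow> (nat \<Rightarrow> real) \<Rightarrow> real \<Rightarrow> real" where
  "dyadic_interp s E E' = (if s \<le> 0 then E'
     else (1 - dyadic_weight s) * E (Suc (dyadic_level s)) + dyadic_weight s * E (dyadic_level s))"

section \<open>Bounds for the dyadic interpolation\<close>

lemma dyadic_level_bounds:
  assumes "0 < s" "s \<le> 1"
  shows "(1/2) ^ Suc (dyadic_level s) < s" "s \<le> (1/2) ^ dyadic_level s"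
proof -
  obtain n where "(1/2 :: real) ^ n < s"
    using real_arch_pow_inv[of s "1/2"] assms by auto
  then have "(1/2 :: real) ^ Suc n < s"
    using assms(1) by simp
  then show "(1/2) ^ Suc (dyadic_level s) < s"
    unfolding dyadic_level_def by (rule LeastI)
  show "s \<le> (1/2) ^ dyadic_level s"
  proof (cases "dyadic_level s")
    case (Suc m)
    then have "\<not> (1/2) ^ Suc m < s"
      using not_less_Least[of m "\<lambda>n. (1/2) ^ Suc n < s"] by (simp add: dyadic_level_def)
    then show ?thesis by (simp add: Suc)
  qed (use assms in simp)
qed

lemma dyadic_weight_bounds:
  assumes "0 < s" "s \<le> 1"
  shows "0 < dyadic_weight s" "dyadic_weight s \<le> 1"
  using dyadic_level_bounds[OF assms] by (simp_all add: dyadic_weight_def power_one_over field_simps)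

lemma dyadic_weight_mult:
  "dyadic_weight s * (1/2) ^ Suc (dyadic_level s) = s - (1/2) ^ Suc (dyadic_level s)"
  by (simp add: dyadic_weight_def power_one_over field_simps)

text \<open>Consecutive values differ by at most \<open>c * (1/2) ^ n + c * (1/2) ^ Suc n\<close>,
  which is \<open>3 * c * (1/2) ^ Suc n\<close>, and the times at which they are taken differ by
  \<open>(1/2) ^ Suc n\<close>. This is the slope \<open>3 * c\<close>.\<close>

lemma dyadic_interp_lipschitz_less:
  assumes E: "\<And>n. \<bar>E n - E'\<bar> \<le> c * (1/2) ^ n" and s: "0 \<le> s" "s < s'" "s' \<le> 1"
  shows "\<bar>dyadic_interp s E E' - dyadic_interp s' E E'\<bar> \<le> 3 * c * (s' - s)"
proof -
  have c: "0 \<le> c" using E[of 0] by simp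
  have step: "\<bar>E n - E (Suc n)\<bar> \<le> 3 * c * (1/2) ^ Suc n" for n
  proof -
    have "\<bar>E n - E (Suc n)\<bar> \<le> c * (1/2) ^ n + c * (1/2) ^ Suc n"
      using E[of n] E[of "Suc n"] by linarith
    then show ?thesis by (simp add: algebra_simps)
  qed
  have chain: "\<bar>E n - E m\<bar> \<le> 3 * c * ((1/2) ^ n - (1/2) ^ m)" if "n \<le> m" for n m
    using that
  proof (induction m rule: dec_induct)
    case (step k)
    have "\<bar>E n - E (Suc k)\<bar> \<le> 3 * c * ((1/2) ^ n - (1/2) ^ k) + 3 * c * (1/2) ^ Suc k"
      using step.IH \<open>\<And>n. \<bar>E n - E (Suc n)\<bar> \<le> 3 * c * (1/2) ^ Suc n\<close>[of k] by linarith
    then show ?case by (simp add: algebra_simps)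
  qed simp
  have low: "\<bar>dyadic_interp x E E' - E (Suc (dyadic_level x))\<bar> \<le> 3 * c * (x - (1/2) ^ Suc (dyadic_level x))"
    and high: "\<bar>E (dyadic_level x) - dyadic_interp x E E'\<bar> \<le> 3 * c * ((1/2) ^ dyadic_level x - x)"
    if x: "0 < x" "x \<le> 1" for x
  proof -
    let ?n = "dyadic_level x" and ?w = "dyadic_weight x"
    have w: "0 < ?w" "?w \<le> 1" using dyadic_weight_bounds[OF x] by auto
    have "dyadic_interp x E E' - E (Suc ?n) = ?w * (E ?n - E (Suc ?n))"
      using x by (simp add: dyadic_interp_def algebra_simps)
    then have "\<bar>dyadic_interp x E E' - E (Suc ?n)\<bar> \<le> ?w * (3 * c * (1/2) ^ Suc ?n)"
      using w mult_left_mono[OF step[of ?n], of ?w] by (simp add: abs_mult del: power_Suc)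
    also have "\<dots> = 3 * c * (?w * (1/2) ^ Suc ?n)" by simp
    finally show "\<bar>dyadic_interp x E E' - E (Suc ?n)\<bar> \<le> 3 * c * (x - (1/2) ^ Suc ?n)"
      unfolding dyadic_weight_mult .
    have "E ?n - dyadic_interp x E E' = (1 - ?w) * (E ?n - E (Suc ?n))"
      using x by (simp add: dyadic_interp_def algebra_simps)
    then have "\<bar>E ?n - dyadic_interp x E E'\<bar> \<le> (1 - ?w) * (3 * c * (1/2) ^ Suc ?n)"
      using w mult_left_mono[OF step[of ?n], of "1 - ?w"] by (simp add: abs_mult del: power_Suc)
    also have "\<dots> = 3 * c * ((1/2) ^ Suc ?n - ?w * (1/2) ^ Suc ?n)"
      by (simp add: algebra_simps del: power_Suc)
    also have "(1/2) ^ Suc ?n - ?w * (1/2) ^ Suc ?n = (1/2) ^ ?n - x"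
      unfolding dyadic_weight_mult by simp
    finally show "\<bar>E ?n - dyadic_interp x E E'\<bar> \<le> 3 * c * ((1/2) ^ ?n - x)" .
  qed
  show ?thesis
  proof (cases "s = 0")
    \<comment> \<open>No dyadic interval ends at 0, so the hypothesis is used directly: both values
      that are interpolated at \<open>s'\<close> are within \<open>c * (1/2) ^ n\<close>, at most
      \<open>2 * c * s'\<close>, of the limit value.\<close>
    case True
    let ?n = "dyadic_level s'"
    have s': "0 < s'" "s' \<le> 1" using s True by auto
    have w: "0 < dyadic_weight s'" "dyadic_weight s' \<le> 1" using dyadic_weight_bounds[OF s'] by auto
    have "dyadic_interp s' E E' - E' = (1 - dyadic_weight s') * (E (Suc ?n) - E') + dyadic_weight s' * (E ?n - E')"
      using s' by (simp add: dyadic_interp_def algebra_simps)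
    moreover have "\<bar>(1 - dyadic_weight s') * (E (Suc ?n) - E')\<bar> \<le> (1 - dyadic_weight s') * (c * (1/2) ^ ?n)"
    proof -
      have "\<bar>E (Suc ?n) - E'\<bar> \<le> c * (1/2) ^ ?n"
        using E[of "Suc ?n"] c by (simp add: order_trans[OF E[of "Suc ?n"]] mult_left_mono)
      then show ?thesis using w by (simp add: abs_mult mult_left_mono)
    qed
    moreover have "\<bar>dyadic_weight s' * (E ?n - E')\<bar> \<le> dyadic_weight s' * (c * (1/2) ^ ?n)"
      using w E[of ?n] by (simp add: abs_mult)
    ultimately have "\<bar>dyadic_interp s' E E' - E'\<bar> \<le> (1 - dyadic_weight s') * (c * (1/2) ^ ?n) + dyadic_weight s' * (c * (1/2) ^ ?n)"
      by linarith
    also have "\<dots> = c * (1/2) ^ ?n" by (simp add: algebra_simps)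
    also have "\<dots> \<le> c * (2 * s')"
      using dyadic_level_bounds(1)[OF s'] c by (intro mult_left_mono) auto
    also have "\<dots> \<le> 3 * c * s'" using c s' by simp
    finally show ?thesis using True by (simp add: dyadic_interp_def)
  next
    case False
    then have s0: "0 < s" "s \<le> 1" and s'0: "0 < s'" "s' \<le> 1" using s by auto
    let ?m = "dyadic_level s" and ?n = "dyadic_level s'"
    have "?n \<le> ?m"
      unfolding dyadic_level_def[of s']
      by (rule Least_le) (use dyadic_level_bounds(1)[OF s0] s in linarith)
    show ?thesis
    proof (cases "?m = ?n")
      case True
      have "dyadic_interp s E E' - dyadic_interp s' E E' = (dyadic_weight s - dyadic_weight s') * (E ?n - E (Suc ?n))"
        using s0 s'0 True by (simp add: dyadic_interp_def algebra_simps)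
      also have "\<bar>\<dots>\<bar> \<le> (dyadic_weight s' - dyadic_weight s) * (3 * c * (1/2) ^ Suc ?n)"
      proof -
        have "dyadic_weight s \<le> dyadic_weight s'"
          using s True by (simp add: dyadic_weight_def)
        then show ?thesis
          using mult_left_mono[OF step[of ?n], of "dyadic_weight s' - dyadic_weight s"]
          by (simp add: abs_mult del: power_Suc)
      qed
      also have "\<dots> = 3 * c * (dyadic_weight s' * (1/2) ^ Suc ?n - dyadic_weight s * (1/2) ^ Suc ?m)"
        by (simp add: True algebra_simps del: power_Suc)
      also have "\<dots> = 3 * c * (s' - s)"
        unfolding dyadic_weight_mult by (simp add: True)
      finally show ?thesis .
    next
      case False
      then have "Suc ?n \<le> ?m" using \<open>?n \<le> ?m\<close> by simp
      \<comment> \<open>From \<open>s\<close> to the upper end of its interval, along whole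
        intervals, and from the lower end of the interval of \<open>s'\<close> to \<open>s'\<close>;
        the three lengths telescope.\<close>
      have "\<bar>dyadic_interp s E E' - dyadic_interp s' E E'\<bar>
        \<le> 3 * c * ((1/2) ^ ?m - s) + 3 * c * ((1/2) ^ Suc ?n - (1/2) ^ ?m) + 3 * c * (s' - (1/2) ^ Suc ?n)"
        using high[OF s0] chain[OF \<open>Suc ?n \<le> ?m\<close>] low[OF s'0] by linarith
      also have "\<dots> = 3 * c * (s' - s)" by (simp add: algebra_simps)
      finally show ?thesis .
    qed
  qed
qed

lemma dyadic_interp_lipschitz:
  assumes E: "\<And>n. \<bar>E n - E'\<bar> \<le> c * (1/2) ^ n" and s: "s \<in> {0..1}" "s' \<in> {0..1}"
  shows "\<bar>dyadic_interp s E E' - dyadic_interp s' E E'\<bar> \<le> 3 * c * \<bar>s - s'\<bar>"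
proof (cases s s' rule: linorder_cases)
  case less
  then show ?thesis using dyadic_interp_lipschitz_less[OF E, of s s'] s by simp
next
  case greater
  then show ?thesis using dyadic_interp_lipschitz_less[OF E, of s' s] s by (simp add: abs_minus_commute)
qed simp

lemma dyadic_interp_diff:
  assumes E: "\<And>n. \<bar>E n - F n\<bar> \<le> M" "\<bar>E' - F'\<bar> \<le> M" and s: "s \<le> 1"
  shows "\<bar>dyadic_interp s E E' - dyadic_interp s F F'\<bar> \<le> M"
proof (cases "s \<le> 0")
  case False
  let ?n = "dyadic_level s" and ?w = "dyadic_weight s"
  have w: "0 < ?w" "?w \<le> 1" using dyadic_weight_bounds False s by auto
  have "dyadic_interp s E E' - dyadic_interp s F F' = (1 - ?w) * (E (Suc ?n) - F (Suc ?n)) + ?w * (E ?n - F ?n)"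
    using False by (simp add: dyadic_interp_def algebra_simps)
  moreover have "\<bar>(1 - ?w) * (E (Suc ?n) - F (Suc ?n))\<bar> \<le> (1 - ?w) * M" "\<bar>?w * (E ?n - F ?n)\<bar> \<le> ?w * M"
    using w E(1)[of "Suc ?n"] E(1)[of ?n] by (simp_all add: abs_mult mult_left_mono)
  ultimately have "\<bar>dyadic_interp s E E' - dyadic_interp s F F'\<bar> \<le> (1 - ?w) * M + ?w * M"
    by linarith
  then show ?thesis by (simp add: algebra_simps)
qed (use E in \<open>simp add: dyadic_interp_def\<close>)

lemma dyadic_interp_ge:
  assumes E: "\<And>n. M \<le> E n" "M \<le> E'" and s: "s \<le> 1"
  shows "M \<le> dyadic_interp s E E'"
proof (cases "s \<le> 0")
  case False
  let ?n = "dyadic_level s" and ?w = "dyadic_weight s"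
  have w: "0 < ?w" "?w \<le> 1" using dyadic_weight_bounds False s by auto
  have "(1 - ?w) * M \<le> (1 - ?w) * E (Suc ?n)" "?w * M \<le> ?w * E ?n"
    using w E(1) by (auto intro!: mult_left_mono)
  moreover have "(1 - ?w) * M + ?w * M = M" by (simp add: algebra_simps)
  ultimately show ?thesis using False by (simp add: dyadic_interp_def)
qed (use E in \<open>simp add: dyadic_interp_def\<close>)

lemma dyadic_interp_const [simp]: "dyadic_interp s (\<lambda>_. c) c = c"
  by (simp add: dyadic_interp_def algebra_simps)

lemma pseudometric_dyadic_interp:
  assumes "\<And>n. pseudometric (E n)" "pseudometric E'" and s: "s \<le> 1"
  shows "pseudometric (\<lambda>x y. dyadic_interp s (\<lambda>n. E n x y) (E' x y))"
  using dyadic_weight_bounds[of s] assms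
  by (cases "s \<le> 0") (auto simp: dyadic_interp_def intro!: pseudometric_comb)

lemma separable_pm_dyadic_interp:
  assumes "\<And>n. separable_pm (E n)" "separable_pm E'" and s: "s \<le> 1"
  shows "separable_pm (\<lambda>x y. dyadic_interp s (\<lambda>n. E n x y) (E' x y))"
  using dyadic_weight_bounds[of s] assms
  by (cases "s \<le> 0") (auto simp: dyadic_interp_def intro!: separable_pm_comb)

lemma measurable_dyadic_interp:
  assumes "\<And>n. (E n) \<in> borel_measurable M" "E' \<in> borel_measurable M"
  shows "(\<lambda>v. dyadic_interp s (\<lambda>n. E n v) (E' v)) \<in> borel_measurable M"
  using assms by (cases "s \<le> 0") (simp_all add: dyadic_interp_def)

section \<open>The family of geodesics\<close>

locale distortion =
  fixes A B :: "real \<Rightarrow> real \<Rightarrow> real" and e :: real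
  assumes A: "pseudometric A" "separable_pm A" "\<And>u. A u \<in> borel_measurable borel"
    and B: "pseudometric B" "separable_pm B" "\<And>u. B u \<in> borel_measurable borel"
    and e: "0 < e" "e \<le> 1"
    and AB: "\<And>u v. u \<in> {0..<1 - e} \<Longrightarrow> v \<in> {0..<1 - e} \<Longrightarrow> \<bar>A u v - B u v\<bar> \<le> e"
begin

text \<open>The point 0 keeps the index set of \<open>bridge\<close> nonempty when \<open>e = 1\<close>.\<close>

definition "core = insert 0 {0..<1 - e}"

section \<open>Gluing two pseudometrics along the core\<close>

lemma core_AB: "u \<in> core \<Longrightarrow> v \<in> core \<Longrightarrow> \<bar>A u v - B u v\<bar> \<le> e"
proof (cases "e < 1")
  case True
  then show "u \<in> core \<Longrightarrow> v \<in> core \<Longrightarrow> \<bar>A u v - B u v\<bar> \<le> e"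
    using AB by (auto simp: core_def)
next
  case False
  \<comment> \<open>Here \<open>e = 1\<close> and the core is the single point 0.\<close>
  then show "u \<in> core \<Longrightarrow> v \<in> core \<Longrightarrow> \<bar>A u v - B u v\<bar> \<le> e"
    using e pseudometricD(1)[OF A(1)] pseudometricD(1)[OF B(1)] by (auto simp: core_def)
qed

text \<open>Cost of a passage from \<open>u\<close> in the copy with \<open>A\<close> to
  \<open>v\<close> in the copy with \<open>B\<close>: walk to a core point, cross to its twin for
  \<open>e / 2\<close>, walk on.\<close>

definition bridge :: "real \<Rightarrow> real \<Rightarrow> real" where
  "bridge u v = (INF s\<in>core. A u s + e / 2 + B s v)"

lemma bridge_le: "s \<in> core \<Longrightarrow> bridge u v \<le> A u s + e / 2 + B s v"
  unfolding bridge_def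
  by (rule cINF_lower) (use e pseudometricD(2)[OF A(1)] pseudometricD(2)[OF B(1)] in \<open>auto intro!: bdd_belowI[of _ 0] add_nonneg_nonneg\<close>)

lemma bridge_greatest: "(\<And>s. s \<in> core \<Longrightarrow> c \<le> A u s + e / 2 + B s v) \<Longrightarrow> c \<le> bridge u v"
  unfolding bridge_def by (rule cINF_greatest) (auto simp: core_def)

lemma bridge_ge: "e / 2 \<le> bridge u v"
  by (rule bridge_greatest) (simp add: pseudometricD(2)[OF A(1)] pseudometricD(2)[OF B(1)])

lemma bridge_A: "bridge u v \<le> A u u' + bridge u' v"
proof -
  have "bridge u v - A u u' \<le> bridge u' v"
  proof (rule bridge_greatest)
    fix s assume "s \<in> core"
    then show "bridge u v - A u u' \<le> A u' s + e / 2 + B s v"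
      using bridge_le[of s u v] pseudometricD(4)[OF A(1), of u s u'] by linarith
  qed
  then show ?thesis by linarith
qed

lemma bridge_B: "bridge u v \<le> bridge u v' + B v' v"
proof -
  have "bridge u v - B v' v \<le> bridge u v'"
  proof (rule bridge_greatest)
    fix s assume "s \<in> core"
    then show "bridge u v - B v' v \<le> A u s + e / 2 + B s v'"
      using bridge_le[of s u v] pseudometricD(4)[OF B(1), of s v v'] by linarith
  qed
  then show ?thesis by linarith
qed

text \<open>A detour through the other copy crosses twice and pays \<open>e\<close> in total, which
  covers the distortion between \<open>A\<close> and \<open>B\<close> on the core. So the gluing
  shortens no distance, and this is the reason for the length \<open>e / 2\<close>.\<close>

lemma A_le_bridge: "A u u' \<le> bridge u v + bridge u' v"
proof -
  have "A u u' - bridge u' v \<le> bridge u v"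
  proof (rule bridge_greatest)
    fix s assume s: "s \<in> core"
    have "A u u' - (A u s + e / 2 + B s v) \<le> bridge u' v"
    proof (rule bridge_greatest)
      fix s' assume s': "s' \<in> core"
      show "A u u' - (A u s + e / 2 + B s v) \<le> A u' s' + e / 2 + B s' v"
        using core_AB[OF s s'] pseudometricD(4)[OF A(1), of u u' s] pseudometricD(4)[OF A(1), of s u' s']
          pseudometricD(3)[OF A(1), of u' s'] pseudometricD(4)[OF B(1), of s s' v] pseudometricD(3)[OF B(1), of s' v]
        by linarith
    qed
    then show "A u u' - bridge u' v \<le> A u s + e / 2 + B s v" by linarith
  qed
  then show ?thesis by linarith
qed

lemma B_le_bridge: "B v v' \<le> bridge u v + bridge u v'"
proof -
  have "B v v' - bridge u v' \<le> bridge u v"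
  proof (rule bridge_greatest)
    fix s assume s: "s \<in> core"
    have "B v v' - (A u s + e / 2 + B s v) \<le> bridge u v'"
    proof (rule bridge_greatest)
      fix s' assume s': "s' \<in> core"
      show "B v v' - (A u s + e / 2 + B s v) \<le> A u s' + e / 2 + B s' v'"
        using core_AB[OF s s'] pseudometricD(4)[OF B(1), of v v' s] pseudometricD(4)[OF B(1), of s v' s']
          pseudometricD(3)[OF B(1), of v s] pseudometricD(4)[OF A(1), of s s' u] pseudometricD(3)[OF A(1), of s u]
        by linarith
    qed
    then show "B v v' - bridge u v' \<le> A u s + e / 2 + B s v" by linarith
  qed
  then show ?thesis by linarith
qed

lemma bridge_core: "u \<in> core \<Longrightarrow> bridge u u \<le> e / 2"
  using bridge_le[of u u u] by (simp add: pseudometricD(1)[OF A(1)] pseudometricD(1)[OF B(1)])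

definition glued :: "bool \<times> real \<Rightarrow> bool \<times> real \<Rightarrow> real" where
  "glued z w = (if fst z then (if fst w then B (snd z) (snd w) else bridge (snd w) (snd z))
     else (if fst w then bridge (snd z) (snd w) else A (snd z) (snd w)))"

lemma glued_simps [simp]:
  "glued (False, u) (False, v) = A u v" "glued (True, u) (True, v) = B u v"
  "glued (False, u) (True, v) = bridge u v" "glued (True, u) (False, v) = bridge v u"
  by (simp_all add: glued_def)

lemma glued_pm: "pseudometric glued"
  unfolding pseudometric_def
proof (intro conjI allI)
  fix x y z :: "bool \<times> real"
  obtain i u j v k w where xyz: "x = (i, u)" "y = (j, v)" "z = (k, w)"
    by (cases x, cases y, cases z)
  show "glued x x = 0"
    by (cases i) (simp_all add: xyz pseudometricD(1)[OF A(1)] pseudometricD(1)[OF B(1)])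
  have "0 \<le> bridge a b" for a b using bridge_ge[of a b] e by simp
  then show "0 \<le> glued x y"
    by (cases i; cases j) (simp_all add: xyz pseudometricD(2)[OF A(1)] pseudometricD(2)[OF B(1)])
  show "glued x y = glued y x"
    by (cases i; cases j) (simp_all add: xyz pseudometricD(3)[OF A(1), of u] pseudometricD(3)[OF B(1), of u])
  show "glued x z \<le> glued x y + glued y z"
    using pseudometricD(4)[OF A(1), of u w v] pseudometricD(4)[OF B(1), of u w v] bridge_A[of u w v] bridge_B[of u w v]
      A_le_bridge[of u w v] B_le_bridge[of u w v] bridge_A[of w u v] bridge_B[of w u v]
      pseudometricD(3)[OF A(1), of w v] pseudometricD(3)[OF B(1), of v u]
    by (cases i; cases j; cases k) (simp_all add: xyz)
qed

lemma glued_sep: "separable_pm glued"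
  unfolding separable_pm_def
proof (intro allI impI)
  fix r :: real assume r: "r > 0"
  obtain k l :: "real \<Rightarrow> nat" where k: "\<And>x y. k x = k y \<Longrightarrow> A x y < r" and l: "\<And>x y. l x = l y \<Longrightarrow> B x y < r"
    using A(2) B(2) r unfolding separable_pm_def by blast
  show "\<exists>k :: bool \<times> real \<Rightarrow> nat. \<forall>x y. k x = k y \<longrightarrow> glued x y < r"
    \<comment> \<open>Even codes for the copy \<open>True\<close> and odd ones for
      \<open>False\<close>, so that no cell meets both copies.\<close>
    by (intro exI[of _ "\<lambda>z. if fst z then 2 * l (snd z) else 2 * k (snd z) + 1"])
      (auto simp: glued_def k l split: if_splits, presburger+)
qed

text \<open>Within each copy \<open>glued z\<close> is 1-Lipschitz for the pseudometric of that
  copy, so \<open>lipschitz_measurable\<close> applies.\<close>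

lemma glued_meas: "(\<lambda>v. glued z (i, v)) \<in> borel_measurable borel"
proof (cases i)
  case True
  show ?thesis
  proof (rule lipschitz_measurable[OF B])
    show "glued z (i, u) - glued z (i, v) \<le> B u v" for u v
      using pseudometricD(4)[OF glued_pm, of z "(True, u)" "(True, v)"] pseudometricD(3)[OF B(1), of u v]
      by (simp add: True)
  qed
next
  case False
  show ?thesis
  proof (rule lipschitz_measurable[OF A])
    show "glued z (i, u) - glued z (i, v) \<le> A u v" for u v
      using pseudometricD(4)[OF glued_pm, of z "(False, u)" "(False, v)"] pseudometricD(3)[OF A(1), of u v]
      by (simp add: False)
  qed
qed

text \<open>The mass of the atoms in the core at any intermediate time.\<close>

definition core_mass :: real where
  "core_mass = measure unit_interval_L
     {u \<in> {0..<1 - e}. measure unit_interval_L {v \<in> {0..<1 - e}. A u v = 0 \<and> B u v = 0} \<noteq> 0}"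

end

section \<open>The path of pseudometrics and its speed\<close>

locale distortion_path = distortion +
  fixes a :: real and q :: "bool \<Rightarrow> nat \<Rightarrow> real" and idx :: "bool \<Rightarrow> nat \<Rightarrow> real \<Rightarrow> nat"
  assumes a: "0 < a" "a < 1"
    and idx: "\<And>j n. idx j n \<in> borel \<rightarrow>\<^sub>M count_space UNIV"
    and q: "\<And>j n u. glued (j, u) (j, q j (idx j n u)) \<le> e / 24 * (1/2) ^ n"
begin

text \<open>Off the core the points change copies one after the other from left to right, mass
  \<open>e\<close> in unit time.\<close>

definition moved :: "real \<Rightarrow> real \<Rightarrow> bool" where
  "moved t u \<longleftrightarrow> u < 1 - e + t * e"

text \<open>Location of \<open>u\<close> in the glued space, where \<open>i\<close> selects the end of the interpolation on the core and
  \<open>N\<close> the discretization level (\<open>None\<close> for no discretization).\<close>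

definition place :: "bool \<Rightarrow> nat option \<Rightarrow> real \<Rightarrow> real \<Rightarrow> bool \<times> real" where
  "place i N t u =
    (if u < 1 - e then (i, u)
     else (moved t u, case N of None \<Rightarrow> u
       | Some n \<Rightarrow> if u < 1 - e + a * e then q (moved t u) (idx (moved t u) n u) else u))"

text \<open>The extra coordinate: it separates the points beyond the discretized portion from each
  other and, being positive there, from the core and the discretized points.\<close>

definition label :: "real \<Rightarrow> real" where
  "label u = (if u < 1 - e + a * e then 0 else u)"

text \<open>Strength of the modification, 1-Lipschitz in time and 0 at both ends. It is both the
  scale of the discretization and the factor of the extra coordinate.\<close>

definition height :: "real \<Rightarrow> real" where
  "height t = min t (1 - t)"

text \<open>Distances are interpolated here, not places, because the discretized places jump from
  one level to the next.\<close>

definition part :: "bool \<Rightarrow> real \<Rightarrow> real \<Rightarrow> real \<Rightarrow> real \<Rightarrow> real" where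
  "part i s t u v = dyadic_interp s (\<lambda>n. glued (place i (Some n) t u) (place i (Some n) t v))
     (glued (place i None t u) (place i None t v))"

text \<open>For two core points this is \<open>(1 - t) * A + t * B\<close>. A point off the core has
  the same place in both parts. The factor \<open>e / 4\<close> is the share of the speed granted to
  the extra coordinate.\<close>

definition path_dist :: "real \<Rightarrow> real \<Rightarrow> real \<Rightarrow> real" where
  "path_dist t u v = (1 - t) * part False (height t) t u v + t * part True (height t) t u v
     + e / 4 * height t * \<bar>label u - label v\<bar>"

lemma part_pm: "s \<le> 1 \<Longrightarrow> pseudometric (part i s t)"
  unfolding part_def
  by (intro pseudometric_dyadic_interp pseudometric_pullback[OF glued_pm])

lemma part_sep: "s \<le> 1 \<Longrightarrow> separable_pm (part i s t)"
  unfolding part_def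
  by (intro separable_pm_dyadic_interp separable_pm_pullback[OF glued_sep])

lemma place_meas: "(\<lambda>v. glued z (place i N t v)) \<in> borel_measurable borel"
proof -
  have comp: "(\<lambda>v. glued z (j, f v)) \<in> borel_measurable borel" if "f \<in> borel_measurable borel" for f j
    using measurable_compose[OF that glued_meas] .
  have qm: "(\<lambda>v. q j (idx j n v)) \<in> borel_measurable borel" for j n
    by (rule measurable_compose[OF idx]) simp
  have eq: "glued z (place i N t v) =
    (if v < 1 - e then glued z (i, v)
     else if moved t v then (case N of None \<Rightarrow> glued z (True, v)
        | Some n \<Rightarrow> if v < 1 - e + a * e then glued z (True, q True (idx True n v)) else glued z (True, v))
     else (case N of None \<Rightarrow> glued z (False, v)
        | Some n \<Rightarrow> if v < 1 - e + a * e then glued z (False, q False (idx False n v)) else glued z (False, v)))" for v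
    by (auto simp: place_def split: option.splits)
  have less: "{v \<in> space borel. v < c} \<in> sets borel" for c :: real
    by simp
  show ?thesis
    unfolding eq moved_def
    by (cases N; simp only: option.case; intro measurable_If less glued_meas comp[OF qm])
qed

lemma part_meas: "part i s t u \<in> borel_measurable borel"
  unfolding part_def by (intro measurable_dyadic_interp place_meas)

lemma label_meas [measurable]: "label \<in> borel_measurable borel"
  unfolding label_def by measurable

lemma height_bounds: "t \<in> {0..1} \<Longrightarrow> 0 \<le> height t \<and> height t \<le> 1"
  by (auto simp: height_def)

lemma path_dist_alt: "path_dist t = (\<lambda>u v. 1 * ((1 - t) * part False (height t) t u v + t * part True (height t) t u v)
     + (e / 4 * height t) * \<bar>label u - label v\<bar>)"
  by (simp add: path_dist_def fun_eq_iff)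

lemma label_pm: "pseudometric (\<lambda>u v. \<bar>label u - label v\<bar>)"
  by (auto simp: pseudometric_def)

lemma path_dist_pm: "t \<in> {0..1} \<Longrightarrow> pseudometric (path_dist t)"
  unfolding path_dist_alt using height_bounds[of t] e
  by (intro pseudometric_comb part_pm label_pm) auto

lemma path_dist_sep: "t \<in> {0..1} \<Longrightarrow> separable_pm (path_dist t)"
  unfolding path_dist_alt using height_bounds[of t] e
  by (intro separable_pm_comb part_sep separable_pm_pullback[OF separable_pm_real_dist]) auto

lemma path_dist_meas: "path_dist t u \<in> borel_measurable borel"
proof -
  note [measurable] = part_meas[of False "height t" t u] part_meas[of True "height t" t u]
  show ?thesis unfolding path_dist_def by measurable
qed

text \<open>At both end times the height is 0, so neither discretization nor label enters. At time 0
  no point off the core has been moved; at time 1 every point below 1 has.\<close>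

lemma path_dist_0: "u \<in> {0..<1} \<Longrightarrow> v \<in> {0..<1} \<Longrightarrow> path_dist 0 u v = A u v"
  by (auto simp: path_dist_def part_def dyadic_interp_def height_def place_def moved_def)

lemma path_dist_1: "u \<in> {0..<1} \<Longrightarrow> v \<in> {0..<1} \<Longrightarrow> path_dist 1 u v = B u v"
  by (auto simp: path_dist_def part_def dyadic_interp_def height_def place_def moved_def)

lemma glued_diff: "\<bar>glued x y - glued x' y'\<bar> \<le> glued x x' + glued y y'"
  using pseudometricD(4)[OF glued_pm, of x y x'] pseudometricD(4)[OF glued_pm, of x' y y']
    pseudometricD(4)[OF glued_pm, of x' y' x] pseudometricD(4)[OF glued_pm, of x y' y]
    pseudometricD(3)[OF glued_pm, of x x'] pseudometricD(3)[OF glued_pm, of y y'] by linarith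

lemma place_close: "glued (place i (Some n) t u) (place i None t u) \<le> e / 24 * (1/2) ^ n"
proof -
  have "glued (j, q j (idx j n u)) (j, u) \<le> e / 24 * (1/2) ^ n" for j
    using q[of j u n] by (simp only: pseudometricD(3)[OF glued_pm, of "(j, q j (idx j n u))"])
  moreover have "glued z z \<le> e / 24 * (1/2) ^ n" for z
    using e by (simp add: pseudometricD(1)[OF glued_pm])
  ultimately show ?thesis
    by (auto simp: place_def)
qed

text \<open>Origin of the constant \<open>e / 24\<close>: it bounds the error of one place, a
  distance of two places has error \<open>e / 12\<close>, and the interpolation turns this into the
  slope \<open>3 * (e / 12) = e / 4\<close>.\<close>

lemma part_lipschitz:
  assumes "s \<in> {0..1}" "s' \<in> {0..1}"
  shows "\<bar>part i s t u v - part i s' t u v\<bar> \<le> e / 4 * \<bar>s - s'\<bar>"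
proof -
  have "\<bar>part i s t u v - part i s' t u v\<bar> \<le> 3 * (e / 12) * \<bar>s - s'\<bar>"
    unfolding part_def
  proof (rule dyadic_interp_lipschitz[OF _ assms])
    fix n
    have "\<bar>glued (place i (Some n) t u) (place i (Some n) t v) - glued (place i None t u) (place i None t v)\<bar>
      \<le> e / 24 * (1/2) ^ n + e / 24 * (1/2) ^ n"
      using glued_diff place_close[of i n t u] place_close[of i n t v] by (meson add_mono order_trans)
    then show "\<bar>glued (place i (Some n) t u) (place i (Some n) t v) - glued (place i None t u) (place i None t v)\<bar>
      \<le> e / 12 * (1/2) ^ n" by simp
  qed
  then show ?thesis by simp
qed

lemma glued_core: "u < 1 - e \<Longrightarrow> 0 \<le> u \<Longrightarrow> glued (False, u) (True, u) \<le> e / 2"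
  using bridge_core[of u] by (simp add: core_def)

text \<open>At most one of the two points is in the core, so switching the end moves at most one
  place, and only to its twin at distance at most \<open>e / 2\<close>. For two core points the
  change could be as large as \<open>e\<close>.\<close>

lemma place_switch_half:
  assumes "u \<in> {0..<1}" "v \<in> {0..<1}" "\<not> (u < 1 - e \<and> v < 1 - e)"
  shows "\<bar>glued (place False N t u) (place False N t v) - glued (place True N t u) (place True N t v)\<bar> \<le> e / 2"
proof -
  have eq: "place False N t w = place True N t w" if "\<not> w < 1 - e" for w
    using that by (simp add: place_def)
  have le: "glued (place False N t w) (place True N t w) \<le> e / 2" if "w \<in> {0..<1}" "w < 1 - e" for w
    using that glued_core[of w] by (simp add: place_def)
  have zero: "glued z z = 0" for z by (rule pseudometricD(1)[OF glued_pm])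
  show ?thesis
    using glued_diff[of "place False N t u" "place False N t v" "place True N t u" "place True N t v"]
      assms eq[of u] eq[of v] le[of u] le[of v] zero e
    by (cases "u < 1 - e"; cases "v < 1 - e") auto
qed

lemma place_core: "u < 1 - e \<Longrightarrow> place i N t u = (i, u)"
  by (simp add: place_def)

lemma part_core: "u < 1 - e \<Longrightarrow> v < 1 - e \<Longrightarrow> part i s t u v = (if i then B u v else A u v)"
  by (simp add: part_def place_core)

lemma label_core: "u < 1 - e \<Longrightarrow> label u = 0"
proof -
  have "0 < a * e" using a e by simp
  moreover assume "u < 1 - e"
  ultimately have "u < 1 - e + a * e" by linarith
  then show ?thesis by (simp add: label_def)
qed

lemma label_diff: "u \<in> {0..<1} \<Longrightarrow> v \<in> {0..<1} \<Longrightarrow> \<bar>label u - label v\<bar> \<le> 1"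
  by (auto simp: label_def)

lemma place_same:
  assumes "moved x u = moved y u \<or> u < 1 - e"
  shows "place i N x u = place i N y u"
  using assms by (auto simp: place_def split: option.splits)

lemma path_dist_lipschitz:
  assumes x: "x \<in> {0..1}" and y: "y \<in> {0..1}" and u: "u \<in> {0..<1}" and v: "v \<in> {0..<1}"
    and mu: "moved x u = moved y u \<or> u < 1 - e" and mv: "moved x v = moved y v \<or> v < 1 - e"
  shows "\<bar>path_dist x u v - path_dist y u v\<bar> \<le> \<bar>x - y\<bar> * e"
proof (cases "u < 1 - e \<and> v < 1 - e")
  case True
  then have "path_dist t u v = (1 - t) * A u v + t * B u v" for t
    by (simp add: path_dist_def part_core label_core)
  then have "path_dist x u v - path_dist y u v = (x - y) * (B u v - A u v)"
    by (simp add: algebra_simps)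
  then show ?thesis
    using AB[of u v] True u v by (simp add: abs_mult abs_minus_commute mult_left_mono)
next
  case False
  let ?F = "\<lambda>s. part False s x u v" and ?T = "\<lambda>s. part True s x u v"
  have same: "part i s y u v = part i s x u v" for i s
    using place_same[OF mu] place_same[OF mv] by (simp add: part_def)
  have hb: "height x \<in> {0..1}" "height y \<in> {0..1}"
    using height_bounds x y by auto
  have h: "\<bar>height x - height y\<bar> \<le> \<bar>x - y\<bar>"
    by (auto simp: height_def min_def)
  \<comment> \<open>A quarter of the allowed change: one share for the discretization, two for
    shifting weight between the ends, one for the extra coordinate.\<close>
  define m where "m = e / 4 * \<bar>x - y\<bar>"
  have m0: "0 \<le> m" using e by (simp add: m_def)
  have hm: "e / 4 * \<bar>height x - height y\<bar> \<le> m"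
    unfolding m_def using h e by (intro mult_left_mono) auto
  have F: "\<bar>?F (height x) - ?F (height y)\<bar> \<le> m" and T: "\<bar>?T (height x) - ?T (height y)\<bar> \<le> m"
    using part_lipschitz[OF hb, of False x u v] part_lipschitz[OF hb, of True x u v] hm by linarith+
  have FT: "\<bar>?F (height y) - ?T (height y)\<bar> \<le> e / 2"
    unfolding part_def
    by (rule dyadic_interp_diff) (use place_switch_half[OF u v False] hb in auto)
  have 1: "\<bar>(1 - x) * (?F (height x) - ?F (height y))\<bar> \<le> (1 - x) * m"
    "\<bar>x * (?T (height x) - ?T (height y))\<bar> \<le> x * m"
    using F T x by (simp_all add: abs_mult mult_left_mono)
  have 2: "\<bar>(y - x) * (?F (height y) - ?T (height y))\<bar> \<le> 2 * m"
  proof -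
    have "\<bar>(y - x) * (?F (height y) - ?T (height y))\<bar> \<le> \<bar>y - x\<bar> * (e / 2)"
      using mult_left_mono[OF FT, of "\<bar>y - x\<bar>"] by (simp add: abs_mult)
    then show ?thesis by (simp add: m_def abs_minus_commute mult.commute)
  qed
  have 3: "\<bar>e / 4 * (height x - height y) * \<bar>label u - label v\<bar>\<bar> \<le> m"
  proof -
    have "\<bar>e / 4 * (height x - height y) * \<bar>label u - label v\<bar>\<bar> = e / 4 * \<bar>height x - height y\<bar> * \<bar>label u - label v\<bar>"
      using e by (simp add: abs_mult)
    also have "\<dots> \<le> e / 4 * \<bar>height x - height y\<bar> * 1"
      using label_diff[OF u v] e by (intro mult_left_mono) auto
    finally show ?thesis using hm by simp
  qed
  define c where "c = e / 4"
  have c: "path_dist t u v = (1 - t) * part False (height t) t u v + t * part True (height t) t u v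
     + c * height t * \<bar>label u - label v\<bar>" for t
    by (simp add: path_dist_def c_def)
  have "path_dist x u v - path_dist y u v = (1 - x) * (?F (height x) - ?F (height y))
    + x * (?T (height x) - ?T (height y)) + (y - x) * (?F (height y) - ?T (height y))
    + c * (height x - height y) * \<bar>label u - label v\<bar>"
    unfolding c same by (simp add: algebra_simps)
  then have "\<bar>path_dist x u v - path_dist y u v\<bar> \<le> (1 - x) * m + x * m + 2 * m + m"
    using 1 2 3 unfolding c_def by linarith
  also have "\<dots> = 4 * m" by (simp add: algebra_simps)
  also have "\<dots> = \<bar>x - y\<bar> * e" by (simp add: m_def mult.commute)
  finally show ?thesis .
qed

end

section \<open>Atoms along the path\<close>

context distortion_path
begin

lemma height_pos: "t \<in> {0<..<1} \<Longrightarrow> 0 < height t \<and> height t \<le> 1"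
  by (auto simp: height_def)

lemma path_dist_zero_iff:
  assumes t: "t \<in> {0<..<1}"
  shows "path_dist t u v = 0 \<longleftrightarrow> part False (height t) t u v = 0 \<and> part True (height t) t u v = 0 \<and> label u = label v"
proof -
  have h: "0 < height t" "height t \<le> 1" using height_pos[OF t] by auto
  have "0 \<le> (1 - t) * part False (height t) t u v" "0 \<le> t * part True (height t) t u v"
    "0 \<le> e / 4 * height t * \<bar>label u - label v\<bar>"
    using t h e pseudometricD(2)[OF part_pm[OF h(2)]] by auto
  then have "path_dist t u v = 0 \<longleftrightarrow> (1 - t) * part False (height t) t u v = 0 \<and> t * part True (height t) t u v = 0 \<and>
    e / 4 * height t * \<bar>label u - label v\<bar> = 0"
    unfolding path_dist_def by linarith
  then show ?thesis using t h e by simp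
qed

definition zero_set :: "real \<Rightarrow> real \<Rightarrow> real set" where
  "zero_set t u = {v \<in> {0..<1}. path_dist t u v = 0}"

text \<open>By \<open>heavy_parameter\<close> these are the points lying over atoms, once
  \<open>path_dist t\<close> is realized by a space.\<close>

definition heavy :: "real \<Rightarrow> real set" where
  "heavy t = {u \<in> {0..<1}. measure unit_interval_L (zero_set t u) \<noteq> 0}"

lemma zero_set_core:
  assumes t: "t \<in> {0<..<1}" and u: "u \<in> {0..<1 - e}"
  shows "zero_set t u = {v \<in> {0..<1 - e}. A u v = 0 \<and> B u v = 0}"
proof (intro equalityI subsetI)
  fix v assume "v \<in> zero_set t u"
  then have v: "v \<in> {0..<1}" and z: "part False (height t) t u v = 0" "part True (height t) t u v = 0"
    using path_dist_zero_iff[OF t] by (auto simp: zero_set_def)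
  have "v < 1 - e"
  proof (rule ccontr)
    assume v': "\<not> v < 1 - e"
    \<comment> \<open>Taking the end opposite to the copy that holds \<open>v\<close> puts the core
      point \<open>u\<close> on the other side of the bridge, so this part of the distance is at
      least \<open>e / 2\<close>.\<close>
    have "e / 2 \<le> glued (\<not> moved t v, u) (moved t v, w)" for w
      using bridge_ge by (cases "moved t v") simp_all
    then have "e / 2 \<le> glued (place (\<not> moved t v) N t u) (place (\<not> moved t v) N t v)" for N
      using u v' by (simp add: place_def)
    then have "e / 2 \<le> part (\<not> moved t v) (height t) t u v"
      unfolding part_def using height_pos[OF t] by (intro dyadic_interp_ge) auto
    then show False
      using z e by (cases "moved t v") auto
  qed
  then show "v \<in> {v \<in> {0..<1 - e}. A u v = 0 \<and> B u v = 0}"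
    using v u z by (simp add: part_core)
next
  fix v assume "v \<in> {v \<in> {0..<1 - e}. A u v = 0 \<and> B u v = 0}"
  then show "v \<in> zero_set t u"
    using u e path_dist_zero_iff[OF t] by (simp add: zero_set_def part_core label_core)
qed

text \<open>The label is positive and injective beyond the discretized portion, so the extra
  coordinate leaves no other point at distance zero.\<close>

lemma zero_set_labelled:
  assumes t: "t \<in> {0<..<1}" and u: "1 - e + a * e \<le> u"
  shows "zero_set t u \<subseteq> {u}"
proof
  fix v assume "v \<in> zero_set t u"
  then have "label v = label u"
    using path_dist_zero_iff[OF t] by (simp add: zero_set_def)
  moreover have "0 < u"
    using mult_pos_pos[of a e] a e u by linarith
  ultimately show "v \<in> {u}"
    using u by (auto simp: label_def split: if_splits)
qed

text \<open>At positive height the interpolation involves only the two neighbouring levels and never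
  the undiscretized distance, so agreement of the copy and of two indices already identifies the
  points.\<close>

lemma path_dist_same_code:
  assumes t: "t \<in> {0<..<1}" and u: "u \<in> {1 - e..<1 - e + a * e}" and v: "v \<in> {1 - e..<1 - e + a * e}"
    and j: "moved t u = j" "moved t v = j"
    and k: "\<And>n. n \<in> {dyadic_level (height t), Suc (dyadic_level (height t))} \<Longrightarrow> idx j n u = idx j n v"
  shows "path_dist t u v = 0"
proof -
  have "place i (Some n) t u = place i (Some n) t v" if "n \<in> {dyadic_level (height t), Suc (dyadic_level (height t))}" for i n
    using u v j k[OF that] by (simp add: place_def)
  then have "part i (height t) t u v = 0" for i
    using height_pos[OF t] by (simp add: part_def dyadic_interp_def pseudometricD(1)[OF glued_pm])
  then show ?thesis
    using u v path_dist_zero_iff[OF t] by (simp add: label_def)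
qed

text \<open>The copy and the two indices cut the portion into countably many cells, and a cell lies
  in the zero set of each of its points. Cells of positive mass thus consist of heavy points, and
  the cells of mass zero together form a null set.\<close>

lemma heavy_discrete:
  assumes t: "t \<in> {0<..<1}"
  shows "AE u in unit_interval_L. u \<in> {1 - e..<1 - e + a * e} \<longrightarrow> u \<in> heavy t"
proof -
  let ?n = "dyadic_level (height t)"
  define cell :: "bool \<times> nat \<times> nat \<Rightarrow> real set" where
    "cell = (\<lambda>(j, k, l). {u \<in> {1 - e..<1 - e + a * e}. moved t u = j \<and> idx j ?n u = k \<and> idx j (Suc ?n) u = l})"
  have sub: "{1 - e..<1 - e + a * e} \<subseteq> {0..<1}"
    using a e mult_strict_right_mono[of a 1 e] by auto
  have cell_sets: "cell c \<in> sets unit_interval_L" for c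
  proof -
    obtain j k l where c: "c = (j, k, l)" by (cases c)
    have "{u. moved t u} \<in> sets borel" unfolding moved_def by simp
    then have "{u. moved t u = j} \<in> sets borel"
      using sets.compl_sets[of "{u. moved t u}" borel] by (cases j) (auto simp: Collect_neg_eq Compl_eq_Diff_UNIV)
    moreover have "idx j ?n -` {k} \<in> sets borel" "idx j (Suc ?n) -` {l} \<in> sets borel"
      using measurable_sets[OF idx, of "{k}" j ?n] measurable_sets[OF idx, of "{l}" j "Suc ?n"] by simp_all
    ultimately have "{1 - e..<1 - e + a * e} \<inter> ({u. moved t u = j} \<inter> (idx j ?n -` {k} \<inter> idx j (Suc ?n) -` {l})) \<in> sets borel"
      by (intro sets.Int) auto
    moreover have "cell c = {1 - e..<1 - e + a * e} \<inter> ({u. moved t u = j} \<inter> (idx j ?n -` {k} \<inter> idx j (Suc ?n) -` {l}))"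
      by (auto simp: cell_def c)
    ultimately show ?thesis
      using sub by (auto simp: sets_unit_interval_L)
  qed
  have zs: "zero_set t u \<in> sets unit_interval_L" for u
  proof -
    have "{v \<in> space borel. path_dist t u v = 0} \<in> sets borel"
      using path_dist_meas[of t u] by measurable
    then have "{v. path_dist t u v = 0} \<inter> {0..<1} \<in> sets borel" by auto
    moreover have "zero_set t u = {v. path_dist t u v = 0} \<inter> {0..<1}"
      by (auto simp: zero_set_def)
    ultimately show ?thesis by (auto simp: sets_unit_interval_L)
  qed
  have "(\<Union>c\<in>{c. emeasure unit_interval_L (cell c) = 0}. cell c) \<in> null_sets unit_interval_L"
    by (intro null_sets_UN' countableI_type) (use cell_sets in auto)
  then show ?thesis
  proof (rule AE_I', intro subsetI)
    fix u assume "u \<in> {u \<in> space unit_interval_L. \<not> (u \<in> {1 - e..<1 - e + a * e} \<longrightarrow> u \<in> heavy t)}"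
    then have u: "u \<in> space unit_interval_L" "u \<in> {1 - e..<1 - e + a * e}" and nh: "u \<notin> heavy t"
      by auto
    define c where "c = (moved t u, idx (moved t u) ?n u, idx (moved t u) (Suc ?n) u)"
    have uc: "u \<in> cell c" using u(2) by (simp add: cell_def c_def)
    have "cell c \<subseteq> zero_set t u"
    proof
      fix v assume v: "v \<in> cell c"
      then have v': "v \<in> {1 - e..<1 - e + a * e}" by (auto simp: cell_def split: prod.splits)
      have "path_dist t u v = 0"
        by (rule path_dist_same_code[OF t u(2) v', of "moved t u"]) (use v in \<open>auto simp: cell_def c_def\<close>)
      then show "v \<in> zero_set t u"
        using v' sub by (auto simp: zero_set_def)
    qed
    then have "measure unit_interval_L (cell c) \<le> measure unit_interval_L (zero_set t u)"
      by (intro UL.finite_measure_mono zs)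
    moreover have "measure unit_interval_L (zero_set t u) = 0"
      using nh u by (simp add: heavy_def)
    ultimately have "emeasure unit_interval_L (cell c) = 0"
      by (simp add: UL.emeasure_eq_measure measure_le_0_iff)
    then show "u \<in> (\<Union>c\<in>{c. emeasure unit_interval_L (cell c) = 0}. cell c)"
      using uc by blast
  qed
qed

text \<open>The core contributes an amount independent of \<open>t\<close>, the discretized portion
  its full length \<open>a * e\<close>, and the labelled rest nothing.\<close>

lemma measure_heavy:
  assumes t: "t \<in> {0<..<1}" and h: "heavy t \<in> sets unit_interval_L"
  shows "measure unit_interval_L (heavy t) = core_mass + a * e"
proof -
  have ae: "0 < a * e" "a * e < e"
    using a e mult_strict_right_mono[of a 1 e] by auto
  have s: "{0..<1 - e} \<in> sets unit_interval_L" "{1 - e..<1} \<in> sets unit_interval_L"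
    "{1 - e..<1 - e + a * e} \<in> sets unit_interval_L"
    using e ae a by (auto simp: sets_unit_interval_L)
  have "(heavy t \<inter> {0..<1 - e}) \<union> (heavy t \<inter> {1 - e..<1}) = heavy t"
    by (auto simp: heavy_def)
  moreover have "measure unit_interval_L ((heavy t \<inter> {0..<1 - e}) \<union> (heavy t \<inter> {1 - e..<1}))
    = measure unit_interval_L (heavy t \<inter> {0..<1 - e}) + measure unit_interval_L (heavy t \<inter> {1 - e..<1})"
    by (rule UL.finite_measure_Union) (use h s in auto)
  ultimately have "measure unit_interval_L (heavy t)
    = measure unit_interval_L (heavy t \<inter> {0..<1 - e}) + measure unit_interval_L (heavy t \<inter> {1 - e..<1})"
    by simp
  moreover have "heavy t \<inter> {0..<1 - e}
    = {u \<in> {0..<1 - e}. measure unit_interval_L {v \<in> {0..<1 - e}. A u v = 0 \<and> B u v = 0} \<noteq> 0}"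
    using zero_set_core[OF t] e by (auto simp: heavy_def)
  moreover have "measure unit_interval_L (heavy t \<inter> {1 - e..<1}) = measure unit_interval_L {1 - e..<1 - e + a * e}"
  proof (rule UL.finite_measure_eq_AE)
    show "AE u in unit_interval_L. u \<in> heavy t \<inter> {1 - e..<1} \<longleftrightarrow> u \<in> {1 - e..<1 - e + a * e}"
      using heavy_discrete[OF t]
    proof eventually_elim
      case (elim u)
      have nh: "u \<notin> heavy t" if u: "1 - e + a * e \<le> u" "u < 1"
      proof -
        have "0 \<le> u" using u ae e by linarith
        then have us: "{u} \<in> sets unit_interval_L" using u by (auto simp: sets_unit_interval_L)
        have "measure unit_interval_L (zero_set t u) \<le> measure unit_interval_L {u}"
          by (rule UL.finite_measure_mono[OF zero_set_labelled[OF t u(1)] us])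
        also have "\<dots> = 0"
          using u \<open>0 \<le> u\<close> by (subst measure_unit_interval_L) auto
        finally show ?thesis by (simp add: heavy_def measure_le_0_iff)
      qed
      have "u \<in> heavy t \<Longrightarrow> u < 1 \<Longrightarrow> u < 1 - e + a * e"
        using nh not_le by blast
      moreover have "u < 1 - e + a * e \<Longrightarrow> u < 1"
        using ae by linarith
      ultimately show ?case using elim by auto
    qed
  qed (use h s in auto)
  moreover have "measure unit_interval_L {1 - e..<1 - e + a * e} = a * e"
    using e ae a by (subst measure_unit_interval_L) auto
  ultimately show ?thesis by (simp add: core_mass_def)
qed

lemma ex_path:
  "\<exists>(\<gamma> :: real \<Rightarrow> real mmspace) \<Phi>.
     (\<forall>t\<in>{0..1}. mm_space (\<gamma> t) \<and> mm_parameter (\<gamma> t) (\<Phi> t)) \<and>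
     (\<forall>u\<in>{0..<1}. \<forall>v\<in>{0..<1}. mm_dist (\<gamma> 0) (\<Phi> 0 u) (\<Phi> 0 v) = A u v \<and> mm_dist (\<gamma> 1) (\<Phi> 1 u) (\<Phi> 1 v) = B u v) \<and>
     (\<forall>x\<in>{0..1}. \<forall>y\<in>{0..1}. \<exists>I\<in>sets borel. I \<subseteq> {0..<1} \<and> 1 - \<bar>x - y\<bar> * e \<le> measure lborel I \<and>
        (\<forall>u\<in>I. \<forall>v\<in>I. \<bar>mm_dist (\<gamma> x) (\<Phi> x u) (\<Phi> x v) - mm_dist (\<gamma> y) (\<Phi> y u) (\<Phi> y v)\<bar> \<le> \<bar>x - y\<bar> * e)) \<and>
     (\<forall>t\<in>{0<..<1}. atomic_mass (\<gamma> t) = core_mass + a * e)"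
proof -
  have "\<forall>t\<in>{0..1}. \<exists>p :: real mmspace \<times> (real \<Rightarrow> real). mm_space (fst p) \<and> mm_parameter (fst p) (snd p) \<and>
      (\<forall>u v. mm_dist (fst p) (snd p u) (snd p v) = path_dist t u v)"
    using pseudometric_realization[OF path_dist_pm path_dist_sep path_dist_meas] by simp
  then obtain P :: "real \<Rightarrow> real mmspace \<times> (real \<Rightarrow> real)" where P: "\<And>t. t \<in> {0..1} \<Longrightarrow> mm_space (fst (P t))"
    "\<And>t. t \<in> {0..1} \<Longrightarrow> mm_parameter (fst (P t)) (snd (P t))"
    "\<And>t u v. t \<in> {0..1} \<Longrightarrow> mm_dist (fst (P t)) (snd (P t) u) (snd (P t) v) = path_dist t u v"
    by metis
  define \<gamma> where "\<gamma> t = fst (P t)" for t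
  define \<Phi> where "\<Phi> t = snd (P t)" for t
  have \<gamma>: "mm_space (\<gamma> t)" "mm_parameter (\<gamma> t) (\<Phi> t)" "mm_dist (\<gamma> t) (\<Phi> t u) (\<Phi> t v) = path_dist t u v"
    if "t \<in> {0..1}" for t u v
    using P that by (auto simp: \<gamma>_def \<Phi>_def)
  have close: "\<exists>I\<in>sets borel. I \<subseteq> {0..<1} \<and> 1 - \<bar>x - y\<bar> * e \<le> measure lborel I \<and>
        (\<forall>u\<in>I. \<forall>v\<in>I. \<bar>mm_dist (\<gamma> x) (\<Phi> x u) (\<Phi> x v) - mm_dist (\<gamma> y) (\<Phi> y u) (\<Phi> y v)\<bar> \<le> \<bar>x - y\<bar> * e)"
    if x: "x \<in> {0..1}" and y: "y \<in> {0..1}" for x y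
  proof -
    let ?l = "1 - e + min x y * e" and ?r = "1 - e + max x y * e"
    have l: "0 \<le> ?l" "?l \<le> ?r"
      using x y e by (auto intro!: add_nonneg_nonneg mult_right_mono)
    have r: "?r \<le> 1"
      using x y e mult_right_mono[of "max x y" 1 e] by auto
    \<comment> \<open>Exactly the points that change copies between the times \<open>x\<close> and
      \<open>y\<close> are removed; they form an interval of length
      \<open>\<bar>x - y\<bar> * e\<close>.\<close>
    define I where "I = {0..<1} - {?l..<?r}"
    have "measure lborel I = measure unit_interval_L I"
      by (rule measure_unit_interval_L[symmetric]) (auto simp: I_def)
    also have "\<dots> = 1 - measure unit_interval_L {?l..<?r}"
      unfolding I_def using UL.prob_compl[of "{?l..<?r}"] l r by (simp add: sets_unit_interval_L)
    also have "measure unit_interval_L {?l..<?r} = ?r - ?l"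
      using l r by (subst measure_unit_interval_L) auto
    also have "?r - ?l = \<bar>x - y\<bar> * e"
      by (auto simp: min_def max_def algebra_simps)
    finally have m: "measure lborel I = 1 - \<bar>x - y\<bar> * e" .
    have same: "moved x u = moved y u" if "u \<in> I" for u
      using that l by (auto simp: I_def moved_def min_def max_def split: if_splits)
    show ?thesis
    proof (intro bexI[of _ I] conjI ballI)
      fix u v assume u: "u \<in> I" and v: "v \<in> I"
      show "\<bar>mm_dist (\<gamma> x) (\<Phi> x u) (\<Phi> x v) - mm_dist (\<gamma> y) (\<Phi> y u) (\<Phi> y v)\<bar> \<le> \<bar>x - y\<bar> * e"
        unfolding \<gamma>(3)[OF x] \<gamma>(3)[OF y]
        by (rule path_dist_lipschitz[OF x y]) (use u v same in \<open>auto simp: I_def\<close>)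
    qed (use m in \<open>auto simp: I_def\<close>)
  qed
  have atom: "atomic_mass (\<gamma> t) = core_mass + a * e" if t: "t \<in> {0<..<1}" for t
  proof -
    have t': "t \<in> {0..1}" using t by auto
    interpret mm "\<gamma> t" by (rule mm.intro[OF \<gamma>(1)[OF t']])
    have "heavy t = {u \<in> {0..<1}. \<Phi> t u \<in> atoms (\<gamma> t)}"
      using heavy_parameter[OF \<gamma>(2)[OF t']] by (simp add: heavy_def zero_set_def \<gamma>(3)[OF t'])
    moreover have "{u \<in> {0..<1}. \<Phi> t u \<in> atoms (\<gamma> t)} \<in> sets unit_interval_L"
      by (rule sets_atoms_parameter[OF \<gamma>(2)[OF t']])
    ultimately show ?thesis
      using measure_heavy[OF t] atomic_mass_parameter[OF \<gamma>(2)[OF t']]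
      by (simp add: heavy_def zero_set_def \<gamma>(3)[OF t'])
  qed
  have ends: "mm_dist (\<gamma> 0) (\<Phi> 0 u) (\<Phi> 0 v) = A u v \<and> mm_dist (\<gamma> 1) (\<Phi> 1 u) (\<Phi> 1 v) = B u v"
    if "u \<in> {0..<1}" "v \<in> {0..<1}" for u v
    using \<gamma>(3)[of 0 u v] \<gamma>(3)[of 1 u v] path_dist_0[OF that] path_dist_1[OF that] by simp
  show ?thesis
    using \<gamma>(1,2) close atom ends by (intro exI[of _ \<gamma>] exI[of _ \<Phi>]) blast
qed

end

section \<open>Assembly of the geodesics and their disjointness\<close>

lemma box_dist_commute: "box_dist X Y = box_dist Y X"
proof -
  have "box_set X Y \<subseteq> box_set Y X" for X :: "'x mmspace" and Y :: "'y mmspace"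
    unfolding box_set_def by (clarsimp simp: abs_minus_commute) blast
  then show ?thesis unfolding box_dist_eq_Inf by (metis subset_antisym)
qed

text \<open>Parameters are controlled only on \<open>{0..<1}\<close>, while
  \<open>distortion\<close> asks for pseudometrics and Borel functions on the whole line;
  precomposing with this retraction supplies them.\<close>

definition into_unit :: "real \<Rightarrow> real" where
  "into_unit u = (if u \<in> {0..<1} then u else 0)"

lemma into_unit_in [simp]: "0 \<le> into_unit u" "into_unit u < 1"
  by (auto simp: into_unit_def)

lemma into_unit_id [simp]: "u \<in> {0..<1} \<Longrightarrow> into_unit u = u"
  by (simp add: into_unit_def)

lemma into_unit_measurable: "into_unit \<in> borel \<rightarrow>\<^sub>M unit_interval_L"
  unfolding unit_interval_L_def
proof (rule measurable_restrict_space2)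
  show "into_unit \<in> borel \<rightarrow>\<^sub>M lborel" unfolding into_unit_def by measurable
qed auto

context mm
begin

lemma parameter_pseudometric:
  assumes \<phi>: "mm_parameter X \<phi>"
  defines "\<rho> \<equiv> \<lambda>u v. d (\<phi> (into_unit u)) (\<phi> (into_unit v))"
  shows "pseudometric \<rho>" "separable_pm \<rho>" "\<And>u. \<rho> u \<in> borel_measurable borel"
proof -
  have S: "\<phi> (into_unit u) \<in> S" for u by (rule parameter_in[OF \<phi>]) simp
  show "pseudometric \<rho>"
    unfolding pseudometric_def \<rho>_def using S by (auto simp: commute intro: triangle)
  show "separable_pm \<rho>"
    unfolding separable_pm_def
  proof (intro allI impI)
    fix e :: real assume e: "e > 0"
    obtain m where m: "(1/2 :: real) ^ m < e / 2"
      using real_arch_pow_inv[of "e / 2" "1 / 2"] e by auto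
    have "\<rho> u v < e" if eq: "code m (\<phi> (into_unit u)) = code m (\<phi> (into_unit v))" for u v
      using code_dist[OF S[of u], of m] code_dist[OF S[of v], of m] m
        triangle''[OF S[of u] xs_in[of "code m (\<phi> (into_unit u))"] S[of v]] eq
      unfolding \<rho>_def by simp
    then show "\<exists>k :: real \<Rightarrow> nat. \<forall>x y. k x = k y \<longrightarrow> \<rho> x y < e"
      by (intro exI[of _ "\<lambda>u. code m (\<phi> (into_unit u))"]) blast
  qed
  have m: "(\<lambda>v. \<phi> (into_unit v)) \<in> borel \<rightarrow>\<^sub>M \<mu>"
    using measurable_compose[OF into_unit_measurable, of \<phi> \<mu>] \<phi> by (simp add: mm_parameter_def)
  show "\<rho> u \<in> borel_measurable borel" for u
    unfolding \<rho>_def by (rule dist_measurable[OF m S])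
qed

end

theorem theorem6p4:
  fixes X0 :: "'a mmspace" and X1 :: "'b mmspace"
  assumes "mm_space X0" and "mm_space X1" and "\<not> mm_iso X0 X1"
  shows "\<exists>G :: (real \<Rightarrow> real mmspace) set. uncountable G \<and>
           (\<forall>\<gamma>\<in>G. box_geodesic X0 X1 \<gamma>) \<and>
           (\<forall>\<gamma>\<in>G. \<forall>\<gamma>'\<in>G. \<gamma> \<noteq> \<gamma>' \<longrightarrow>
              (\<forall>s\<in>{0<..<1}. \<forall>t\<in>{0<..<1}. \<not> mm_iso (\<gamma> s) (\<gamma>' t)))"
proof -
  interpret X: mm X0 by (rule mm.intro) fact
  interpret Y: mm X1 by (rule mm.intro) fact
  define e where "e = box_dist X0 X1"
  have e: "0 < e" "e \<le> 1"
    using box_dist_pos[OF assms] box_dist_le_one[OF assms(1,2)] by (simp_all add: e_def)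
  obtain \<phi> \<psi> where \<phi>: "mm_parameter X0 \<phi>" and \<psi>: "mm_parameter X1 \<psi>"
    and dis: "\<And>s t. s \<in> {0..<1 - e} \<Longrightarrow> t \<in> {0..<1 - e} \<Longrightarrow> \<bar>mm_dist X0 (\<phi> s) (\<phi> t) - mm_dist X1 (\<psi> s) (\<psi> t)\<bar> \<le> e"
    using box_dist_attained[OF assms(1,2)] unfolding e_def by blast
  define A where "A = (\<lambda>u v. mm_dist X0 (\<phi> (into_unit u)) (\<phi> (into_unit v)))"
  define B where "B = (\<lambda>u v. mm_dist X1 (\<psi> (into_unit u)) (\<psi> (into_unit v)))"
  have A: "A u v = mm_dist X0 (\<phi> u) (\<phi> v)" and B: "B u v = mm_dist X1 (\<psi> u) (\<psi> v)"
    if "u \<in> {0..<1}" "v \<in> {0..<1}" for u v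
    using that by (simp_all add: A_def B_def)
  interpret D: distortion A B e
  proof
    show "\<bar>A u v - B u v\<bar> \<le> e" if "u \<in> {0..<1 - e}" "v \<in> {0..<1 - e}" for u v
      using dis[OF that] that e A[of u v] B[of u v] by simp
  qed (use X.parameter_pseudometric[OF \<phi>] Y.parameter_pseudometric[OF \<psi>] e in \<open>auto simp: A_def B_def\<close>)
  have "\<exists>q idx. \<forall>n. idx n \<in> borel \<rightarrow>\<^sub>M count_space (UNIV :: nat set) \<and>
      (\<forall>u. D.glued (j, u) (j, q (idx n u)) \<le> e / 24 * (1/2) ^ n)" for j
    using ex_discretization[OF D.A, of "e / 24"] ex_discretization[OF D.B, of "e / 24"] e
    by (cases j) simp_all
  then obtain q idx where q: "\<And>j n. idx j n \<in> borel \<rightarrow>\<^sub>M count_space (UNIV :: nat set)"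
    "\<And>j n u. D.glued (j, u) (j, q j (idx j n u)) \<le> e / 24 * (1/2) ^ n"
    by metis
  \<comment> \<open>\<open>core_mass\<close> is fixed before the portion \<open>a\<close> is chosen,
    so the same \<open>k\<close> serves all geodesics.\<close>
  define k where "k = D.core_mass"
  have "\<forall>a\<in>{0<..<1}. \<exists>\<gamma> :: real \<Rightarrow> real mmspace. box_geodesic X0 X1 \<gamma> \<and>
      (\<forall>t\<in>{0<..<1}. mm_space (\<gamma> t) \<and> atomic_mass (\<gamma> t) = k + a * e)"
  proof
    fix a :: real assume a: "a \<in> {0<..<1}"
    interpret P: distortion_path A B e a q idx
      by unfold_locales (use a q in auto)
    obtain \<gamma> :: "real \<Rightarrow> real mmspace" and \<Phi> where
      g': "\<forall>t\<in>{0..1}. mm_space (\<gamma> t) \<and> mm_parameter (\<gamma> t) (\<Phi> t)"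
      and ends': "\<forall>u\<in>{0..<1}. \<forall>v\<in>{0..<1}. mm_dist (\<gamma> 0) (\<Phi> 0 u) (\<Phi> 0 v) = A u v \<and>
        mm_dist (\<gamma> 1) (\<Phi> 1 u) (\<Phi> 1 v) = B u v"
      and close: "\<forall>x\<in>{0..1}. \<forall>y\<in>{0..1}. \<exists>I\<in>sets borel. I \<subseteq> {0..<1} \<and> 1 - \<bar>x - y\<bar> * e \<le> measure lborel I \<and>
        (\<forall>u\<in>I. \<forall>v\<in>I. \<bar>mm_dist (\<gamma> x) (\<Phi> x u) (\<Phi> x v) - mm_dist (\<gamma> y) (\<Phi> y u) (\<Phi> y v)\<bar> \<le> \<bar>x - y\<bar> * e)"
      and atom': "\<forall>t\<in>{0<..<1}. atomic_mass (\<gamma> t) = k + a * e"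
      using P.ex_path[folded k_def] by (elim exE conjE) (rule that)
    have g: "mm_space (\<gamma> t)" "mm_parameter (\<gamma> t) (\<Phi> t)" if "t \<in> {0..1}" for t
      using g' that by auto
    have ends: "mm_dist (\<gamma> 0) (\<Phi> 0 u) (\<Phi> 0 v) = A u v" "mm_dist (\<gamma> 1) (\<Phi> 1 u) (\<Phi> 1 v) = B u v"
      if "u \<in> {0..<1}" "v \<in> {0..<1}" for u v
      using ends' that by auto
    have close: "\<exists>I\<in>sets borel. I \<subseteq> {0..<1} \<and> 1 - \<bar>x - y\<bar> * e \<le> measure lborel I \<and>
        (\<forall>u\<in>I. \<forall>v\<in>I. \<bar>mm_dist (\<gamma> x) (\<Phi> x u) (\<Phi> x v) - mm_dist (\<gamma> y) (\<Phi> y u) (\<Phi> y v)\<bar> \<le> \<bar>x - y\<bar> * e)"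
      if "x \<in> {0..1}" "y \<in> {0..1}" for x y
      using close that by blast
    have atom: "atomic_mass (\<gamma> t) = k + a * e" if "t \<in> {0<..<1}" for t
      using atom' that by blast
    have le: "box_dist (\<gamma> x) (\<gamma> y) \<le> \<bar>x - y\<bar> * e" if x: "x \<in> {0..1}" and y: "y \<in> {0..1}" for x y
    proof -
      obtain I where "I \<in> sets borel" "I \<subseteq> {0..<1}" "1 - \<bar>x - y\<bar> * e \<le> measure lborel I"
        "\<forall>u\<in>I. \<forall>v\<in>I. \<bar>mm_dist (\<gamma> x) (\<Phi> x u) (\<Phi> x v) - mm_dist (\<gamma> y) (\<Phi> y u) (\<Phi> y v)\<bar> \<le> \<bar>x - y\<bar> * e"
        using close[OF x y] by blast
      then show ?thesis
        using g(2)[OF x] g(2)[OF y] e by (intro box_dist_le[of _ "\<Phi> x" _ "\<Phi> y" I]) auto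
    qed
    \<comment> \<open>\<open>\<Phi> 0\<close> and \<open>\<phi>\<close> have the same pulled-back
      distances, so \<open>\<phi>\<close> can replace \<open>\<Phi> 0\<close> and the estimate
      between the times 0 and \<open>y\<close> holds for \<open>X0\<close> itself.\<close>
    have le0: "box_dist X0 (\<gamma> y) \<le> y * e" if y: "y \<in> {0..1}" for y
    proof -
      obtain I where I: "I \<in> sets borel" "I \<subseteq> {0..<1}" "1 - \<bar>0 - y\<bar> * e \<le> measure lborel I"
        "\<And>u v. u \<in> I \<Longrightarrow> v \<in> I \<Longrightarrow> \<bar>mm_dist (\<gamma> 0) (\<Phi> 0 u) (\<Phi> 0 v) - mm_dist (\<gamma> y) (\<Phi> y u) (\<Phi> y v)\<bar> \<le> \<bar>0 - y\<bar> * e"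
        using close[of 0 y] y by auto
      show ?thesis
      proof (rule box_dist_le[OF \<phi> g(2)[OF y] I(1,2)])
        fix u v assume uv: "u \<in> I" "v \<in> I"
        then have "u \<in> {0..<1}" "v \<in> {0..<1}" using I(2) by auto
        then show "\<bar>mm_dist X0 (\<phi> u) (\<phi> v) - mm_dist (\<gamma> y) (\<Phi> y u) (\<Phi> y v)\<bar> \<le> y * e"
          using I(4)[OF uv] y by (simp add: ends A)
      qed (use I(3) y e in auto)
    qed
    have le1: "box_dist (\<gamma> x) X1 \<le> (1 - x) * e" if x: "x \<in> {0..1}" for x
    proof -
      obtain I where I: "I \<in> sets borel" "I \<subseteq> {0..<1}" "1 - \<bar>x - 1\<bar> * e \<le> measure lborel I"
        "\<And>u v. u \<in> I \<Longrightarrow> v \<in> I \<Longrightarrow> \<bar>mm_dist (\<gamma> x) (\<Phi> x u) (\<Phi> x v) - mm_dist (\<gamma> 1) (\<Phi> 1 u) (\<Phi> 1 v)\<bar> \<le> \<bar>x - 1\<bar> * e"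
        using close[of x 1] x by auto
      show ?thesis
      proof (rule box_dist_le[OF g(2)[OF x] \<psi> I(1,2)])
        fix u v assume uv: "u \<in> I" "v \<in> I"
        then have "u \<in> {0..<1}" "v \<in> {0..<1}" using I(2) by auto
        then show "\<bar>mm_dist (\<gamma> x) (\<Phi> x u) (\<Phi> x v) - mm_dist X1 (\<psi> u) (\<psi> v)\<bar> \<le> (1 - x) * e"
          using I(4)[OF uv] x by (simp add: ends B)
      qed (use I(3) x e in auto)
    qed
    \<comment> \<open>The route \<open>X0\<close>, \<open>\<gamma> x\<close>,
      \<open>\<gamma> y\<close>, \<open>X1\<close> has length at least \<open>e\<close>, and its
      outer legs use at most \<open>x * e\<close> and \<open>(1 - y) * e\<close>. For
      \<open>y < x\<close> the bound is trivial; the swapped instance is used then.\<close>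
    have ge: "(y - x) * e \<le> box_dist (\<gamma> x) (\<gamma> y)" if x: "x \<in> {0..1}" and y: "y \<in> {0..1}" for x y
    proof -
      have "e \<le> box_dist X0 (\<gamma> x) + box_dist (\<gamma> x) X1"
        unfolding e_def by (rule box_dist_triangle[OF assms(1) g(1)[OF x] assms(2)])
      also have "box_dist (\<gamma> x) X1 \<le> box_dist (\<gamma> x) (\<gamma> y) + box_dist (\<gamma> y) X1"
        by (rule box_dist_triangle[OF g(1)[OF x] g(1)[OF y] assms(2)])
      finally have "e \<le> x * e + (box_dist (\<gamma> x) (\<gamma> y) + (1 - y) * e)"
        using le0[OF x] le1[OF y] by linarith
      then show ?thesis by (simp add: algebra_simps)
    qed
    have "box_dist (\<gamma> x) (\<gamma> y) = \<bar>x - y\<bar> * e" if x: "x \<in> {0..1}" and y: "y \<in> {0..1}" for x y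
      using le[OF x y] ge[OF x y] ge[OF y x] box_dist_commute[of "\<gamma> x" "\<gamma> y"]
      by (cases "x \<le> y") (auto simp: abs_if split: if_splits)
    moreover have "mm_iso (\<gamma> 0) X0"
    proof -
      have "mm_match (\<gamma> 0) X0 (\<Phi> 0) \<phi> {0..<1}"
        using assms(1) g[of 0] \<phi> ends A by unfold_locales (auto simp: sets_unit_interval_L measure_unit_interval_L)
      then show ?thesis by (rule mm_match.mm_iso)
    qed
    moreover have "mm_iso (\<gamma> 1) X1"
    proof -
      have "mm_match (\<gamma> 1) X1 (\<Phi> 1) \<psi> {0..<1}"
        using assms(2) g[of 1] \<psi> ends B by unfold_locales (auto simp: sets_unit_interval_L measure_unit_interval_L)
      then show ?thesis by (rule mm_match.mm_iso)
    qed
    ultimately have "box_geodesic X0 X1 \<gamma>"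
      using g(1) by (simp add: box_geodesic_def e_def)
    then show "\<exists>\<gamma> :: real \<Rightarrow> real mmspace. box_geodesic X0 X1 \<gamma> \<and>
      (\<forall>t\<in>{0<..<1}. mm_space (\<gamma> t) \<and> atomic_mass (\<gamma> t) = k + a * e)"
      using atom g(1) by (intro exI[of _ \<gamma>]) auto
  qed
  then obtain \<Gamma> :: "real \<Rightarrow> real \<Rightarrow> real mmspace" where
    geo: "\<And>a. a \<in> {0<..<1} \<Longrightarrow> box_geodesic X0 X1 (\<Gamma> a)"
    and sp: "\<And>a t. a \<in> {0<..<1} \<Longrightarrow> t \<in> {0<..<1} \<Longrightarrow> mm_space (\<Gamma> a t)"
    and am: "\<And>a t. a \<in> {0<..<1} \<Longrightarrow> t \<in> {0<..<1} \<Longrightarrow> atomic_mass (\<Gamma> a t) = k + a * e"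
    by metis
  have inj: "inj_on \<Gamma> {0<..<1}"
  proof
    fix a b :: real assume a: "a \<in> {0<..<1}" and b: "b \<in> {0<..<1}" and eq: "\<Gamma> a = \<Gamma> b"
    \<comment> \<open>Any intermediate time tells the curves apart; 1/2 is a convenient one.\<close>
    have half: "1/2 \<in> {0<..<1 :: real}" by simp
    have "k + a * e = k + b * e"
      using am[OF a half] am[OF b half] unfolding eq by linarith
    then show "a = b" using e(1) mult_cancel_right[of a e b] by linarith
  qed
  show ?thesis
  proof (intro exI[of _ "\<Gamma> ` {0<..<1}"] conjI ballI impI)
    have "uncountable {0<..<1 :: real}"
      by (simp add: uncountable_open_interval)
    then show "uncountable (\<Gamma> ` {0<..<1})"
      using countable_image_inj_on[OF _ inj] by blast
  next
    fix \<gamma> assume "\<gamma> \<in> \<Gamma> ` {0<..<1}"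
    then show "box_geodesic X0 X1 \<gamma>" using geo by blast
  next
    fix \<gamma> \<gamma>' :: "real \<Rightarrow> real mmspace" and s t :: real
    assume "\<gamma> \<in> \<Gamma> ` {0<..<1}" "\<gamma>' \<in> \<Gamma> ` {0<..<1}" and ne: "\<gamma> \<noteq> \<gamma>'" and s: "s \<in> {0<..<1}" and t: "t \<in> {0<..<1}"
    then obtain a b where ab: "a \<in> {0<..<1}" "b \<in> {0<..<1}" "\<gamma> = \<Gamma> a" "\<gamma>' = \<Gamma> b" by blast
    show "\<not> mm_iso (\<gamma> s) (\<gamma>' t)"
    proof
      assume "mm_iso (\<gamma> s) (\<gamma>' t)"
      then have "k + a * e = k + b * e"
        using mm_iso_atomic_mass[OF sp[OF ab(1) s] sp[OF ab(2) t]] am[OF ab(1) s] am[OF ab(2) t] ab by simp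
      then show False using e ne ab by auto
    qed
  qed
qed

end
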